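(* Let $C:f=0$ be a reduced curve of degree $d$ in $\mathbb{P}^2=\mathbb{P}^2_{\mathbb{C}}$ with $mdr(f)>0$, and let $S_1,\dots,S_r$ be the list of the analytic isomorphism classes of all its singularities. Suppose that the analytic space $\mathcal{V}_d^{ea}(S_1,\dots,S_r)$ is smooth at the point $C$ of the expected dimension $$\frac{d(d+3)}{2}-\tau(C).$$ Then one has the following. (1) If the curve $C$ is free, then the degree $d$ of $C$ is at most $7$. (2) If the curve $C$ is nearly free, then the degree $d$ of $C$ is at most $8$.
   Context: Let $S=\mathbb{C}[x,y,z]$ with its standard grading, $f\in S_d$ a reduced homogeneous polynomial of degree $d$, and $f_x,f_y,f_z$ its partial derivatives. Syzygies and Jacobian module. $J_f=(f_x,f_y,f_z)\subset S$ is the Jacobian ideal, $I_f$ is its saturation with respect to $(x,y,z)$, $N(f)=I_f/J_f$ is the (graded) Jacobian module, and $\nu(C)=\max_j \dim_{\mathbb{C}} N(f)_j$. The curve $C$ is free if $\nu(C)=0$ (equivalently $J_f=I_f$), and nearly free if $\nu(C)=1$. Set $AR(f)_m=\{(a,b,c)\in S_m^3 : af_x+bf_y+cf_z=0\}$ and $mdr(f)=\min\{m\ge 0: AR(f)_m\neq0\}$. (One has $mdr(f)=0$ iff $C$ consists of $d$ concurrent lines.) The Tjurina number of an isolated plane curve singularity $(C,p)$ with local equation $g(u,v)=0$ is $\tau(C,p)=\dim_{\mathbb{C}}\mathbb{C}\{u,v\}/(g,g_u,g_v)$, and $\tau(C)=\sum_p\tau(C,p)$, the sum over the singular points of $C$,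 is the total Tjurina number. Equianalytic strata. Let $\mathbb{P}^N=\mathbb{P}(S_d)$, $N=d(d+3)/2$, be the space of degree $d$ plane curves. $V_d^{ea}(S_1,\dots,S_r)\subset\mathbb{P}^N$ is the set of reduced degree $d$ curves having precisely $r$ singular points, which are analytically isomorphic to the isolated plane curve singularities $S_1,\dots,S_r$. It carries a natural, possibly non-reduced, complex analytic subspace structure $\mathcal{V}_d^{ea}(S_1,\dots,S_r)\subset \mathbb{P}^N$, characterized by the property that it parametrizes equianalytic families of such curves. Locally at a curve $C$ with singular points $p_1,\dots,p_r$: the universal family of degree $d$ curves induces a map germ $(\mathbb{P}^N,C)\to\prod_{j}(B_j,0)$, where $(B_j,0)$ is the (smooth) base of the miniversal deformation of the singularity $(C,p_j)$, and the germ of $\mathcal{V}_d^{ea}(S_1,\dots,S_r)$ at $C$ is the (scheme-theoretic) fibre of this map over the reduced point $0$. *)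

theory Defs
  imports
    "HOL-Analysis.Analysis"
    "HOL-Library.Poly_Mapping"
    "HOL-Library.Extended_Nat"
    "HOL-Computational_Algebra.Squarefree"
begin

section \<open>Monomials and quotient dimensions\<close>

definition mdeg :: "('v \<Rightarrow>\<^sub>0 nat) \<Rightarrow> nat" where
  "mdeg m = (\<Sum>x\<in>Poly_Mapping.keys m. Poly_Mapping.lookup m x)"

text \<open>
  The dimension of \<open>V / W\<close> for complex subspaces \<open>W \<subseteq> V\<close> (scalar multiplication \<open>sc\<close>): the
  number of elements of a basis of a complement of \<open>W\<close> in \<open>V\<close>. It is meant for
  finite-dimensional quotients only and is unspecified otherwise.
\<close>

definition quot_dim :: "(complex \<Rightarrow> 'a::ab_group_add \<Rightarrow> 'a) \<Rightarrow> 'a set \<Rightarrow> 'a set \<Rightarrow> nat" where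
  "quot_dim sc V W = (THE n. \<exists>B. B \<subseteq> V \<and> finite B \<and> card B = n \<and>
      \<not> module.dependent sc B \<and> module.span sc B \<inter> W = {0} \<and>
      V = {b + w | b w. b \<in> module.span sc B \<and> w \<in> W})"


section \<open>Homogeneous polynomials in three variables and the Jacobian module\<close>

datatype hvar = X | Y | Z

type_synonym hpoly = "(hvar \<Rightarrow>\<^sub>0 nat) \<Rightarrow>\<^sub>0 complex"

definition pscale :: "complex \<Rightarrow> hpoly \<Rightarrow> hpoly" where
  "pscale c p = Poly_Mapping.single 0 c * p"

definition forms :: "nat \<Rightarrow> hpoly set" where
  "forms d = {p. \<forall>m\<in>Poly_Mapping.keys p. mdeg m = d}"

definition pdv :: "hvar \<Rightarrow> hpoly \<Rightarrow> hpoly" where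
  "pdv x p = (\<Sum>m\<in>Poly_Mapping.keys p.
      Poly_Mapping.single (m - Poly_Mapping.single x 1)
        (of_nat (Poly_Mapping.lookup m x) * Poly_Mapping.lookup p m))"

definition jacobian_ideal :: "hpoly \<Rightarrow> hpoly set" where
  "jacobian_ideal f = {a * pdv X f + b * pdv Y f + c * pdv Z f | a b c. True}"

text \<open>The power \<open>(x,y,z)^k\<close> is generated by \<open>forms k\<close>.\<close>

definition saturated_jacobian_ideal :: "hpoly \<Rightarrow> hpoly set" where
  "saturated_jacobian_ideal f = {h. \<exists>k. \<forall>q\<in>forms k. q * h \<in> jacobian_ideal f}"

definition jacobian_module_dim :: "hpoly \<Rightarrow> nat \<Rightarrow> nat" where
  "jacobian_module_dim f j =
     quot_dim pscale (saturated_jacobian_ideal f \<inter> forms j) (jacobian_ideal f \<inter> forms j)"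

text \<open>
  The maximum over all degrees is written as a supremum in \<^typ>\<open>enat\<close>; since \<open>N(f)\<close> has
  finite length the supremum is finite and attained.
\<close>

definition nu :: "hpoly \<Rightarrow> enat" where
  "nu f = (SUP j. enat (jacobian_module_dim f j))"

definition free_curve :: "hpoly \<Rightarrow> bool" where
  "free_curve f \<longleftrightarrow> nu f = 0"

definition nearly_free_curve :: "hpoly \<Rightarrow> bool" where
  "nearly_free_curve f \<longleftrightarrow> nu f = 1"

definition AR :: "hpoly \<Rightarrow> nat \<Rightarrow> (hpoly \<times> hpoly \<times> hpoly) set" where
  "AR f m = {(a, b, c). a \<in> forms m \<and> b \<in> forms m \<and> c \<in> forms m \<and>
      a * pdv X f + b * pdv Y f + c * pdv Z f = 0}"

definition mdr :: "hpoly \<Rightarrow> nat" where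
  "mdr f = (LEAST m. AR f m \<noteq> {(0, 0, 0)})"

definition reduced_form :: "nat \<Rightarrow> hpoly \<Rightarrow> bool" where
  "reduced_form d f \<longleftrightarrow> f \<in> forms d \<and> f \<noteq> 0 \<and> squarefree f"


section \<open>Points of the projective plane\<close>

text \<open>Every point has exactly one representative whose first nonzero coordinate is 1.\<close>

definition proj_plane :: "(hvar \<Rightarrow> complex) set" where
  "proj_plane = {p. p X = 1 \<or> (p X = 0 \<and> p Y = 1) \<or> (p X = 0 \<and> p Y = 0 \<and> p Z = 1)}"

definition peval :: "(hvar \<Rightarrow> complex) \<Rightarrow> hpoly \<Rightarrow> complex" where
  "peval p q = (\<Sum>m\<in>Poly_Mapping.keys q. Poly_Mapping.lookup q m *
      (\<Prod>x\<in>{X, Y, Z}. p x ^ Poly_Mapping.lookup m x))"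

definition singular_points :: "hpoly \<Rightarrow> (hvar \<Rightarrow> complex) set" where
  "singular_points f = {p \<in> proj_plane. peval p f = 0 \<and> (\<forall>x. peval p (pdv x f) = 0)}"


section \<open>Formal power series in several variables\<close>

typedef 'v mps = "UNIV :: (('v \<Rightarrow>\<^sub>0 nat) \<Rightarrow> complex) set"
  morphisms coeff Mps ..

setup_lifting type_definition_mps

lemma mps_eqI: "(\<And>m. coeff F m = coeff G m) \<Longrightarrow> F = G"
  by (metis coeff_inject ext)

lemma finite_monomial_divisors:
  fixes m :: "'v \<Rightarrow>\<^sub>0 nat"
  shows "finite {a. \<forall>x. Poly_Mapping.lookup a x \<le> Poly_Mapping.lookup m x}" (is "finite ?S")
proof -
  let ?K = "Poly_Mapping.keys m"
  let ?B = "\<Union>x\<in>?K. {..Poly_Mapping.lookup m x}"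
  have "finite {f. \<forall>x. (x \<in> ?K \<longrightarrow> f x \<in> ?B) \<and> (x \<notin> ?K \<longrightarrow> f x = (0::nat))}"
    by (rule finite_set_of_finite_funs) auto
  moreover have "Poly_Mapping.lookup ` ?S
      \<subseteq> {f. \<forall>x. (x \<in> ?K \<longrightarrow> f x \<in> ?B) \<and> (x \<notin> ?K \<longrightarrow> f x = 0)}"
  proof (intro image_subsetI CollectI allI conjI impI)
    fix a x assume a: "a \<in> ?S"
    then have le: "Poly_Mapping.lookup a x \<le> Poly_Mapping.lookup m x" by blast
    { assume "x \<in> ?K" then show "Poly_Mapping.lookup a x \<in> ?B" using le by blast }
    { assume "x \<notin> ?K" then show "Poly_Mapping.lookup a x = 0" using le by (simp add: in_keys_iff) }
  qed
  ultimately have "finite (Poly_Mapping.lookup ` ?S)"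
    by (rule rev_finite_subset)
  moreover have "inj_on Poly_Mapping.lookup ?S"
    by (simp add: inj_on_def)
  ultimately show ?thesis
    by (rule finite_imageD)
qed

lemma finite_monomial_splittings:
  fixes m :: "'v \<Rightarrow>\<^sub>0 nat"
  shows "finite {(a, b). a + b = m}"
proof (rule finite_subset)
  let ?S = "{a. \<forall>x. Poly_Mapping.lookup a x \<le> Poly_Mapping.lookup m x}"
  show "{(a, b). a + b = m} \<subseteq> ?S \<times> ?S"
    by (auto simp only: mem_Collect_eq case_prod_conv mem_Times_iff fst_conv snd_conv
        lookup_add le_add1 le_add2)
  show "finite (?S \<times> ?S)"
    using finite_monomial_divisors by blast
qed

instantiation mps :: (type) comm_ring_1
begin

lift_definition zero_mps :: "'a mps" is "\<lambda>_. 0" .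
lift_definition one_mps :: "'a mps" is "\<lambda>m. if m = 0 then 1 else 0" .
lift_definition plus_mps :: "'a mps \<Rightarrow> 'a mps \<Rightarrow> 'a mps" is "\<lambda>F G m. F m + G m" .
lift_definition minus_mps :: "'a mps \<Rightarrow> 'a mps \<Rightarrow> 'a mps" is "\<lambda>F G m. F m - G m" .
lift_definition uminus_mps :: "'a mps \<Rightarrow> 'a mps" is "\<lambda>F m. - F m" .
lift_definition times_mps :: "'a mps \<Rightarrow> 'a mps \<Rightarrow> 'a mps"
  is "\<lambda>F G m. \<Sum>(a, b) | a + b = m. F a * G b" .

instance
proof
  fix F G H :: "'a mps"
  show "F + G + H = F + (G + H)" by transfer (simp add: add.assoc)
  show "F + G = G + F" by transfer (simp add: add.commute)
  show "0 + F = F" by transfer simp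
  show "- F + F = 0" by transfer simp
  show "F - G = F + - G" by transfer simp
  show "(0::'a mps) \<noteq> 1" by transfer (metis zero_neq_one)
  show "(F + G) * H = F * H + G * H"
    by transfer (simp add: algebra_simps sum.distrib split_def)
  show "F * G = G * F"
  proof (transfer, rule ext)
    fix F G :: "('a \<Rightarrow>\<^sub>0 nat) \<Rightarrow> complex" and m
    show "(\<Sum>(a, b) | a + b = m. F a * G b) = (\<Sum>(a, b) | a + b = m. G a * F b)"
      by (rule sum.reindex_bij_witness[of _ prod.swap prod.swap])
         (auto simp: add.commute mult.commute)
  qed
  show "1 * F = F"
  proof (transfer, rule ext)
    fix F :: "('a \<Rightarrow>\<^sub>0 nat) \<Rightarrow> complex" and m
    have "(\<Sum>(a, b) | a + b = m. (if a = 0 then 1 else 0) * F b)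
        = (\<Sum>(a, b) \<in> {(0 :: ('a \<Rightarrow>\<^sub>0 nat), m)}. (if a = 0 then 1 else 0) * F b)"
      by (rule sum.mono_neutral_right) (auto simp: finite_monomial_splittings split: if_splits)
    then show "(\<Sum>(a, b) | a + b = m. (if a = 0 then 1 else 0) * F b) = F m"
      by simp
  qed
  show "F * G * H = F * (G * H)"
  proof (transfer, rule ext)
    fix F G H :: "('a \<Rightarrow>\<^sub>0 nat) \<Rightarrow> complex" and m
    have "(\<Sum>(p, c) | p + c = m. (\<Sum>(a, b) | a + b = p. F a * G b) * H c)
        = (\<Sum>q \<in> {(p, c). p + c = m}. \<Sum>r \<in> {(a, b). a + b = fst q}.
              F (fst r) * G (snd r) * H (snd q))"
      by (simp add: split_def sum_distrib_right)
    also have "\<dots> = (\<Sum>(q, r) \<in> (SIGMA q:{(p, c). p + c = m}. {(a, b). a + b = fst q}).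
              F (fst r) * G (snd r) * H (snd q))"
      by (rule sum.Sigma) (auto simp: finite_monomial_splittings)
    also have "\<dots> = (\<Sum>(q, r) \<in> (SIGMA q:{(a, p). a + p = m}. {(b, c). b + c = snd q}).
              F (fst q) * G (fst r) * H (snd r))"
      by (rule sum.reindex_bij_witness[of _
            "\<lambda>((a, p), (b, c)). ((a + b, c), (a, b))" "\<lambda>((p, c), (a, b)). ((a, b + c), (b, c))"])
         (auto simp: add.assoc)
    also have "\<dots> = (\<Sum>q \<in> {(a, p). a + p = m}. \<Sum>r \<in> {(b, c). b + c = snd q}.
              F (fst q) * G (fst r) * H (snd r))"
      by (rule sum.Sigma[symmetric]) (auto simp: finite_monomial_splittings)
    also have "\<dots> = (\<Sum>(a, p) | a + p = m. F a * (\<Sum>(b, c) | b + c = p. G b * H c))"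
      by (simp add: split_def sum_distrib_left mult.assoc)
    finally show "(\<Sum>(p, c) | p + c = m. (\<Sum>(a, b) | a + b = p. F a * G b) * H c)
        = (\<Sum>(a, p) | a + p = m. F a * (\<Sum>(b, c) | b + c = p. G b * H c))" .
  qed
qed

end

definition mconst :: "complex \<Rightarrow> 'v mps" where
  "mconst c = Mps (\<lambda>m. if m = 0 then c else 0)"

definition mvar :: "'v \<Rightarrow> 'v mps" where
  "mvar x = Mps (\<lambda>m. if m = Poly_Mapping.single x 1 then 1 else 0)"

definition mscale :: "complex \<Rightarrow> 'v mps \<Rightarrow> 'v mps" where
  "mscale c F = mconst c * F"

definition mderiv :: "'v \<Rightarrow> 'v mps \<Rightarrow> 'v mps" where
  "mderiv x F = Mps (\<lambda>m. of_nat (Poly_Mapping.lookup m x + 1) *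
      coeff F (m + Poly_Mapping.single x 1))"

text \<open>
  The composite \<open>G(\<sigma>)\<close>. It is meant for series \<open>G\<close> in finitely many variables and for
  substitutions by series without constant term; then monomials of \<open>G\<close> of degree larger than
  that of \<open>m\<close> do not contribute to the coefficient at \<open>m\<close>, and the sum is finite.
\<close>

definition msubst :: "('v \<Rightarrow> 'w mps) \<Rightarrow> 'v mps \<Rightarrow> 'w mps" where
  "msubst \<sigma> G = Mps (\<lambda>m. \<Sum>a | mdeg a \<le> mdeg m \<and> coeff G a \<noteq> 0.
      coeff G a * coeff (\<Prod>x\<in>Poly_Mapping.keys a. \<sigma> x ^ Poly_Mapping.lookup a x) m)"

text \<open>\<open>germs A\<close> is the ring of convergent power series in the (finitely many) variables \<open>A\<close>.\<close>

definition germs :: "'v set \<Rightarrow> 'v mps set" where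
  "germs A = {F. (\<forall>m. coeff F m \<noteq> 0 \<longrightarrow> Poly_Mapping.keys m \<subseteq> A) \<and>
      (\<exists>r>0. (\<lambda>m. norm (coeff F m) * r ^ mdeg m) summable_on UNIV)}"

definition ideal_gen :: "'v mps set \<Rightarrow> 'v mps set \<Rightarrow> 'v mps set" where
  "ideal_gen R S = {\<Sum>s\<in>T. a s * s | T a. finite T \<and> T \<subseteq> S \<and> (\<forall>s\<in>T. a s \<in> R)}"


section \<open>Plane curve singularities and their miniversal deformations\<close>

text \<open>\<open>LU\<close> and \<open>LV\<close> are the coordinates of the plane germ, \<open>Par i\<close> those of the parameter space.\<close>

datatype lvar = LU | LV | Par nat

abbreviation plane_ring :: "lvar mps set" where
  "plane_ring \<equiv> germs {LU, LV}"

abbreviation param_ring :: "nat \<Rightarrow> lvar mps set" where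
  "param_ring n \<equiv> germs (Par ` {..<n})"

abbreviation total_ring :: "nat \<Rightarrow> lvar mps set" where
  "total_ring n \<equiv> germs ({LU, LV} \<union> Par ` {..<n})"

definition param_max_ideal :: "nat \<Rightarrow> lvar mps set" where
  "param_max_ideal n = {F \<in> param_ring n. coeff F 0 = 0}"

definition tjurina :: "lvar mps \<Rightarrow> nat" where
  "tjurina g = quot_dim mscale plane_ring (ideal_gen plane_ring {g, mderiv LU g, mderiv LV g})"

definition special_fibre :: "lvar mps \<Rightarrow> lvar mps" where
  "special_fibre F = Mps (\<lambda>m. if Poly_Mapping.keys m \<subseteq> {LU, LV} then coeff F m else 0)"

text \<open>
  A complex space germ is presented as the subgerm of \<open>(\<complex>^n, 0)\<close> cut out by a set \<open>S\<close> of
  elements of the maximal ideal; \<open>S \<subseteq> S'\<close> means that \<open>S'\<close> cuts out a closed subgerm of it.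
  Every deformation of the plane curve germ \<open>g = 0\<close> over it is, up to isomorphism, an embedded one,
  given by a series \<open>F\<close> with special fibre \<open>g\<close>, considered modulo the ideal generated by \<open>S\<close>.
\<close>

definition is_deformation :: "lvar mps \<Rightarrow> nat \<Rightarrow> lvar mps \<Rightarrow> bool" where
  "is_deformation g n F \<longleftrightarrow> F \<in> total_ring n \<and> special_fibre F = g"

text \<open>
  A morphism from the germ \<open>(n, S)\<close> to \<open>(\<complex>^m, 0)\<close> is an \<open>m\<close>-tuple \<open>\<phi>\<close> in the maximal ideal.
  It induces \<open>F\<close> from \<open>G\<close> if the pullback of \<open>G\<close> by \<open>\<phi>\<close> is isomorphic to \<open>F\<close> as a deformation.
  Such an isomorphism consists of a unit \<open>E\<close> and a family \<open>(A, B)\<close> of coordinate changes of the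
  plane germ, which restrict to the identity on the special fibre.
\<close>

definition induces ::
    "nat \<Rightarrow> lvar mps set \<Rightarrow> nat \<Rightarrow> lvar mps \<Rightarrow> (nat \<Rightarrow> lvar mps) \<Rightarrow> lvar mps \<Rightarrow> bool" where
  "induces n S m G \<phi> F \<longleftrightarrow> (\<forall>i<m. \<phi> i \<in> param_max_ideal n) \<and>
     (\<exists>E\<in>total_ring n. \<exists>A\<in>total_ring n. \<exists>B\<in>total_ring n.
        special_fibre E = 1 \<and> special_fibre A = mvar LU \<and> special_fibre B = mvar LV \<and>
        F - E * msubst (case_lvar A B \<phi>) G \<in> ideal_gen (total_ring n) S)"

definition versal :: "lvar mps \<Rightarrow> nat \<Rightarrow> lvar mps \<Rightarrow> bool" where
  "versal g m G \<longleftrightarrow>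
     (\<forall>n S S' F \<phi>'. S \<subseteq> S' \<longrightarrow> S' \<subseteq> param_max_ideal n \<longrightarrow> is_deformation g n F \<longrightarrow>
        induces n S' m G \<phi>' F \<longrightarrow>
        (\<exists>\<phi>. induces n S m G \<phi> F \<and>
             (\<forall>i<m. \<phi> i - \<phi>' i \<in> ideal_gen (param_ring n) S')))"

definition dir_deriv :: "nat \<Rightarrow> (nat \<Rightarrow> complex) \<Rightarrow> lvar mps \<Rightarrow> complex" where
  "dir_deriv n v h = (\<Sum>k<n. v k * coeff h (Poly_Mapping.single (Par k) 1))"

text \<open>
  Miniversal (= semiuniversal) deformation with smooth base \<open>(\<complex>^m, 0)\<close>: it is versal, and the
  tangent map of an inducing morphism is determined by the induced deformation. The vectors \<open>v\<close>
  annihilated by \<open>S\<close> form the Zariski tangent space of the germ \<open>(n, S)\<close>.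
\<close>

definition miniversal :: "lvar mps \<Rightarrow> nat \<Rightarrow> lvar mps \<Rightarrow> bool" where
  "miniversal g m G \<longleftrightarrow> is_deformation g m G \<and> versal g m G \<and>
     (\<forall>n S F \<phi> \<phi>' v. S \<subseteq> param_max_ideal n \<longrightarrow> is_deformation g n F \<longrightarrow>
        induces n S m G \<phi> F \<longrightarrow> induces n S m G \<phi>' F \<longrightarrow>
        (\<forall>h\<in>S. dir_deriv n v h = 0) \<longrightarrow>
        (\<forall>i<m. dir_deriv n v (\<phi> i) = dir_deriv n v (\<phi>' i)))"


section \<open>Local equations and the total Tjurina number\<close>

text \<open>
  Local affine coordinates at a normalised point \<open>p\<close>: the coordinate of \<open>p\<close> that was normalised
  to 1 is kept fixed, and the other two are translated to the origin.
\<close>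

definition local_coord :: "(hvar \<Rightarrow> complex) \<Rightarrow> hvar \<Rightarrow> lvar mps" where
  "local_coord p =
     (if p X \<noteq> 0 then case_hvar 0 (mvar LU) (mvar LV)
      else if p Y \<noteq> 0 then case_hvar (mvar LU) 0 (mvar LV)
      else case_hvar (mvar LU) (mvar LV) 0)"

definition local_eq :: "(hvar \<Rightarrow> complex) \<Rightarrow> hpoly \<Rightarrow> lvar mps" where
  "local_eq p q = (\<Sum>m\<in>Poly_Mapping.keys q. mconst (Poly_Mapping.lookup q m) *
      (\<Prod>x\<in>{X, Y, Z}. (mconst (p x) + local_coord p x) ^ Poly_Mapping.lookup m x))"

definition total_tjurina :: "hpoly \<Rightarrow> nat" where
  "total_tjurina f = (\<Sum>p\<in>singular_points f. tjurina (local_eq p f))"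


section \<open>The germ of the equianalytic stratum\<close>

definition curve_space_dim :: "nat \<Rightarrow> nat" where
  "curve_space_dim d = d * (d + 3) div 2"

text \<open>
  If \<open>f\<close> and \<open>h 0, \<dots>, h (N - 1)\<close> span the space of forms of degree \<open>d\<close>, whose dimension is
  \<open>N + 1\<close>, they form a basis of it, and the map sending \<open>s\<close> to the class of \<open>f + (\<Sum>i<N. s i * h i)\<close>
  is an affine chart of the projective space of forms, centred at the curve \<open>f = 0\<close>.
\<close>

definition chart_at :: "nat \<Rightarrow> hpoly \<Rightarrow> (nat \<Rightarrow> hpoly) \<Rightarrow> bool" where
  "chart_at d f h \<longleftrightarrow>
     module.span pscale (insert f (h ` {..<curve_space_dim d})) = forms d"

text \<open>The germ at \<open>p\<close> of the universal family of curves of degree \<open>d\<close>, in the chart \<open>h\<close>.\<close>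

definition universal_family ::
    "nat \<Rightarrow> hpoly \<Rightarrow> (nat \<Rightarrow> hpoly) \<Rightarrow> (hvar \<Rightarrow> complex) \<Rightarrow> lvar mps" where
  "universal_family d f h p =
     local_eq p f + (\<Sum>i<curve_space_dim d. mvar (Par i) * local_eq p (h i))"

text \<open>
  \<open>I\<close> is the ideal, in a chart around \<open>f = 0\<close>, of the germ at \<open>f = 0\<close> of the equianalytic stratum
  of curves with the singularities of \<open>f = 0\<close>: it is generated by the components of the map
  to the product of the bases of the miniversal deformations of the singularities, so it defines
  the scheme-theoretic fibre over 0. Different choices of \<open>h\<close>, \<open>m\<close>, \<open>G\<close> and \<open>\<phi>\<close> lead to
  isomorphic germs.
\<close>

definition ea_stratum_ideal :: "nat \<Rightarrow> hpoly \<Rightarrow> lvar mps set \<Rightarrow> bool" where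
  "ea_stratum_ideal d f I \<longleftrightarrow>
     (\<exists>h m G \<phi>. chart_at d f h \<and>
        (\<forall>p\<in>singular_points f.
           miniversal (local_eq p f) (m p) (G p) \<and>
           induces (curve_space_dim d) {} (m p) (G p) (\<phi> p) (universal_family d f h p)) \<and>
        I = ideal_gen (param_ring (curve_space_dim d))
              {\<phi> p i | p i. p \<in> singular_points f \<and> i < m p})"

text \<open>
  The germ defined by \<open>I\<close> in \<open>(\<complex>^n, 0)\<close> is smooth of dimension \<open>k\<close> if it is isomorphic to
  \<open>(\<complex>^k, 0)\<close>, that is, if its local ring is isomorphic, as a complex algebra, to the ring of
  convergent power series in \<open>k\<close> variables.
\<close>

definition smooth_germ :: "nat \<Rightarrow> lvar mps set \<Rightarrow> nat \<Rightarrow> bool" where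
  "smooth_germ n I k \<longleftrightarrow>
     (\<exists>\<alpha>. \<alpha> ` param_ring n = param_ring k \<and>
        (\<forall>F\<in>param_ring n. \<forall>G\<in>param_ring n.
           \<alpha> (F + G) = \<alpha> F + \<alpha> G \<and> \<alpha> (F * G) = \<alpha> F * \<alpha> G) \<and>
        (\<forall>c. \<alpha> (mconst c) = mconst c) \<and>
        {F \<in> param_ring n. \<alpha> F = 0} = I)"

definition ea_stratum_smooth_of_dim :: "nat \<Rightarrow> hpoly \<Rightarrow> int \<Rightarrow> bool" where
  "ea_stratum_smooth_of_dim d f D \<longleftrightarrow>
     (\<exists>I k. ea_stratum_ideal d f I \<and> smooth_germ (curve_space_dim d) I k \<and> int k = D)"

end

theory Submission
  imports Defs "HOL-Computational_Algebra.Fundamental_Theorem_Algebra"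
begin

text \<open>
  Let \<open>T\<^sub>p\<close> be the Tjurina ideal of the curve at a singular point \<open>p\<close>. The first-order part of
  the map to the bases of the miniversal deformations is \<open>S\<^sub>d \<rightarrow> \<Prod> \<O>\<^sub>p / T\<^sub>p\<close>, and smoothness of
  the expected dimension says that it is surjective. If \<open>l\<close> is a linear form that does not vanish
  at the singular points, it is a unit in every \<open>\<O>\<^sub>p\<close>, so \<open>S\<^sub>d\<^sub>+\<^sub>1 = l S\<^sub>d + K\<close>, where \<open>K\<close> is the space
  of forms of degree \<open>d + 1\<close> that lie in all \<open>T\<^sub>p\<close>. By the Nullstellensatz and Nakayama's lemma
  \<open>K\<close> is the degree \<open>d + 1\<close> part of the saturation \<open>I\<^sub>f\<close>. Restricting to the line \<open>l = 0\<close>, the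
  space of binary forms of degree \<open>d + 1\<close>, of dimension \<open>d + 2\<close>, is spanned by the images of \<open>J\<^sub>f\<close>, at
  most 9-dimensional, and of a complement of \<open>J\<^sub>f\<close> in \<open>I\<^sub>f\<close> in this degree. Hence
  \<open>d + 2 \<le> 9 + \<nu>(C)\<close>.
\<close>

text \<open>The stratum enters through the linear parts of its equations. If the chart has dimension
  N and the germ dimension k, then N = \<tau> + k, and the linear parts of the \<tau> components
  \<open>\<phi> p i\<close> together with those of k lifted coordinates form a square system. It is
  injective, since a tangent vector of the germ is determined by its k coordinates, hence solvable
  for every right-hand side: this is the surjectivity. It presupposes that the base of a miniversal
  deformation has dimension \<tau>. As that deformation is known only by its universal property, its
  Kodaira-Spencer classes are tested on deformations over C[t]/(t^2). A second obstacle: the Tjurina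
  ideals consist of convergent series, the saturation of polynomials. Finite colength yields an s
  such that the monomials of degree s lie in the Tjurina ideal up to order s + 1. So series may be
  truncated to polynomials, and a Nakayama lemma without localisation produces a polynomial with
  nonzero value at p that multiplies the given form into the Jacobian ideal on an affine chart. The
  degree d + 1 is that of a linear form times S_d; there the partial derivatives, of degree d - 1,
  have quadratic coefficients.\<close>

abbreviation (input) "single \<equiv> Poly_Mapping.single"
abbreviation (input) "lookup \<equiv> Poly_Mapping.lookup"
abbreviation (input) "keys \<equiv> Poly_Mapping.keys"

section \<open>Linear algebra: systems of equations and complements of subspaces\<close>

text \<open>Gaussian elimination by induction on the equations. With arbitrary index types it
  carries most dimension counts below: instead of comparing dimensions, a nontrivial linear relation
  or functional is produced.\<close>

lemma homogeneous_system_nontrivial_solution: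
  fixes M :: "'r \<Rightarrow> 'k \<Rightarrow> 'a::field"
  assumes "finite R" "finite K" "card R < card K"
  shows "\<exists>v. (\<exists>k\<in>K. v k \<noteq> 0) \<and> (\<forall>r\<in>R. (\<Sum>k\<in>K. M r k * v k) = 0)"
  using assms
proof (induction R arbitrary: K M rule: finite_induct)
  case empty
  then obtain k where "k \<in> K" by fastforce
  then show ?case by (intro exI[of _ "\<lambda>_. 1"]) auto
next
  case (insert r R)
  show ?case
  proof (cases "\<forall>k\<in>K. M r k = 0")
    case True
    have "card R < card K" using insert by simp
    from insert.IH[OF insert.prems(1) this, of M] True show ?thesis by auto
  next
    case False
    then obtain k0 where k0: "k0 \<in> K" "M r k0 \<noteq> 0" by blast
    let ?K = "K - {k0}"
    \<comment> \<open>The remaining equations after equation \<open>r\<close> has been solved for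
      the unknown \<open>k0\<close>.\<close>
    define M' where "M' s k = M s k - M s k0 * M r k / M r k0" for s k
    have "card R < card ?K" using insert k0 by simp
    from insert.IH[OF _ this, of M'] insert.prems obtain v where
      v: "\<exists>k\<in>?K. v k \<noteq> 0" "\<forall>s\<in>R. (\<Sum>k\<in>?K. M' s k * v k) = 0" by auto
    define S where "S = (\<Sum>k\<in>?K. M r k * v k)"
    define w where "w k = (if k = k0 then - S / M r k0 else v k)" for k
    have split: "(\<Sum>k\<in>K. M s k * w k) = (\<Sum>k\<in>?K. M s k * v k) - M s k0 * S / M r k0" for s
    proof -
      have "(\<Sum>k\<in>K. M s k * w k) = M s k0 * w k0 + (\<Sum>k\<in>?K. M s k * w k)"
        using k0 insert.prems(1) by (simp add: sum.remove)
      also have "(\<Sum>k\<in>?K. M s k * w k) = (\<Sum>k\<in>?K. M s k * v k)"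
        by (rule sum.cong) (auto simp: w_def)
      finally show ?thesis by (simp add: w_def)
    qed
    have "(\<Sum>k\<in>K. M s k * w k) = 0" if "s \<in> insert r R" for s
    proof (cases "s = r")
      case True
      then show ?thesis using k0 by (simp add: split S_def)
    next
      case False
      with that v(2) have "0 = (\<Sum>k\<in>?K. M' s k * v k)" by simp
      also have "\<dots> = (\<Sum>k\<in>?K. M s k * v k - M s k0 / M r k0 * (M r k * v k))"
        by (rule sum.cong) (auto simp: M'_def algebra_simps)
      also have "\<dots> = (\<Sum>k\<in>K. M s k * w k)"
        by (simp add: split S_def sum_subtractf sum_distrib_left sum_divide_distrib)
      finally show ?thesis by simp
    qed
    moreover have "\<exists>k\<in>K. w k \<noteq> 0" using v(1) by (auto simp: w_def)
    ultimately show ?thesis by blast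
  qed
qed

text \<open>The right-hand side becomes the column of an extra unknown \<open>None\<close>. The
  enlarged system has one unknown too many, hence a nonzero solution; injectivity forbids that its
  \<open>None\<close> entry vanishes, so it can be scaled to 1.\<close>

lemma square_system_solvable:
  fixes M :: "'r \<Rightarrow> 'k \<Rightarrow> 'a::field"
  assumes "finite R" "finite K" "card R = card K"
    and inj: "\<And>v. (\<forall>r\<in>R. (\<Sum>k\<in>K. M r k * v k) = 0) \<Longrightarrow> \<forall>k\<in>K. v k = 0"
  shows "\<exists>v. \<forall>r\<in>R. (\<Sum>k\<in>K. M r k * v k) = b r"
proof -
  let ?K = "insert None (Some ` K)"
  define M' where "M' r k = (case k of None \<Rightarrow> - b r | Some j \<Rightarrow> M r j)" for r k
  have card: "card ?K = Suc (card K)"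
    using assms(2) by (subst card_insert_disjoint) (auto simp: card_image)
  have sum: "(\<Sum>k\<in>?K. M' r k * v k) = - b r * v None + (\<Sum>k\<in>K. M r k * v (Some k))" for r v
    using assms(2) by (subst sum.insert) (auto simp: M'_def sum.reindex)
  obtain v where v: "\<exists>k\<in>?K. v k \<noteq> 0" "\<forall>r\<in>R. (\<Sum>k\<in>?K. M' r k * v k) = 0"
    using homogeneous_system_nontrivial_solution[of R ?K M'] assms card by auto
  have "v None \<noteq> 0"
  proof
    assume "v None = 0"
    then have "\<forall>k\<in>K. v (Some k) = 0" using v(2) by (intro inj) (auto simp: sum)
    with v(1) \<open>v None = 0\<close> show False by auto
  qed
  then have "(\<Sum>k\<in>K. M r k * (v (Some k) / v None)) = b r" if "r \<in> R" for r
  proof -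
    have "(\<Sum>k\<in>K. M r k * v (Some k)) = b r * v None"
      using v(2) that sum[of r v] by simp
    then show ?thesis using \<open>v None \<noteq> 0\<close> by (simp add: sum_divide_distrib[symmetric])
  qed
  then show ?thesis by (intro exI[of _ "\<lambda>k. v (Some k) / v None"]) simp
qed

text \<open>The condition under the definite description in \<open>quot_dim\<close>, without the
  cardinality, so that two witnesses can be compared.\<close>

definition is_complement :: "(complex \<Rightarrow> 'a::ab_group_add \<Rightarrow> 'a) \<Rightarrow> 'a set \<Rightarrow> 'a set \<Rightarrow> 'a set \<Rightarrow> bool" where
  "is_complement sc V W B \<longleftrightarrow> B \<subseteq> V \<and> finite B \<and> \<not> module.dependent sc B \<and>
     module.span sc B \<inter> W = {0} \<and> V = {b + w | b w. b \<in> module.span sc B \<and> w \<in> W}"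

context
  fixes sc :: "complex \<Rightarrow> 'a::ab_group_add \<Rightarrow> 'a"
  assumes vs: "vector_space sc"
begin

interpretation vector_space sc by (rule vs)

text \<open>Were \<open>B\<close> larger, the coordinates of its elements along \<open>C\<close>
  modulo \<open>W\<close> would satisfy a nontrivial relation. The corresponding combination of
  \<open>B\<close> lies in \<open>W\<close> and in \<open>span B\<close>, hence is 0, against
  independence.\<close>

lemma complement_card_le:
  assumes W: "subspace W" and B: "is_complement sc V W B" and C: "is_complement sc V W C"
  shows "card B \<le> card C"
proof (rule ccontr)
  assume "\<not> card B \<le> card C"
  then have lt: "card C < card B" by simp
  have fin: "finite B" "finite C" using B C by (auto simp: is_complement_def)
  have "\<exists>u. b - (\<Sum>c\<in>C. sc (u c) c) \<in> W" if "b \<in> B" for b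
  proof -
    have "b \<in> V" using B that by (auto simp: is_complement_def)
    then obtain x w where "b = x + w" "x \<in> span C" "w \<in> W"
      using C by (auto simp: is_complement_def)
    moreover obtain u where "x = (\<Sum>c\<in>C. sc (u c) c)"
      using \<open>x \<in> span C\<close> span_finite[OF fin(2)] by auto
    ultimately show ?thesis by (intro exI[of _ u]) simp
  qed
  then obtain u where u: "\<And>b. b \<in> B \<Longrightarrow> b - (\<Sum>c\<in>C. sc (u b c) c) \<in> W" by metis
  obtain v where v: "\<exists>b\<in>B. v b \<noteq> 0" "\<forall>c\<in>C. (\<Sum>b\<in>B. u b c * v b) = 0"
    using homogeneous_system_nontrivial_solution[OF fin(2,1) lt, of "\<lambda>c b. u b c"] by blast
  have "(\<Sum>b\<in>B. sc (v b) (b - (\<Sum>c\<in>C. sc (u b c) c))) \<in> W"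
    by (intro subspace_sum[OF W] subspace_scale[OF W] u)
  also have "(\<Sum>b\<in>B. sc (v b) (b - (\<Sum>c\<in>C. sc (u b c) c)))
      = (\<Sum>b\<in>B. sc (v b) b) - (\<Sum>b\<in>B. \<Sum>c\<in>C. sc (u b c * v b) c)"
    by (simp add: scale_right_diff_distrib sum_subtractf scale_sum_right mult.commute)
  also have "(\<Sum>b\<in>B. \<Sum>c\<in>C. sc (u b c * v b) c) = (\<Sum>c\<in>C. sc (\<Sum>b\<in>B. u b c * v b) c)"
    by (subst sum.swap) (simp add: scale_sum_left)
  also have "\<dots> = 0" using v(2) by simp
  finally have "(\<Sum>b\<in>B. sc (v b) b) \<in> W" by simp
  moreover have "(\<Sum>b\<in>B. sc (v b) b) \<in> span B"
    by (intro span_sum span_scale span_base)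
  ultimately have "(\<Sum>b\<in>B. sc (v b) b) = 0" using B by (auto simp: is_complement_def)
  then have "\<forall>b\<in>B. v b = 0"
    using B fin(1) by (auto simp: is_complement_def dependent_finite)
  with v(1) show False by blast
qed

lemma quot_dim_eq_card:
  assumes "subspace W" "is_complement sc V W B"
  shows "quot_dim sc V W = card B"
  unfolding quot_dim_def
proof (rule the_equality)
  show "\<exists>B'\<subseteq>V. finite B' \<and> card B' = card B \<and> independent B' \<and> span B' \<inter> W = {0} \<and>
      V = {b + w |b w. b \<in> span B' \<and> w \<in> W}"
    using assms(2) unfolding is_complement_def
    by (intro exI[of _ B]) (elim conjE, intro conjI refl)
  fix n assume "\<exists>B'\<subseteq>V. finite B' \<and> card B' = n \<and> independent B' \<and> span B' \<inter> W = {0} \<and>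
      V = {b + w |b w. b \<in> span B' \<and> w \<in> W}"
  then obtain B' where "is_complement sc V W B'" "card B' = n"
    unfolding is_complement_def by (elim exE conjE) blast
  then show "n = card B"
    by (metis antisym complement_card_le[OF assms(1) assms(2)]
        complement_card_le[OF assms(1) _ assms(2)])
qed

text \<open>Extend a basis of \<open>W\<close> to one of \<open>V\<close> and keep the added
  vectors.\<close>

lemma complement_exists:
  assumes V: "subspace V" and W: "subspace W" and WV: "W \<subseteq> V"
    and fin: "finite S" and S: "V \<subseteq> span S"
  shows "\<exists>B. is_complement sc V W B"
proof -
  obtain A where A: "A \<subseteq> W" "independent A" "W \<subseteq> span A" by (rule basis_exists)
  then have WA: "W = span A" by (intro equalityI A(3) span_minimal[OF A(1) W])
  obtain C where C: "A \<subseteq> C" "C \<subseteq> V" "independent C" "V \<subseteq> span C"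
    by (rule maximal_independent_subset_extend[of A V]) (use A(1,2) WV in auto)
  have finC: "finite C" using independent_span_bound[OF fin C(3)] C(2) S by auto
  have finA: "finite A" by (rule finite_subset[OF C(1) finC])
  define B where "B = C - A"
  have finB: "finite B" using finC by (simp add: B_def)
  have indB: "independent B" by (rule independent_mono[OF C(3)]) (auto simp: B_def)
  have "x = 0" if x: "x \<in> span B" "x \<in> span A" for x
  proof -
    obtain a where a: "x = (\<Sum>c\<in>A. sc (a c) c)" using x(2) span_finite[OF finA] by auto
    obtain b where b: "x = (\<Sum>c\<in>B. sc (b c) c)" using x(1) span_finite[OF finB] by auto
    \<comment> \<open>The two expansions of \<open>x\<close>, taken with opposite signs, form a
      linear relation on the basis \<open>C\<close>.\<close>
    define e where "e c = (if c \<in> A then a c else - b c)" for c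
    have "(\<Sum>c\<in>C. sc (e c) c) = (\<Sum>c\<in>A. sc (e c) c) + (\<Sum>c\<in>B. sc (e c) c)"
      unfolding B_def using finC C(1) by (subst sum.subset_diff[of A C]) (auto simp: add.commute)
    also have "(\<Sum>c\<in>A. sc (e c) c) = x" unfolding a by (rule sum.cong) (auto simp: e_def)
    also have "(\<Sum>c\<in>B. sc (e c) c) = (\<Sum>c\<in>B. - sc (b c) c)"
      by (rule sum.cong) (auto simp: e_def B_def)
    also have "\<dots> = - x" by (simp add: b sum_negf)
    finally have "\<forall>c\<in>C. e c = 0" using C(3) finC by (auto simp: dependent_finite)
    then have "a c = 0" if "c \<in> A" for c
      using that C(1) bspec[of C "\<lambda>c. e c = 0" c] by (auto simp: e_def)
    then show ?thesis by (simp add: a)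
  qed
  then have int: "span B \<inter> W = {0}" by (auto simp: WA span_zero)
  have "span C = {b + w |b w. b \<in> span B \<and> w \<in> span A}"
  proof -
    have "C = B \<union> A" using C(1) by (auto simp: B_def)
    then show ?thesis by (auto simp: span_Un)
  qed
  moreover have "span C = V" by (intro equalityI C(4) span_minimal[OF C(2) V])
  ultimately have "V = {b + w |b w. b \<in> span B \<and> w \<in> W}" by (simp add: WA)
  with int indB finB C(2) have "is_complement sc V W B"
    by (auto simp: is_complement_def B_def)
  then show ?thesis by blast
qed

lemma quot_dim_complement:
  assumes "subspace V" "subspace W" "W \<subseteq> V" "finite S" "V \<subseteq> span S"
  obtains B where "is_complement sc V W B" "card B = quot_dim sc V W"
  by (metis complement_exists[OF assms] quot_dim_eq_card[OF assms(2)])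

end

section \<open>Monomials as finitely supported exponent functions\<close>

lemma mdeg_eq_sum:
  assumes "finite A" "keys m \<subseteq> A"
  shows "mdeg m = (\<Sum>x\<in>A. lookup m x)"
  unfolding mdeg_def using assms by (intro sum.mono_neutral_left) (auto simp: in_keys_iff)

lemma mdeg_0 [simp]: "mdeg 0 = 0" by (simp add: mdeg_def)

lemma mdeg_single [simp]: "mdeg (single x n) = n" by (simp add: mdeg_def)

lemma mdeg_add [simp]: "mdeg (a + b) = mdeg a + mdeg b"
proof -
  let ?K = "keys a \<union> keys b"
  have "keys (a + b) \<subseteq> ?K" by (rule Poly_Mapping.keys_add)
  then show ?thesis
    by (subst (1 2 3) mdeg_eq_sum[of ?K]) (auto simp: lookup_add sum.distrib)
qed

lemma lookup_le_mdeg: "lookup m x \<le> mdeg m"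
  unfolding mdeg_def by (cases "x \<in> keys m") (auto intro: member_le_sum simp: in_keys_iff)

lemma mdeg_eq_0_iff [simp]: "mdeg m = 0 \<longleftrightarrow> m = 0"
proof
  assume "mdeg m = 0"
  then have "lookup m x = 0" for x using lookup_le_mdeg[of m x] by simp
  then show "m = 0" by (intro poly_mapping_eqI) simp
qed simp

lemma keys_add_nat [simp]:
  "keys (a + b :: 'v \<Rightarrow>\<^sub>0 nat) = keys a \<union> keys b"
  by (auto simp: in_keys_iff lookup_add)

lemma monomial_split:
  assumes "x \<in> keys m"
  shows "m = (m - single x 1) + single x (1::nat)"
  using assms by (intro poly_mapping_eqI) (auto simp: lookup_add lookup_minus lookup_single when_def in_keys_iff)

lemma monomial_induct [case_names zero add]:
  fixes m :: "'v \<Rightarrow>\<^sub>0 nat"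
  assumes "P 0" and step: "\<And>m x. P m \<Longrightarrow> P (m + single x 1)"
  shows "P m"
proof (induction "mdeg m" arbitrary: m)
  case 0
  then show ?case using assms(1) by simp
next
  case (Suc n)
  then have "keys m \<noteq> {}" by (auto simp: mdeg_def)
  then obtain x where x: "x \<in> keys m" by blast
  let ?m = "m - single x 1"
  have m: "m = ?m + single x 1" using monomial_split[OF x] .
  have "mdeg m = mdeg (?m + single x 1)" using m by (rule arg_cong)
  with Suc(2) have "n = mdeg ?m" by simp
  then show ?case by (subst m) (intro step Suc(1))
qed

lemma finite_monomials_le:
  assumes "finite A"
  shows "finite {m :: 'v \<Rightarrow>\<^sub>0 nat. keys m \<subseteq> A \<and> mdeg m \<le> K}" (is "finite ?S")
proof -
  have "finite {f. \<forall>x. (x \<in> A \<longrightarrow> f x \<in> {..K}) \<and> (x \<notin> A \<longrightarrow> f x = (0::nat))}"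
    by (rule finite_set_of_finite_funs) (use assms in auto)
  moreover have "lookup ` ?S \<subseteq> {f. \<forall>x. (x \<in> A \<longrightarrow> f x \<in> {..K}) \<and> (x \<notin> A \<longrightarrow> f x = 0)}"
    using le_trans[OF lookup_le_mdeg] by (auto simp: in_keys_iff subset_iff)
  ultimately have "finite (lookup ` ?S)" by (rule rev_finite_subset)
  then show ?thesis by (rule finite_imageD) (simp add: inj_on_def)
qed

section \<open>Coefficients\<close>

lemma coeff_Mps [simp]: "coeff (Mps F) = F" by (simp add: Mps_inverse)
lemma coeff_zero [simp]: "coeff 0 m = 0" by (simp add: zero_mps.rep_eq)
lemma coeff_one: "coeff 1 m = (if m = 0 then 1 else 0)" by (simp add: one_mps.rep_eq)
lemma coeff_add [simp]: "coeff (F + G) m = coeff F m + coeff G m" by (simp add: plus_mps.rep_eq)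
lemma coeff_diff [simp]: "coeff (F - G) m = coeff F m - coeff G m" by (simp add: minus_mps.rep_eq)
lemma coeff_uminus [simp]: "coeff (- F) m = - coeff F m" by (simp add: uminus_mps.rep_eq)
lemma coeff_mult: "coeff (F * G) m = (\<Sum>(a, b) | a + b = m. coeff F a * coeff G b)"
  by (simp add: times_mps.rep_eq)
lemma coeff_sum [simp]: "coeff (sum F A) m = (\<Sum>i\<in>A. coeff (F i) m)"
  by (induction A rule: infinite_finite_induct) auto
lemma coeff_mconst: "coeff (mconst c) m = (if m = 0 then c else 0)" by (simp add: mconst_def)
lemma coeff_mvar: "coeff (mvar x) m = (if m = single x 1 then 1 else 0)"
  by (simp add: mvar_def)
lemma coeff_mderiv: "coeff (mderiv x F) m =
    of_nat (lookup m x + 1) * coeff F (m + single x 1)"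
  by (simp add: mderiv_def)

definition mmon :: "('v \<Rightarrow>\<^sub>0 nat) \<Rightarrow> 'v mps" where
  "mmon a = Mps (\<lambda>m. if m = a then 1 else 0)"

lemma coeff_mmon: "coeff (mmon a) m = (if m = a then 1 else 0)" by (simp add: mmon_def)

lemma coeff_mmon_mult_add [simp]: "coeff (mmon a * F) (a + m) = coeff F m"
proof -
  have "coeff (mmon a * F) (a + m) = (\<Sum>(b, c) \<in> {(a, m)}. coeff (mmon a) b * coeff F c)"
    unfolding coeff_mult
    by (rule sum.mono_neutral_right) (auto simp: finite_monomial_splittings coeff_mmon split: if_splits)
  then show ?thesis by (simp add: coeff_mmon)
qed

lemma coeff_mmon_mult_eq_0:
  assumes "\<nexists>c. m = a + c"
  shows "coeff (mmon a * F) m = 0"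
  unfolding coeff_mult using assms by (intro sum.neutral) (auto simp: coeff_mmon)

lemma mmon_0: "mmon 0 = 1" by (rule mps_eqI) (simp add: coeff_mmon coeff_one)

lemma mmon_add: "mmon (a + b) = mmon a * mmon b"
proof (rule mps_eqI)
  fix m
  show "coeff (mmon (a + b)) m = coeff (mmon a * mmon b) m"
  proof (cases "\<exists>c. m = a + c")
    case True
    then show ?thesis by (auto simp: coeff_mmon)
  next
    case False
    then show ?thesis by (auto simp: coeff_mmon_mult_eq_0 coeff_mmon)
  qed
qed

lemma mvar_eq_mmon: "mvar x = mmon (single x 1)"
  by (rule mps_eqI) (simp add: coeff_mmon coeff_mvar)

lemma coeff_mconst_mult [simp]:
  fixes m :: "'v \<Rightarrow>\<^sub>0 nat"
  shows "coeff (mconst c * F) m = c * coeff F m"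
proof -
  have "coeff (mconst c * F) m = (\<Sum>(b, d) \<in> {(0 :: 'v \<Rightarrow>\<^sub>0 nat, m)}. coeff (mconst c) b * coeff F d)"
    unfolding coeff_mult
    by (rule sum.mono_neutral_right) (auto simp: finite_monomial_splittings coeff_mconst split: if_splits)
  then show ?thesis by (simp add: coeff_mconst)
qed

lemma coeff_mscale [simp]: "coeff (mscale c F) m = c * coeff F m"
  by (simp add: mscale_def)

lemma mconst_0 [simp]: "mconst 0 = 0" by (rule mps_eqI) (simp add: coeff_mconst)
lemma mconst_1 [simp]: "mconst 1 = 1" by (rule mps_eqI) (simp add: coeff_mconst coeff_one)
lemma mconst_add: "mconst (a + b) = mconst a + mconst b" by (rule mps_eqI) (simp add: coeff_mconst)
lemma mconst_uminus: "mconst (- a) = - mconst a" by (rule mps_eqI) (simp add: coeff_mconst)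
lemma mconst_mult: "mconst (a * b) = mconst a * mconst b" by (rule mps_eqI) (simp add: coeff_mconst)

lemma vector_space_mscale: "vector_space mscale"
  by unfold_locales (auto intro!: mps_eqI simp: algebra_simps)

lemma coeff_mult_0 [simp]: "coeff (F * G) 0 = coeff F 0 * coeff G 0"
proof -
  have "{(a, b). a + b = (0 :: 'a \<Rightarrow>\<^sub>0 nat)} = {(0, 0)}"
    by (auto simp: poly_mapping_eq_iff lookup_add fun_eq_iff)
  then show ?thesis by (simp add: coeff_mult)
qed

lemma coeff_power_0 [simp]: "coeff (F ^ n) 0 = coeff F 0 ^ n"
  by (induction n) (auto simp: coeff_one)

lemma coeff_mult_linear:
  "coeff (F * G) (single x 1) =
     coeff F 0 * coeff G (single x 1) + coeff F (single x 1) * coeff G 0"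
proof -
  let ?e = "single x (1::nat)"
  have "a = 0 \<and> b = ?e \<or> a = ?e \<and> b = 0" if "a + b = ?e" for a b
  proof -
    have "mdeg a + mdeg b = 1" using arg_cong[OF that, of mdeg] by simp
    then have "a = 0 \<or> b = 0" by (metis One_nat_def add_is_1 mdeg_eq_0_iff)
    then show ?thesis using that by auto
  qed
  then have "{(a, b). a + b = ?e} = {(0, ?e), (?e, 0)}" by auto
  moreover have "?e \<noteq> 0" by (metis mdeg_0 mdeg_single zero_neq_one)
  ultimately show ?thesis by (simp add: coeff_mult)
qed

section \<open>Derivations\<close>

lemma mderiv_add: "mderiv x (F + G) = mderiv x F + mderiv x G"
  by (rule mps_eqI) (simp add: coeff_mderiv algebra_simps)

lemma mderiv_0 [simp]: "mderiv x 0 = 0"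
  by (rule mps_eqI) (simp add: coeff_mderiv)

lemma mderiv_sum: "mderiv x (sum F A) = (\<Sum>i\<in>A. mderiv x (F i))"
  by (induction A rule: infinite_finite_induct) (auto simp: mderiv_add)

lemma single_neq_zero [simp]: "single x (Suc n) \<noteq> 0"
  by (metis mdeg_0 mdeg_single nat.distinct(1))

lemma mderiv_mconst [simp]: "mderiv x (mconst c) = 0"
proof (rule mps_eqI)
  fix m :: "'a \<Rightarrow>\<^sub>0 nat"
  have "m + single x 1 \<noteq> 0" by (metis add_is_0 mdeg_0 mdeg_add mdeg_single zero_neq_one)
  then show "coeff (mderiv x (mconst c)) m = coeff 0 m" by (simp add: coeff_mderiv coeff_mconst)
qed

lemma mderiv_1 [simp]: "mderiv x 1 = 0"
  by (metis mconst_1 mderiv_mconst)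

text \<open>Indexing by splittings of \<open>m + single x 1\<close>, with the exponent of
  \<open>x\<close> in the left factor as weight, puts both halves of the Leibniz rule over the same
  index set; the two weights then add up to the exponent of \<open>x\<close> in the product.\<close>

lemma coeff_mderiv_mult:
  "coeff (mderiv x F * G) m = (\<Sum>(a, b) | a + b = m + single x 1.
      of_nat (lookup a x) * (coeff F a * coeff G b))"
proof -
  let ?e = "single x (1::nat)"
  let ?S = "{(a, b). a + b = m + ?e}"
  let ?f = "\<lambda>(a, b). of_nat (lookup a x) * (coeff F a * coeff G b)"
  have "sum ?f ?S = sum ?f {(a, b) \<in> ?S. lookup a x \<noteq> 0}"
    by (rule sum.mono_neutral_right) (auto simp: finite_monomial_splittings)
  also have "\<dots> = (\<Sum>(a, b) | a + b = m. of_nat (lookup a x + 1) * coeff F (a + ?e) * coeff G b)"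
  proof (rule sum.reindex_bij_witness[of _ "\<lambda>(a, b). (a + ?e, b)" "\<lambda>(a, b). (a - ?e, b)"], goal_cases)
    case (1 p)
    then show ?case using monomial_split[of x "fst p"] by (auto simp: in_keys_iff)
  next
    case (2 p)
    obtain a b where p: "p = (a, b)" by force
    with 2 have "a + b = m + ?e" "a = (a - ?e) + ?e" using monomial_split[of x a] by (auto simp: in_keys_iff)
    then have "(a - ?e + b) + ?e = m + ?e" by (metis add.assoc add.commute)
    then show ?case by (simp add: p)
  next
    case (3 p)
    then show ?case by auto
  next
    case (4 p)
    then show ?case by (auto simp: lookup_add ac_simps)
  next
    case (5 p)
    obtain a b where p: "p = (a, b)" by force
    with 5 have "a = (a - ?e) + ?e" using monomial_split[of x a] by (auto simp: in_keys_iff)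
    moreover from this have "lookup a x = lookup (a - ?e) x + 1"
      by (metis lookup_add lookup_single_eq)
    ultimately show ?case by (auto simp: p)
  qed
  finally show ?thesis by (simp add: coeff_mult coeff_mderiv)
qed

lemma mderiv_mult: "mderiv x (F * G) = mderiv x F * G + F * mderiv x G"
proof (rule mps_eqI)
  fix m
  let ?e = "single x (1::nat)"
  let ?S = "{(a, b). a + b = m + ?e}"
  have "coeff (F * mderiv x G) m = coeff (mderiv x G * F) m" by (simp add: mult.commute)
  also have "\<dots> = (\<Sum>(a, b) \<in> ?S. of_nat (lookup b x) * (coeff F a * coeff G b))"
    unfolding coeff_mderiv_mult
    by (rule sum.reindex_bij_witness[of _ prod.swap prod.swap]) (auto simp: add.commute mult.commute)
  finally have "coeff (mderiv x F * G + F * mderiv x G) m =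
      (\<Sum>(a, b) \<in> ?S. of_nat (lookup a x) * (coeff F a * coeff G b)) +
      (\<Sum>(a, b) \<in> ?S. of_nat (lookup b x) * (coeff F a * coeff G b))"
    by (simp only: coeff_add coeff_mderiv_mult)
  also have "\<dots> =
      (\<Sum>(a, b) \<in> ?S. of_nat (lookup a x + lookup b x) * (coeff F a * coeff G b))"
    by (simp add: sum.distrib[symmetric] split_def algebra_simps)
  also have "\<dots> = (\<Sum>(a, b) \<in> ?S. of_nat (lookup m x + 1) * (coeff F a * coeff G b))"
  proof (rule sum.cong)
    fix p assume "p \<in> ?S"
    then have "fst p + snd p = m + ?e" by auto
    then have "lookup (fst p) x + lookup (snd p) x = lookup m x + 1"
      by (metis lookup_add lookup_single_eq)
    then show "(case p of (a, b) \<Rightarrow> of_nat (lookup a x + lookup b x) * (coeff F a * coeff G b))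
        = (case p of (a, b) \<Rightarrow> of_nat (lookup m x + 1) * (coeff F a * coeff G b))"
      by (simp only: split_def)
  qed simp
  also have "\<dots> = coeff (mderiv x (F * G)) m"
    by (simp add: coeff_mderiv coeff_mult sum_distrib_left split_def)
  finally show "coeff (mderiv x (F * G)) m = coeff (mderiv x F * G + F * mderiv x G) m" by simp
qed

lemma mderiv_mvar: "mderiv x (mvar y) = (if x = y then 1 else 0)"
proof (rule mps_eqI)
  fix m :: "'a \<Rightarrow>\<^sub>0 nat"
  have "m + single x 1 = single y 1 \<longleftrightarrow> m = 0 \<and> x = y"
  proof
    assume h: "m + single x 1 = single y 1"
    have "mdeg m + 1 = 1" by (metis h mdeg_add mdeg_single)
    then have "m = 0" by simp
    then show "m = 0 \<and> x = y" using h by (metis add_0 keys_single singleton_inject zero_neq_one)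
  qed auto
  then show "coeff (mderiv x (mvar y)) m = coeff (if x = y then 1 else 0) m"
    by (auto simp: coeff_mderiv coeff_mvar coeff_one)
qed

section \<open>Order of vanishing\<close>

text \<open>The filtration by powers of the maximal ideal, expressed by coefficients so that no
  generators are needed.\<close>

definition ord_ge :: "nat \<Rightarrow> 'v mps \<Rightarrow> bool" where
  "ord_ge n F \<longleftrightarrow> (\<forall>m. mdeg m < n \<longrightarrow> coeff F m = 0)"

lemma ord_ge_add: "ord_ge n F \<Longrightarrow> ord_ge n G \<Longrightarrow> ord_ge n (F + G)"
  by (simp add: ord_ge_def)

lemma ord_ge_1: "ord_ge (Suc 0) F \<longleftrightarrow> coeff F 0 = 0"
  by (auto simp: ord_ge_def)

lemma ord_ge_0 [simp]: "ord_ge 0 F" by (simp add: ord_ge_def)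

lemma ord_ge_mult: "ord_ge n F \<Longrightarrow> ord_ge k G \<Longrightarrow> ord_ge (n + k) (F * G)"
  unfolding ord_ge_def
proof (intro allI impI)
  fix m :: "'a \<Rightarrow>\<^sub>0 nat"
  assume F: "\<forall>m. mdeg m < n \<longrightarrow> coeff F m = 0" and G: "\<forall>m. mdeg m < k \<longrightarrow> coeff G m = 0"
    and m: "mdeg m < n + k"
  have "coeff F a = 0 \<or> coeff G b = 0" if "a + b = m" for a b
  proof -
    have "mdeg a < n \<or> mdeg b < k" using m arg_cong[OF that, of mdeg] by auto
    then show ?thesis using F G by blast
  qed
  then show "coeff (F * G) m = 0" unfolding coeff_mult by (intro sum.neutral) auto
qed

lemma ord_ge_power: "coeff F 0 = 0 \<Longrightarrow> ord_ge n (F ^ n)"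
proof (induction n)
  case (Suc n)
  then have "ord_ge (Suc 0 + n) (F * F ^ n)" by (intro ord_ge_mult) (simp_all add: ord_ge_1)
  then show ?case by simp
qed simp

section \<open>Convergent power series\<close>

text \<open>A bound for the weighted l1 norm at radius \<open>r\<close>. Quantifying over finite
  partial sums avoids summability side conditions, and the norm is submultiplicative.\<close>

definition norm_bound :: "real \<Rightarrow> 'v mps \<Rightarrow> real \<Rightarrow> bool" where
  "norm_bound r F C \<longleftrightarrow> (\<forall>M. finite M \<longrightarrow> (\<Sum>m\<in>M. norm (coeff F m) * r ^ mdeg m) \<le> C)"

lemma norm_boundD: "norm_bound r F C \<Longrightarrow> finite M \<Longrightarrow> (\<Sum>m\<in>M. norm (coeff F m) * r ^ mdeg m) \<le> C"
  by (simp add: norm_bound_def)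

lemma norm_bound_nonneg: "norm_bound r F C \<Longrightarrow> 0 \<le> C"
  using norm_boundD[of r F C "{}"] by simp

lemma norm_bound_add:
  assumes "0 \<le> r" "norm_bound r F C" "norm_bound r G D"
  shows "norm_bound r (F + G) (C + D)"
  unfolding norm_bound_def
proof (intro allI impI)
  fix M :: "('a \<Rightarrow>\<^sub>0 nat) set" assume M: "finite M"
  have "(\<Sum>m\<in>M. norm (coeff (F + G) m) * r ^ mdeg m)
      \<le> (\<Sum>m\<in>M. norm (coeff F m) * r ^ mdeg m + norm (coeff G m) * r ^ mdeg m)"
    using assms(1) by (intro sum_mono)
      (auto simp: distrib_right[symmetric] intro!: mult_right_mono norm_triangle_ineq)
  also have "\<dots> \<le> C + D"
    using norm_boundD[OF assms(2) M] norm_boundD[OF assms(3) M] by (simp add: sum.distrib)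
  finally show "(\<Sum>m\<in>M. norm (coeff (F + G) m) * r ^ mdeg m) \<le> C + D" .
qed

text \<open>The splittings of the monomials in a finite set all lie in a finite product set, over
  which the double sum factors.\<close>

lemma norm_bound_mult:
  assumes r: "0 \<le> r" and F: "norm_bound r F C" and G: "norm_bound r G D"
  shows "norm_bound r (F * G) (C * D)"
  unfolding norm_bound_def
proof (intro allI impI)
  fix M :: "('a \<Rightarrow>\<^sub>0 nat) set" assume M: "finite M"
  let ?P = "\<lambda>m. {(a, b). a + b = m}"
  let ?f = "\<lambda>a. norm (coeff F a) * r ^ mdeg a"
  let ?g = "\<lambda>b. norm (coeff G b) * r ^ mdeg b"
  let ?U = "\<Union>m\<in>M. ?P m"
  have fin: "finite (?P m)" for m :: "'a \<Rightarrow>\<^sub>0 nat" by (rule finite_monomial_splittings)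
  have finU: "finite ?U" using M fin by (intro finite_UN_I)
  have "(\<Sum>m\<in>M. norm (coeff (F * G) m) * r ^ mdeg m) \<le> (\<Sum>m\<in>M. \<Sum>p\<in>?P m. ?f (fst p) * ?g (snd p))"
  proof (rule sum_mono)
    fix m
    have "norm (coeff (F * G) m) * r ^ mdeg m
        \<le> (\<Sum>p\<in>?P m. norm (coeff F (fst p) * coeff G (snd p))) * r ^ mdeg m"
      unfolding coeff_mult split_def using r by (intro mult_right_mono norm_sum) auto
    also have "\<dots> = (\<Sum>p\<in>?P m. norm (coeff F (fst p) * coeff G (snd p)) * r ^ mdeg m)"
      by (rule sum_distrib_right)
    also have "\<dots> = (\<Sum>p\<in>?P m. ?f (fst p) * ?g (snd p))"
      by (rule sum.cong) (auto simp: norm_mult power_add)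
    finally show "norm (coeff (F * G) m) * r ^ mdeg m \<le> (\<Sum>p\<in>?P m. ?f (fst p) * ?g (snd p))" .
  qed
  also have "\<dots> = (\<Sum>p\<in>?U. ?f (fst p) * ?g (snd p))"
    using M fin by (subst sum.UNION_disjoint) auto
  also have "\<dots> \<le> (\<Sum>p\<in>(fst ` ?U) \<times> (snd ` ?U). ?f (fst p) * ?g (snd p))"
  proof (rule sum_mono2)
    show "finite (fst ` ?U \<times> snd ` ?U)" using finU by blast
    show "?U \<subseteq> fst ` ?U \<times> snd ` ?U" by (metis subset_fst_snd)
  qed (use r in auto)
  also have "\<dots> = (\<Sum>a\<in>fst ` ?U. ?f a) * (\<Sum>b\<in>snd ` ?U. ?g b)"
    by (simp add: sum_product sum.cartesian_product split_def)
  also have "\<dots> \<le> C * D"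
    using finU r by (intro mult_mono norm_boundD[OF F] norm_boundD[OF G] norm_bound_nonneg[OF F] sum_nonneg) auto
  finally show "(\<Sum>m\<in>M. norm (coeff (F * G) m) * r ^ mdeg m) \<le> C * D" .
qed

lemma norm_bound_mconst: "norm_bound r (mconst c) (norm c)"
  unfolding norm_bound_def
proof (intro allI impI)
  fix M :: "('a \<Rightarrow>\<^sub>0 nat) set" assume M: "finite M"
  have "(\<Sum>m\<in>M. norm (coeff (mconst c) m) * r ^ mdeg m) = (\<Sum>m\<in>M. if m = 0 then norm c else 0)"
    by (rule sum.cong) (auto simp: coeff_mconst)
  also have "\<dots> \<le> norm c" using M by (simp add: sum.delta')
  finally show "(\<Sum>m\<in>M. norm (coeff (mconst c) m) * r ^ mdeg m) \<le> norm c" .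
qed

lemma norm_bound_1: "norm_bound r 1 1"
  using norm_bound_mconst[of r 1] by simp

lemma norm_bound_power: "0 \<le> r \<Longrightarrow> norm_bound r F C \<Longrightarrow> norm_bound r (F ^ n) (C ^ n)"
  by (induction n) (auto intro: norm_bound_1 norm_bound_mult)

lemma norm_bound_prod:
  "0 \<le> r \<Longrightarrow> (\<And>i. i \<in> A \<Longrightarrow> norm_bound r (F i) (C i)) \<Longrightarrow> norm_bound r (prod F A) (prod C A)"
  by (induction A rule: infinite_finite_induct) (auto intro: norm_bound_1 norm_bound_mult)

text \<open>Translation by \<open>e\<close> is injective on monomials, so the shifted terms form a
  partial sum for \<open>F\<close>. Shrinking the radius, differentiating and dividing by a monomial
  are all instances.\<close>

lemma norm_bound_compare:
  assumes F: "norm_bound r F C" and K: "0 \<le> K"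
    and le: "\<And>m. norm (coeff G m) * s ^ mdeg m \<le> K * (norm (coeff F (m + e)) * r ^ mdeg (m + e))"
  shows "norm_bound s G (K * C)"
  unfolding norm_bound_def
proof (intro allI impI)
  fix M :: "('a \<Rightarrow>\<^sub>0 nat) set" assume M: "finite M"
  have "(\<Sum>m\<in>M. norm (coeff G m) * s ^ mdeg m) \<le> (\<Sum>m\<in>M. K * (norm (coeff F (m + e)) * r ^ mdeg (m + e)))"
    by (intro sum_mono le)
  also have "\<dots> = K * (\<Sum>m\<in>(\<lambda>m. m + e) ` M. norm (coeff F m) * r ^ mdeg m)"
    by (simp add: sum_distrib_left sum.reindex)
  also have "\<dots> \<le> K * C" using M K by (intro mult_left_mono norm_boundD[OF F]) auto
  finally show "(\<Sum>m\<in>M. norm (coeff G m) * s ^ mdeg m) \<le> K * C" .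
qed

lemma norm_bound_shrink:
  assumes "norm_bound r F C" "0 \<le> s" "s \<le> r"
  shows "norm_bound s F C"
proof -
  have "norm_bound s F (1 * C)"
  proof (rule norm_bound_compare[where e = 0])
    fix m show "norm (coeff F m) * s ^ mdeg m \<le> 1 * (norm (coeff F (m + 0)) * r ^ mdeg (m + 0))"
      using assms(2,3) by (auto intro!: mult_left_mono power_mono)
  qed (use assms in auto)
  then show ?thesis by simp
qed

text \<open>Without constant term every occurring monomial has degree at least 1, so scaling the
  radius by some q \<le> 1 lowers the bound at least by the factor q.\<close>

lemma norm_bound_small:
  assumes F: "norm_bound r F C" and r: "0 < r" and F0: "coeff F 0 = 0" and eps: "0 < \<epsilon>"
  shows "\<exists>s>0. norm_bound s F \<epsilon>"
proof -
  have C: "0 \<le> C" using norm_bound_nonneg[OF F] .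
  \<comment> \<open>\<open>C + 1\<close> instead of \<open>C\<close>, because \<open>C\<close> may
    be 0.\<close>
  define q where "q = min 1 (\<epsilon> / (C + 1))"
  have q: "0 < q" "q \<le> 1" using eps C by (auto simp: q_def)
  have "q * C \<le> \<epsilon> / (C + 1) * C" using C by (intro mult_right_mono) (auto simp: q_def)
  also have "\<dots> \<le> \<epsilon>" using C eps by (simp add: field_simps)
  finally have qC: "q * C \<le> \<epsilon>" .
  have "norm_bound (q * r) F (q * C)"
  proof (rule norm_bound_compare[OF F, where e = 0])
    fix m
    show "norm (coeff F m) * (q * r) ^ mdeg m \<le> q * (norm (coeff F (m + 0)) * r ^ mdeg (m + 0))"
    proof (cases "m = 0")
      case False
      then obtain k where k: "mdeg m = Suc k" by (metis mdeg_eq_0_iff not0_implies_Suc)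
      have "q ^ mdeg m \<le> q" using q power_le_one[of q k] by (simp add: k mult_left_le)
      then have "q ^ mdeg m * (norm (coeff F m) * r ^ mdeg m) \<le> q * (norm (coeff F m) * r ^ mdeg m)"
        using r by (intro mult_right_mono) auto
      then show ?thesis by (simp add: power_mult_distrib algebra_simps)
    qed (simp add: F0)
  qed (use q in auto)
  then have "norm_bound (q * r) F \<epsilon>" using qC unfolding norm_bound_def by force
  then show ?thesis using q r by (intro exI[of _ "q * r"]) simp
qed

lemma germs_iff:
  "F \<in> germs A \<longleftrightarrow> (\<forall>m. coeff F m \<noteq> 0 \<longrightarrow> keys m \<subseteq> A) \<and> (\<exists>r>0. \<exists>C. norm_bound r F C)"
proof -
  have "(\<lambda>m. norm (coeff F m) * r ^ mdeg m) summable_on UNIV \<longleftrightarrow> (\<exists>C. norm_bound r F C)" if "r > 0" for r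
  proof
    assume s: "(\<lambda>m. norm (coeff F m) * r ^ mdeg m) summable_on UNIV"
    have "norm_bound r F (infsum (\<lambda>m. norm (coeff F m) * r ^ mdeg m) UNIV)"
      unfolding norm_bound_def using that by (auto intro!: finite_sum_le_infsum[OF s])
    then show "\<exists>C. norm_bound r F C" by blast
  next
    assume "\<exists>C. norm_bound r F C"
    then obtain C where C: "norm_bound r F C" by blast
    show "(\<lambda>m. norm (coeff F m) * r ^ mdeg m) summable_on UNIV"
      using that C by (intro nonneg_bdd_above_summable_on) (auto simp: norm_bound_def bdd_above_def)
  qed
  then show ?thesis unfolding germs_def by auto
qed

lemma germs_support: "F \<in> germs A \<Longrightarrow> coeff F m \<noteq> 0 \<Longrightarrow> keys m \<subseteq> A"
  by (auto simp: germs_iff)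

lemma germsE:
  assumes "F \<in> germs A"
  obtains r C where "0 < r" "norm_bound r F C"
  using assms by (auto simp: germs_iff)

lemma germsI:
  assumes "\<And>m. coeff F m \<noteq> 0 \<Longrightarrow> keys m \<subseteq> A" "0 < r" "norm_bound r F C"
  shows "F \<in> germs A"
  using assms by (auto simp: germs_iff)

lemma germs_common_radius:
  assumes "F \<in> germs A" "G \<in> germs B"
  obtains r C D where "0 < r" "norm_bound r F C" "norm_bound r G D"
proof -
  obtain r C s D where "0 < r" "norm_bound r F C" "0 < s" "norm_bound s G D"
    using assms by (meson germsE)
  then have "0 < min r s" "norm_bound (min r s) F C" "norm_bound (min r s) G D"
    by (auto intro: norm_bound_shrink)
  then show thesis by (rule that)
qed

lemma mconst_in_germs [simp, intro]: "mconst c \<in> germs A"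
  by (rule germsI[where r = 1 and C = "norm c"]) (auto simp: coeff_mconst norm_bound_mconst split: if_splits)

lemma one_in_germs [simp, intro]: "1 \<in> germs A" using mconst_in_germs[of 1] by simp
lemma zero_in_germs [simp, intro]: "0 \<in> germs A" using mconst_in_germs[of 0] by simp

lemma germs_add [intro]:
  assumes "F \<in> germs A" "G \<in> germs A"
  shows "F + G \<in> germs A"
proof -
  obtain r C D where r: "0 < r" "norm_bound r F C" "norm_bound r G D"
    using germs_common_radius[OF assms] .
  show ?thesis
  proof (rule germsI[OF _ r(1) norm_bound_add[OF _ r(2,3)]])
    fix m assume "coeff (F + G) m \<noteq> 0"
    then have "coeff F m \<noteq> 0 \<or> coeff G m \<noteq> 0" by auto
    then show "keys m \<subseteq> A" using assms germs_support by blast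
  qed (use r in simp)
qed

lemma germs_mult [intro]:
  assumes "F \<in> germs A" "G \<in> germs A"
  shows "F * G \<in> germs A"
proof -
  obtain r C D where r: "0 < r" "norm_bound r F C" "norm_bound r G D"
    using germs_common_radius[OF assms] .
  show ?thesis
  proof (rule germsI[OF _ r(1) norm_bound_mult[OF _ r(2,3)]])
    fix m assume "coeff (F * G) m \<noteq> 0"
    then obtain a b where "a + b = m" "coeff F a \<noteq> 0" "coeff G b \<noteq> 0"
      unfolding coeff_mult by (auto elim!: sum.not_neutral_contains_not_neutral)
    then show "keys m \<subseteq> A"
      using germs_support[OF assms(1)] germs_support[OF assms(2)] by force
  qed (use r in simp)
qed

lemma germs_uminus [intro]: "F \<in> germs A \<Longrightarrow> - F \<in> germs A"
  by (metis germs_mult mconst_in_germs mconst_uminus mconst_1 mult_minus1)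

lemma germs_diff [intro]: "F \<in> germs A \<Longrightarrow> G \<in> germs A \<Longrightarrow> F - G \<in> germs A"
  using germs_add[of F A "- G"] by auto

lemma germs_sum [intro]: "(\<And>i. i \<in> I \<Longrightarrow> F i \<in> germs A) \<Longrightarrow> sum F I \<in> germs A"
  by (induction I rule: infinite_finite_induct) auto

lemma germs_power [intro]: "F \<in> germs A \<Longrightarrow> F ^ n \<in> germs A"
  by (induction n) auto

lemma germs_prod [intro]: "(\<And>i. i \<in> I \<Longrightarrow> F i \<in> germs A) \<Longrightarrow> prod F I \<in> germs A"
  by (induction I rule: infinite_finite_induct) auto

lemma germs_mono: "A \<subseteq> B \<Longrightarrow> F \<in> germs A \<Longrightarrow> F \<in> germs B"
  by (fastforce simp: germs_iff)

lemma germs_mscale [intro]: "F \<in> germs A \<Longrightarrow> mscale c F \<in> germs A"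
  unfolding mscale_def by auto

lemma mvar_in_germs [intro]:
  assumes "x \<in> A"
  shows "mvar x \<in> germs A"
proof (rule germsI[where r = 1 and C = 1])
  show "norm_bound 1 (mvar x) 1"
    unfolding norm_bound_def
  proof (intro allI impI)
    fix M :: "('a \<Rightarrow>\<^sub>0 nat) set" assume M: "finite M"
    have "(\<Sum>m\<in>M. norm (coeff (mvar x) m) * 1 ^ mdeg m) = (\<Sum>m\<in>M. if m = single x 1 then 1 else 0)"
      by (rule sum.cong) (auto simp: coeff_mvar)
    also have "\<dots> \<le> (1::real)" using M by (simp add: sum.delta')
    finally show "(\<Sum>m\<in>M. norm (coeff (mvar x) m) * 1 ^ mdeg m) \<le> 1" .
  qed
qed (use assms in \<open>auto simp: coeff_mvar split: if_splits\<close>)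

definition monomial_value :: "('v \<Rightarrow> 'a::comm_monoid_mult) \<Rightarrow> ('v \<Rightarrow>\<^sub>0 nat) \<Rightarrow> 'a" where
  "monomial_value \<sigma> a = (\<Prod>x\<in>keys a. \<sigma> x ^ lookup a x)"

lemma monomial_value_superset:
  assumes "finite B" "keys a \<subseteq> B"
  shows "monomial_value \<sigma> a = (\<Prod>x\<in>B. \<sigma> x ^ lookup a x)"
  unfolding monomial_value_def using assms
  by (intro prod.mono_neutral_left) (auto simp: in_keys_iff)

lemma monomial_value_0 [simp]: "monomial_value \<sigma> 0 = 1"
  by (simp add: monomial_value_def)

lemma monomial_value_add: "monomial_value \<sigma> (a + b) = monomial_value \<sigma> a * monomial_value \<sigma> b"
proof -
  let ?K = "keys a \<union> keys b"
  have "monomial_value \<sigma> c = (\<Prod>x\<in>?K. \<sigma> x ^ lookup c x)"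
    if "keys c \<subseteq> ?K" for c
    using that by (intro monomial_value_superset) auto
  from this[of a] this[of b] this[of "a + b"] show ?thesis
    by (simp add: lookup_add power_add prod.distrib)
qed

lemma monomial_value_single [simp]: "monomial_value \<sigma> (single x n) = \<sigma> x ^ n"
  by (cases "n = 0") (simp_all add: monomial_value_def)

lemma monomial_value_cong:
  "(\<And>x. x \<in> keys a \<Longrightarrow> \<sigma> x = \<tau> x) \<Longrightarrow> monomial_value \<sigma> a = monomial_value \<tau> a"
  by (simp add: monomial_value_def)

lemma mmon_eq_monomial_value: "mmon a = monomial_value mvar a"
  by (induction a rule: monomial_induct) (auto simp: mmon_0 mmon_add monomial_value_add mvar_eq_mmon)

text \<open>The factor brought down by differentiation is at most \<open>2 ^ mdeg m\<close>, which
  halving the radius compensates.\<close>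

lemma germs_mderiv [intro]:
  assumes "F \<in> germs A"
  shows "mderiv x F \<in> germs A"
proof -
  obtain r C where r: "0 < r" "norm_bound r F C" using germsE[OF assms] .
  let ?e = "single x (1::nat)"
  have "norm_bound (r / 2) (mderiv x F) (1 / r * C)"
  proof (rule norm_bound_compare[OF r(2), where e = ?e])
    fix m
    have "lookup m x + 1 \<le> mdeg m + 1" using lookup_le_mdeg by auto
    also have "\<dots> \<le> 2 ^ mdeg m" using less_exp[of "mdeg m"] by (simp add: Suc_leI)
    finally have "real (lookup m x + 1) \<le> 2 ^ mdeg m"
      using of_nat_mono by fastforce
    then have "real (lookup m x + 1) * (norm (coeff F (m + ?e)) * (r / 2) ^ mdeg m)
        \<le> 2 ^ mdeg m * (norm (coeff F (m + ?e)) * (r / 2) ^ mdeg m)"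
      using r by (intro mult_right_mono) auto
    then show "norm (coeff (mderiv x F) m) * (r / 2) ^ mdeg m
        \<le> 1 / r * (norm (coeff F (m + ?e)) * r ^ mdeg (m + ?e))"
      using r(1) unfolding coeff_mderiv norm_mult norm_of_nat
      by (simp add: power_divide field_simps)
  qed (use r in auto)
  then show ?thesis
  proof (rule germsI[rotated 2])
    fix m assume "coeff (mderiv x F) m \<noteq> 0"
    then have "coeff F (m + ?e) \<noteq> 0" by (simp add: coeff_mderiv)
    then show "keys m \<subseteq> A" using germs_support[OF assms] by fastforce
  qed (use r in simp)
qed

text \<open>Serves restriction to the special fibre (\<open>e = 0\<close>) and division by a
  variable or by t^2; the alternative 0 allows coefficients to be dropped at the same time.\<close>

lemma germs_shift:
  assumes F: "F \<in> germs A" and G: "\<And>m. coeff G m = 0 \<or> coeff G m = coeff F (m + e)"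
  shows "G \<in> germs A"
proof -
  obtain r C where r: "0 < r" "norm_bound r F C" using germsE[OF F] .
  have "norm_bound r G (1 / r ^ mdeg e * C)"
  proof (rule norm_bound_compare[OF r(2), where e = e])
    fix m
    show "norm (coeff G m) * r ^ mdeg m \<le> 1 / r ^ mdeg e * (norm (coeff F (m + e)) * r ^ mdeg (m + e))"
      using r(1) G[of m] by (auto simp: power_add)
  qed (use r in auto)
  then show ?thesis
  proof (rule germsI[rotated 2])
    fix m assume "coeff G m \<noteq> 0"
    then have "coeff F (m + e) \<noteq> 0" using G[of m] by auto
    then show "keys m \<subseteq> A" using germs_support[OF F] by fastforce
  qed (use r in simp)
qed

text \<open>Geometric series in \<open>U\<close>, which is 1 minus \<open>F\<close> divided by its
  constant term. As \<open>U ^ n\<close> has order at least n, each coefficient of the series is a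
  finite sum; at a radius where \<open>U\<close> has norm at most 1/2 the series has norm at most
  2.\<close>

lemma germs_inverse:
  assumes F: "F \<in> germs A" and F0: "coeff F 0 \<noteq> 0"
  shows "\<exists>G\<in>germs A. F * G = 1"
proof -
  define U where "U = 1 - mconst (1 / coeff F 0) * F"
  have U: "U \<in> germs A" using F by (auto simp: U_def)
  have U0: "coeff U 0 = 0" using F0 by (simp add: U_def coeff_one coeff_mconst)
  define H where "H = Mps (\<lambda>m. \<Sum>n\<le>mdeg m. coeff (U ^ n) m)"
  have tail: "ord_ge (Suc K) (H - (\<Sum>n\<le>K. U ^ n))" for K
    unfolding ord_ge_def
  proof (intro allI impI)
    fix m :: "'a \<Rightarrow>\<^sub>0 nat" assume m: "mdeg m < Suc K"
    have "(\<Sum>n\<le>K. coeff (U ^ n) m) = (\<Sum>n\<le>mdeg m. coeff (U ^ n) m)"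
      using m ord_ge_power[OF U0] by (intro sum.mono_neutral_right) (auto simp: ord_ge_def)
    then show "coeff (H - (\<Sum>n\<le>K. U ^ n)) m = 0" by (simp add: H_def)
  qed
  have "(1 - U) * H = 1"
  proof (rule mps_eqI)
    fix m :: "'a \<Rightarrow>\<^sub>0 nat"
    let ?K = "mdeg m" let ?S = "\<Sum>n\<le>?K. U ^ n"
    have "(1 - U) * H - 1 = (1 - U) * (H - ?S) - U ^ Suc ?K"
      using sum_gp_basic[of U ?K] by (simp add: algebra_simps)
    moreover have "ord_ge (Suc ?K) ((1 - U) * (H - ?S))"
      using ord_ge_mult[OF _ tail[of ?K], of 0 "1 - U"] by simp
    moreover have "ord_ge (Suc ?K) (U ^ Suc ?K)" by (rule ord_ge_power[OF U0])
    ultimately have "coeff ((1 - U) * H - 1) m = 0" by (simp add: ord_ge_def)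
    then show "coeff ((1 - U) * H) m = coeff 1 m" by simp
  qed
  moreover have "1 - U = mconst (1 / coeff F 0) * F" by (simp add: U_def)
  ultimately have "F * (mconst (1 / coeff F 0) * H) = 1" by (simp add: ac_simps)
  moreover have "H \<in> germs A"
  proof -
    obtain r C where "0 < r" "norm_bound r U C" using germsE[OF U] .
    from norm_bound_small[OF this(2,1) U0, of "1/2"] obtain s where s: "0 < s" "norm_bound s U (1/2)" by auto
    have "norm_bound s H 2"
      unfolding norm_bound_def
    proof (intro allI impI)
      fix M :: "('a \<Rightarrow>\<^sub>0 nat) set" assume M: "finite M"
      define K where "K = Max (insert 0 (mdeg ` M))"
      have K: "mdeg m \<le> K" if "m \<in> M" for m using M that by (auto simp: K_def)
      have "(\<Sum>m\<in>M. norm (coeff H m) * s ^ mdeg m) \<le> (\<Sum>m\<in>M. \<Sum>n\<le>K. norm (coeff (U ^ n) m) * s ^ mdeg m)"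
      proof (rule sum_mono)
        fix m assume m: "m \<in> M"
        have "norm (coeff H m) \<le> (\<Sum>n\<le>mdeg m. norm (coeff (U ^ n) m))"
          by (simp add: H_def norm_sum)
        also have "\<dots> \<le> (\<Sum>n\<le>K. norm (coeff (U ^ n) m))"
          using K[OF m] by (intro sum_mono2) auto
        finally have "norm (coeff H m) * s ^ mdeg m \<le> (\<Sum>n\<le>K. norm (coeff (U ^ n) m)) * s ^ mdeg m"
          using s by (intro mult_right_mono) auto
        then show "norm (coeff H m) * s ^ mdeg m \<le> (\<Sum>n\<le>K. norm (coeff (U ^ n) m) * s ^ mdeg m)"
          by (simp add: sum_distrib_right)
      qed
      also have "\<dots> = (\<Sum>n\<le>K. \<Sum>m\<in>M. norm (coeff (U ^ n) m) * s ^ mdeg m)" by (rule sum.swap)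
      also have "\<dots> \<le> (\<Sum>n\<le>K. (1/2) ^ n)"
        using s by (intro sum_mono norm_boundD[OF norm_bound_power M]) auto
      also have "\<dots> \<le> 2" by (subst sum_gp0) (simp add: field_simps)
      finally show "(\<Sum>m\<in>M. norm (coeff H m) * s ^ mdeg m) \<le> 2" .
    qed
    then show ?thesis
    proof (rule germsI[rotated 2])
      fix m assume "coeff H m \<noteq> 0"
      then obtain n where "coeff (U ^ n) m \<noteq> 0"
        by (auto simp: H_def elim: sum.not_neutral_contains_not_neutral)
      then show "keys m \<subseteq> A" using germs_support[OF germs_power[OF U]] by blast
    qed (use s in simp)
  qed
  ultimately show ?thesis by (intro bexI[of _ "mconst (1 / coeff F 0) * H"]) auto
qed

text \<open>Every nonconstant monomial is assigned to one of its own variables; \<open>B x\<close>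
  collects the terms assigned to \<open>x\<close>, divided by \<open>x\<close>.\<close>

lemma germs_divide_by_variables:
  assumes F: "F \<in> germs A" and F0: "coeff F 0 = 0" and A: "finite A"
  shows "\<exists>B. (\<forall>x. B x \<in> germs A) \<and> F = (\<Sum>x\<in>A. mvar x * B x)"
proof -
  define pick where "pick m = (SOME x. x \<in> keys m)" for m :: "'a \<Rightarrow>\<^sub>0 nat"
  have pick: "pick m \<in> keys m" if "m \<noteq> 0" for m
  proof -
    have "\<exists>x. x \<in> keys m"
      using that by (auto simp: in_keys_iff poly_mapping_eq_iff fun_eq_iff)
    then show ?thesis unfolding pick_def by (rule someI_ex)
  qed
  define B where "B x = Mps (\<lambda>m. if pick (m + single x 1) = x
      then coeff F (m + single x 1) else 0)" for x
  have "B x \<in> germs A" for x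
    by (rule germs_shift[OF F, of _ "single x 1"]) (simp add: B_def)
  moreover have "coeff F m = coeff (\<Sum>x\<in>A. mvar x * B x) m" for m
  proof (cases "m = 0")
    case True
    then show ?thesis using F0 by (simp add: coeff_mvar)
  next
    case False
    have *: "coeff (mvar x * B x) m = (if x = pick m then coeff F m else 0)" for x
    proof (cases "x \<in> keys m")
      case True
      obtain n where m: "m = single x 1 + n"
        using monomial_split[OF True] by (metis add.commute)
      have "coeff (mvar x * B x) m = coeff (B x) n"
        by (simp only: m mvar_eq_mmon coeff_mmon_mult_add)
      also have "\<dots> = (if x = pick m then coeff F m else 0)"
        by (auto simp: B_def m add.commute)
      finally show ?thesis .
    next
      case nk: False
      have "\<nexists>c. m = single x 1 + c"
      proof
        assume "\<exists>c. m = single x 1 + c"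
        then have "x \<in> keys m" by auto
        with nk show False by simp
      qed
      then have "coeff (mvar x * B x) m = 0" by (simp add: mvar_eq_mmon coeff_mmon_mult_eq_0)
      then show ?thesis using pick[OF False] nk by auto
    qed
    show ?thesis
    proof (cases "coeff F m = 0")
      case False
      then have "pick m \<in> A" using germs_support[OF F] pick[OF \<open>m \<noteq> 0\<close>] by blast
      then show ?thesis using A by (simp add: * sum.delta')
    qed (simp add: * if_distrib cong: if_cong)
  qed
  ultimately show ?thesis by (intro exI[of _ B]) (auto intro: mps_eqI)
qed

section \<open>Generated ideals\<close>

lemma ideal_gen_induct [consumes 1, case_names zero add]:
  assumes "x \<in> ideal_gen R S" "P 0" "\<And>x a s. P x \<Longrightarrow> a \<in> R \<Longrightarrow> s \<in> S \<Longrightarrow> P (x + a * s)"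
  shows "P x"
proof -
  obtain T a where T: "x = (\<Sum>s\<in>T. a s * s)" "finite T" "T \<subseteq> S" "\<forall>s\<in>T. a s \<in> R"
    using assms(1) by (auto simp: ideal_gen_def)
  have "P (\<Sum>s\<in>T. a s * s)"
    using T(2-4)
  proof (induction T rule: finite_induct)
    case (insert s T)
    then have "P ((\<Sum>s\<in>T. a s * s) + a s * s)" by (intro assms(3)) auto
    then show ?case using insert by (simp add: add.commute)
  qed (simp add: assms(2))
  then show ?thesis by (simp add: T(1))
qed

lemma ideal_gen_0 [simp, intro]: "0 \<in> ideal_gen R S"
  unfolding ideal_gen_def by (auto intro!: exI[of _ "{}"])

lemma ideal_gen_empty [simp]: "ideal_gen R {} = {0}"
  unfolding ideal_gen_def by auto

lemma ideal_gen_baseI: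
  assumes "a \<in> R" "s \<in> S"
  shows "a * s \<in> ideal_gen R S"
  unfolding ideal_gen_def using assms by (auto intro!: exI[of _ "{s}"] exI[of _ "\<lambda>_. a"])

lemma ideal_gen_superset:
  assumes "s \<in> S"
  shows "s \<in> ideal_gen (germs A) S"
  using ideal_gen_baseI[of 1 "germs A" s S] assms by auto

lemma ideal_gen_add [intro]:
  assumes "x \<in> ideal_gen (germs A) S" "y \<in> ideal_gen (germs A) S"
  shows "x + y \<in> ideal_gen (germs A) S"
proof -
  obtain T a where T: "x = (\<Sum>s\<in>T. a s * s)" "finite T" "T \<subseteq> S" "\<forall>s\<in>T. a s \<in> germs A"
    using assms(1) by (auto simp: ideal_gen_def)
  obtain U b where U: "y = (\<Sum>s\<in>U. b s * s)" "finite U" "U \<subseteq> S" "\<forall>s\<in>U. b s \<in> germs A"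
    using assms(2) by (auto simp: ideal_gen_def)
  define c where "c s = (if s \<in> T then a s else 0) + (if s \<in> U then b s else 0)" for s
  have "(\<Sum>s\<in>T \<union> U. c s * s) = (\<Sum>s\<in>T \<union> U. if s \<in> T then a s * s else 0) + (\<Sum>s\<in>T \<union> U. if s \<in> U then b s * s else 0)"
    unfolding sum.distrib[symmetric] by (rule sum.cong) (auto simp: c_def algebra_simps)
  also have "(\<Sum>s\<in>T \<union> U. if s \<in> T then a s * s else 0) = x"
    using T(2) U(2) unfolding T(1) by (intro sum.mono_neutral_cong_right) auto
  also have "(\<Sum>s\<in>T \<union> U. if s \<in> U then b s * s else 0) = y"
    using T(2) U(2) unfolding U(1) by (intro sum.mono_neutral_cong_right) auto
  finally have "x + y = (\<Sum>s\<in>T \<union> U. c s * s)" by simp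
  moreover have "\<forall>s\<in>T \<union> U. c s \<in> germs A" using T(4) U(4) by (auto simp: c_def)
  ultimately show ?thesis unfolding ideal_gen_def using T U by blast
qed

lemma ideal_gen_mult [intro]:
  assumes "c \<in> germs A" "x \<in> ideal_gen (germs A) S"
  shows "c * x \<in> ideal_gen (germs A) S"
proof -
  obtain T a where T: "x = (\<Sum>s\<in>T. a s * s)" "finite T" "T \<subseteq> S" "\<forall>s\<in>T. a s \<in> germs A"
    using assms(2) by (auto simp: ideal_gen_def)
  have "c * x = (\<Sum>s\<in>T. (c * a s) * s)" by (simp add: T(1) sum_distrib_left mult.assoc)
  then show ?thesis unfolding ideal_gen_def using T assms(1)
    by (intro CollectI exI[of _ T] exI[of _ "\<lambda>s. c * a s"]) auto
qed

lemma ideal_gen_uminus [intro]: "x \<in> ideal_gen (germs A) S \<Longrightarrow> - x \<in> ideal_gen (germs A) S"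
  using ideal_gen_mult[of "- 1" A x S] by auto

lemma ideal_gen_diff [intro]:
  "x \<in> ideal_gen (germs A) S \<Longrightarrow> y \<in> ideal_gen (germs A) S \<Longrightarrow> x - y \<in> ideal_gen (germs A) S"
  using ideal_gen_add[of x A S "- y"] by auto

lemma ideal_gen_sum [intro]:
  "(\<And>i. i \<in> I \<Longrightarrow> F i \<in> ideal_gen (germs A) S) \<Longrightarrow> sum F I \<in> ideal_gen (germs A) S"
  by (induction I rule: infinite_finite_induct) auto

lemma ideal_gen_mscale [intro]:
  "x \<in> ideal_gen (germs A) S \<Longrightarrow> mscale c x \<in> ideal_gen (germs A) S"
  unfolding mscale_def by auto

lemma ideal_gen_subset_germs:
  assumes "S \<subseteq> germs A"
  shows "ideal_gen (germs A) S \<subseteq> germs A"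
proof
  fix x assume "x \<in> ideal_gen (germs A) S"
  then show "x \<in> germs A" by (induction rule: ideal_gen_induct) (use assms in auto)
qed

lemma ideal_gen_three:
  "x \<in> ideal_gen (germs A) {p, q, r} \<longleftrightarrow>
     (\<exists>a\<in>germs A. \<exists>b\<in>germs A. \<exists>c\<in>germs A. x = a * p + b * q + c * r)"
proof
  assume "x \<in> ideal_gen (germs A) {p, q, r}"
  then show "\<exists>a\<in>germs A. \<exists>b\<in>germs A. \<exists>c\<in>germs A. x = a * p + b * q + c * r"
  proof (induction rule: ideal_gen_induct)
    case zero
    then show ?case by (intro bexI[of _ 0]) auto
  next
    case (add x a s)
    then obtain u v w where uvw: "u \<in> germs A" "v \<in> germs A" "w \<in> germs A" "x = u * p + v * q + w * r"
      by blast
    from add consider "s = p" | "s = q" | "s = r" by auto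
    then show ?case
    proof cases
      case 1
      then show ?thesis using add uvw
        by (intro bexI[of _ "u + a"] bexI[of _ v] bexI[of _ w]) (auto simp: algebra_simps)
    next
      case 2
      then show ?thesis using add uvw
        by (intro bexI[of _ u] bexI[of _ "v + a"] bexI[of _ w]) (auto simp: algebra_simps)
    next
      case 3
      then show ?thesis using add uvw
        by (intro bexI[of _ u] bexI[of _ v] bexI[of _ "w + a"]) (auto simp: algebra_simps)
    qed
  qed
next
  assume "\<exists>a\<in>germs A. \<exists>b\<in>germs A. \<exists>c\<in>germs A. x = a * p + b * q + c * r"
  then show "x \<in> ideal_gen (germs A) {p, q, r}"
    by (auto intro!: ideal_gen_add ideal_gen_baseI)
qed

section \<open>Restriction to the special fibre\<close>

lemma special_fibre_coeff:
  "coeff (special_fibre F) m = (if keys m \<subseteq> {LU, LV} then coeff F m else 0)"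
  by (simp add: special_fibre_def)

lemma special_fibre_add [simp]: "special_fibre (F + G) = special_fibre F + special_fibre G"
  by (rule mps_eqI) (simp add: special_fibre_coeff)

lemma special_fibre_diff [simp]: "special_fibre (F - G) = special_fibre F - special_fibre G"
  by (rule mps_eqI) (simp add: special_fibre_coeff)

lemma special_fibre_mconst [simp]: "special_fibre (mconst c) = mconst c"
  by (rule mps_eqI) (simp add: special_fibre_coeff coeff_mconst)

lemma special_fibre_0 [simp]: "special_fibre 0 = 0"
  and special_fibre_1 [simp]: "special_fibre 1 = 1"
  using special_fibre_mconst[of 0] special_fibre_mconst[of 1] by simp_all

text \<open>A product of monomials involves only \<open>LU\<close> and \<open>LV\<close> exactly
  when both factors do.\<close>

lemma special_fibre_mult [simp]: "special_fibre (F * G) = special_fibre F * special_fibre G"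
proof (rule mps_eqI)
  fix m
  have "coeff (special_fibre F * special_fibre G) m =
      (\<Sum>(a, b) | a + b = m. if keys m \<subseteq> {LU, LV} then coeff F a * coeff G b else 0)"
    unfolding coeff_mult by (rule sum.cong) (auto simp: special_fibre_coeff)
  also have "\<dots> = coeff (special_fibre (F * G)) m"
    by (simp add: special_fibre_coeff coeff_mult split_def)
  finally show "coeff (special_fibre (F * G)) m = coeff (special_fibre F * special_fibre G) m" ..
qed

lemma special_fibre_sum [simp]: "special_fibre (sum F A) = (\<Sum>i\<in>A. special_fibre (F i))"
  by (induction A rule: infinite_finite_induct) auto

lemma special_fibre_power [simp]: "special_fibre (F ^ n) = special_fibre F ^ n"
  by (induction n) auto

lemma special_fibre_prod [simp]: "special_fibre (prod F A) = (\<Prod>i\<in>A. special_fibre (F i))"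
  by (induction A rule: infinite_finite_induct) auto

lemma special_fibre_mvar:
  "special_fibre (mvar x) = (if x \<in> {LU, LV} then mvar x else 0)"
  by (rule mps_eqI) (auto simp: special_fibre_coeff coeff_mvar split: if_splits)

lemma special_fibre_plane: "F \<in> plane_ring \<Longrightarrow> special_fibre F = F"
  by (rule mps_eqI) (use germs_support in \<open>auto simp: special_fibre_coeff\<close>)

lemma monomial_plane_param:
  assumes "keys m \<subseteq> {LU, LV}" "keys m \<subseteq> Par ` N"
  shows "m = (0 :: lvar \<Rightarrow>\<^sub>0 nat)"
proof -
  have "x \<notin> keys m" for x using assms by (cases x) auto
  then show ?thesis by (intro poly_mapping_eqI) (simp add: in_keys_iff)
qed

lemma special_fibre_param:
  assumes "F \<in> param_ring n"
  shows "special_fibre F = mconst (coeff F 0)"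
proof (rule mps_eqI)
  fix m
  show "coeff (special_fibre F) m = coeff (mconst (coeff F 0)) m"
  proof (cases "coeff F m \<noteq> 0 \<and> keys m \<subseteq> {LU, LV}")
    case True
    then have "m = 0" using germs_support[OF assms] monomial_plane_param by blast
    then show ?thesis by (simp add: special_fibre_coeff coeff_mconst)
  next
    case False
    then show ?thesis by (auto simp: special_fibre_coeff coeff_mconst)
  qed
qed

lemma special_fibre_in_plane [intro]:
  assumes "F \<in> germs A"
  shows "special_fibre F \<in> plane_ring"
proof -
  have "special_fibre F \<in> germs A"
    by (rule germs_shift[OF assms, of _ 0]) (simp add: special_fibre_coeff)
  then show ?thesis by (auto simp: germs_iff special_fibre_coeff)
qed

lemma special_fibre_mderiv:
  "x \<in> {LU, LV} \<Longrightarrow> special_fibre (mderiv x F) = mderiv x (special_fibre F)"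
  by (rule mps_eqI) (auto simp: special_fibre_coeff coeff_mderiv)

lemma plane_subset_total: "plane_ring \<subseteq> total_ring n"
  using germs_mono[of "{LU, LV}" "{LU, LV} \<union> Par ` {..<n}"] by blast

lemma param_subset_total: "param_ring n \<subseteq> total_ring n"
  using germs_mono[of "Par ` {..<n}" "{LU, LV} \<union> Par ` {..<n}"] by blast

section \<open>First-order deformations\<close>

text \<open>
  \<open>special_fibre F + \<epsilon> tangent_deriv n v F\<close> is the restriction of \<open>F\<close> to the first-order arc with
  parameters \<open>\<epsilon> v\<close>; it is multiplicative in \<open>F\<close> over the dual numbers.
\<close>

definition tangent_deriv :: "nat \<Rightarrow> (nat \<Rightarrow> complex) \<Rightarrow> lvar mps \<Rightarrow> lvar mps" where
  "tangent_deriv n v F = (\<Sum>k<n. mscale (v k) (special_fibre (mderiv (Par k) F)))"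

lemma mscale_mult_left: "mscale c (F * G) = mscale c F * G"
  and mscale_mult_right: "mscale c (F * G) = F * mscale c G"
  by (simp_all add: mscale_def ac_simps)

lemma mscale_add_right: "mscale c (F + G) = mscale c F + mscale c G"
  by (simp add: mscale_def algebra_simps)

lemma tangent_deriv_add: "tangent_deriv n v (F + G) = tangent_deriv n v F + tangent_deriv n v G"
  by (simp add: tangent_deriv_def mderiv_add mscale_add_right sum.distrib)

lemma tangent_deriv_0 [simp]: "tangent_deriv n v 0 = 0"
  by (simp add: tangent_deriv_def mscale_def)

lemma tangent_deriv_1 [simp]: "tangent_deriv n v 1 = 0"
  by (simp add: tangent_deriv_def mscale_def)

lemma tangent_deriv_sum: "tangent_deriv n v (sum F A) = (\<Sum>i\<in>A. tangent_deriv n v (F i))"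
  by (induction A rule: infinite_finite_induct) (auto simp: tangent_deriv_add)

lemma tangent_deriv_mult: "tangent_deriv n v (F * G) =
    tangent_deriv n v F * special_fibre G + special_fibre F * tangent_deriv n v G"
  by (simp add: tangent_deriv_def mderiv_mult mscale_add_right sum.distrib
      sum_distrib_left sum_distrib_right mscale_mult_left mscale_mult_right[symmetric])

lemma tangent_deriv_uminus: "tangent_deriv n v (- F) = - tangent_deriv n v F"
  using tangent_deriv_add[of n v F "- F"] by (simp add: eq_neg_iff_add_eq_0 add.commute)

lemma tangent_deriv_diff: "tangent_deriv n v (F - G) = tangent_deriv n v F - tangent_deriv n v G"
  using tangent_deriv_add[of n v F "- G"] by (simp add: tangent_deriv_uminus)

lemma coeff_tangent_deriv:
  "coeff (tangent_deriv n v F) m = (if keys m \<subseteq> {LU, LV}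
     then \<Sum>k<n. v k * coeff F (m + single (Par k) 1) else 0)"
proof (cases "keys m \<subseteq> {LU, LV}")
  case True
  then have "lookup m (Par k) = 0" for k by (auto simp: in_keys_iff)
  then show ?thesis using True by (simp add: tangent_deriv_def special_fibre_coeff coeff_mderiv)
next
  case False
  then show ?thesis by (simp add: tangent_deriv_def special_fibre_coeff)
qed

lemma tangent_deriv_in_plane [intro]: "F \<in> germs A \<Longrightarrow> tangent_deriv n v F \<in> plane_ring"
  unfolding tangent_deriv_def by (intro germs_sum germs_mscale special_fibre_in_plane germs_mderiv)

lemma tangent_deriv_param:
  assumes "F \<in> param_ring n'"
  shows "tangent_deriv n v F = mconst (dir_deriv n v F)"
proof (rule mps_eqI)
  fix m
  show "coeff (tangent_deriv n v F) m = coeff (mconst (dir_deriv n v F)) m"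
  proof (cases "keys m \<subseteq> {LU, LV} \<and> m \<noteq> 0")
    case True
    have "coeff F (m + single (Par k) 1) = 0" for k
    proof (rule ccontr)
      assume "coeff F (m + single (Par k) 1) \<noteq> 0"
      then have "keys m \<subseteq> Par ` {..<n'}" using germs_support[OF assms] by fastforce
      then show False using True monomial_plane_param by blast
    qed
    then show ?thesis using True by (simp add: coeff_tangent_deriv coeff_mconst)
  next
    case False
    then show ?thesis by (auto simp: coeff_tangent_deriv coeff_mconst dir_deriv_def)
  qed
qed

lemma tangent_deriv_plane:
  assumes "F \<in> plane_ring"
  shows "tangent_deriv n v F = 0"
proof (rule mps_eqI)
  fix m
  have "coeff F (m + single (Par k) 1) = 0" for k
    using germs_support[OF assms, of "m + single (Par k) 1"] by auto
  then show "coeff (tangent_deriv n v F) m = coeff 0 m" by (simp add: coeff_tangent_deriv)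
qed

lemma tangent_deriv_mvar: "k < n \<Longrightarrow> tangent_deriv n v (mvar (Par k)) = mconst (v k)"
proof -
  assume k: "k < n"
  have "tangent_deriv n v (mvar (Par k)) = (\<Sum>i<n. if i = k then mconst (v k) else 0)"
    unfolding tangent_deriv_def by (rule sum.cong) (auto simp: mderiv_mvar mscale_def)
  then show ?thesis using k by simp
qed

section \<open>Chain rule\<close>

abbreviation total_vars :: "nat \<Rightarrow> lvar set" where
  "total_vars m \<equiv> {LU, LV} \<union> Par ` {..<m}"

lemma special_fibre_monomial_value:
  "special_fibre (monomial_value \<sigma> a) = monomial_value (\<lambda>x. special_fibre (\<sigma> x)) a"
  by (simp add: monomial_value_def)

lemma special_fibre_monomial_value_eq_mmon:
  assumes "\<And>x. x \<in> V \<Longrightarrow> special_fibre (\<sigma> x) = special_fibre (mvar x)" "keys a \<subseteq> V"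
  shows "special_fibre (monomial_value \<sigma> a) = special_fibre (mmon a)"
  unfolding mmon_eq_monomial_value special_fibre_monomial_value
  using assms by (intro monomial_value_cong) auto

text \<open>The hypothesis on \<sigma> says that the substitution is the identity on the special
  fibre. Therefore the derivatives of the monomial appear unsubstituted.\<close>

lemma tangent_deriv_monomial_value:
  assumes \<sigma>: "\<And>x. x \<in> V \<Longrightarrow> special_fibre (\<sigma> x) = special_fibre (mvar x)" and V: "finite V"
  shows "keys a \<subseteq> V \<Longrightarrow> tangent_deriv n v (monomial_value \<sigma> a) =
      (\<Sum>x\<in>V. special_fibre (mderiv x (mmon a)) * tangent_deriv n v (\<sigma> x))"
proof (induction a rule: monomial_induct)
  case zero
  then show ?case by (simp add: mmon_0)
next
  case (add a y)
  then have y: "y \<in> V" and a: "keys a \<subseteq> V" by auto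
  note sf = special_fibre_monomial_value_eq_mmon[OF \<sigma> a]
  have "tangent_deriv n v (monomial_value \<sigma> (a + single y 1))
      = (\<Sum>x\<in>V. special_fibre (mderiv x (mmon a)) * tangent_deriv n v (\<sigma> x)) * special_fibre (mvar y)
        + special_fibre (mmon a) * tangent_deriv n v (\<sigma> y)"
    using add.IH[OF a] by (simp add: monomial_value_add tangent_deriv_mult sf \<sigma>[OF y])
  also have "special_fibre (mmon a) * tangent_deriv n v (\<sigma> y)
      = (\<Sum>x\<in>V. if x = y then special_fibre (mmon a) * tangent_deriv n v (\<sigma> x) else 0)"
    using V y by simp
  also have "(\<Sum>x\<in>V. special_fibre (mderiv x (mmon a)) * tangent_deriv n v (\<sigma> x)) * special_fibre (mvar y) + \<dots>
      = (\<Sum>x\<in>V. special_fibre (mderiv x (mmon (a + single y 1))) * tangent_deriv n v (\<sigma> x))"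
    unfolding sum_distrib_right sum.distrib[symmetric]
    by (rule sum.cong) (auto simp: mmon_add mvar_eq_mmon[symmetric] mderiv_mult mderiv_mvar algebra_simps simp del: One_nat_def)
  finally show ?case .
qed

text \<open>Each coefficient of \<open>msubst\<close> sees only a Taylor polynomial of the series;
  truncation turns the chain rule into a statement about finite sums of monomials.\<close>

definition truncation :: "nat \<Rightarrow> 'v mps \<Rightarrow> 'v mps" where
  "truncation K G = (\<Sum>a | mdeg a \<le> K \<and> coeff G a \<noteq> 0. mscale (coeff G a) (mmon a))"

lemma finite_low_degree_support:
  assumes "G \<in> germs V" "finite V"
  shows "finite {a. mdeg a \<le> K \<and> coeff G a \<noteq> 0}"
  by (rule finite_subset[OF _ finite_monomials_le[OF assms(2), of K]])
     (use germs_support[OF assms(1)] in auto)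

lemma coeff_truncation:
  assumes "G \<in> germs V" "finite V"
  shows "coeff (truncation K G) b = (if mdeg b \<le> K then coeff G b else 0)"
proof -
  have "coeff (truncation K G) b = (\<Sum>a | mdeg a \<le> K \<and> coeff G a \<noteq> 0. if a = b then coeff G b else 0)"
    unfolding truncation_def coeff_sum by (rule sum.cong) (auto simp: coeff_mmon)
  then show ?thesis using finite_low_degree_support[OF assms, of K] by (simp add: sum.delta')
qed

lemma coeff_msubst: "coeff (msubst \<sigma> G) m =
    (\<Sum>a | mdeg a \<le> mdeg m \<and> coeff G a \<noteq> 0. coeff G a * coeff (monomial_value \<sigma> a) m)"
  by (simp add: msubst_def monomial_value_def)

lemma special_fibre_msubst:
  assumes G: "G \<in> germs V" and V: "finite V"
    and \<sigma>: "\<And>x. x \<in> V \<Longrightarrow> special_fibre (\<sigma> x) = special_fibre (mvar x)"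
  shows "special_fibre (msubst \<sigma> G) = special_fibre G"
proof (rule mps_eqI)
  fix m
  show "coeff (special_fibre (msubst \<sigma> G)) m = coeff (special_fibre G) m"
  proof (cases "keys m \<subseteq> {LU, LV}")
    case True
    have "coeff (msubst \<sigma> G) m
        = (\<Sum>a | mdeg a \<le> mdeg m \<and> coeff G a \<noteq> 0. coeff G a * coeff (special_fibre (monomial_value \<sigma> a)) m)"
      using True by (simp add: coeff_msubst special_fibre_coeff)
    also have "\<dots> = (\<Sum>a | mdeg a \<le> mdeg m \<and> coeff G a \<noteq> 0. coeff G a * coeff (special_fibre (mmon a)) m)"
      by (rule sum.cong) (auto simp: special_fibre_monomial_value_eq_mmon[OF \<sigma> germs_support[OF G]])
    also have "\<dots> = coeff (truncation (mdeg m) G) m"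
      using True by (simp add: truncation_def special_fibre_coeff)
    finally show ?thesis using True by (simp add: coeff_truncation[OF G V] special_fibre_coeff)
  qed (simp add: special_fibre_coeff)
qed

lemma tangent_deriv_msubst:
  assumes G: "G \<in> germs V" and V: "finite V"
    and \<sigma>: "\<And>x. x \<in> V \<Longrightarrow> special_fibre (\<sigma> x) = special_fibre (mvar x)"
  shows "tangent_deriv n v (msubst \<sigma> G) =
    (\<Sum>x\<in>V. special_fibre (mderiv x G) * tangent_deriv n v (\<sigma> x))"
proof (rule mps_eqI)
  fix m
  let ?R = "\<Sum>x\<in>V. special_fibre (mderiv x G) * tangent_deriv n v (\<sigma> x)"
  show "coeff (tangent_deriv n v (msubst \<sigma> G)) m = coeff ?R m"
  proof (cases "keys m \<subseteq> {LU, LV}")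
    case True
    \<comment> \<open>The tangent derivative at \<open>m\<close> uses coefficients at
      \<open>m\<close> times one parameter, hence one degree more.\<close>
    let ?K = "mdeg m + 1"
    let ?A = "{a. mdeg a \<le> ?K \<and> coeff G a \<noteq> 0}"
    let ?e = "\<lambda>k. single (Par k) (1::nat)"
    have "coeff (tangent_deriv n v (msubst \<sigma> G)) m
        = (\<Sum>k<n. v k * (\<Sum>a\<in>?A. coeff G a * coeff (monomial_value \<sigma> a) (m + ?e k)))"
      using True by (simp add: coeff_tangent_deriv coeff_msubst)
    also have "\<dots> = (\<Sum>a\<in>?A. coeff G a * (\<Sum>k<n. v k * coeff (monomial_value \<sigma> a) (m + ?e k)))"
      unfolding sum_distrib_left by (subst sum.swap) (simp add: algebra_simps)
    also have "\<dots> = (\<Sum>a\<in>?A. coeff G a * coeff (tangent_deriv n v (monomial_value \<sigma> a)) m)"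
      using True by (simp add: coeff_tangent_deriv)
    also have "\<dots> = (\<Sum>a\<in>?A. coeff G a *
        coeff (\<Sum>x\<in>V. special_fibre (mderiv x (mmon a)) * tangent_deriv n v (\<sigma> x)) m)"
      by (rule sum.cong) (auto simp: tangent_deriv_monomial_value[OF \<sigma> V germs_support[OF G]])
    also have "\<dots> = coeff (\<Sum>a\<in>?A. \<Sum>x\<in>V. mscale (coeff G a)
        (special_fibre (mderiv x (mmon a))) * tangent_deriv n v (\<sigma> x)) m"
      by (simp add: sum_distrib_left mscale_mult_left[symmetric])
    also have "(\<Sum>a\<in>?A. \<Sum>x\<in>V. mscale (coeff G a) (special_fibre (mderiv x (mmon a))) * tangent_deriv n v (\<sigma> x))
        = (\<Sum>x\<in>V. special_fibre (mderiv x (truncation ?K G)) * tangent_deriv n v (\<sigma> x))"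
      by (subst sum.swap) (simp add: truncation_def mderiv_sum sum_distrib_right mscale_def mderiv_mult)
    also have "coeff \<dots> m = coeff ?R m"
    proof -
      \<comment> \<open>Truncation is invisible in the coefficient at \<open>m\<close>, because
        differentiation lowers the degree by only one.\<close>
      have "coeff (special_fibre (mderiv x (truncation ?K G)) * T) m = coeff (special_fibre (mderiv x G) * T) m"
        for x T
        unfolding coeff_mult
      proof (rule sum.cong)
        fix p assume "p \<in> {(a, b). a + b = m}"
        then obtain a b where p: "p = (a, b)" "a + b = m" by auto
        then have "mdeg a \<le> mdeg m" by auto
        then have "coeff (special_fibre (mderiv x (truncation ?K G))) a = coeff (special_fibre (mderiv x G)) a"
          by (simp add: special_fibre_coeff coeff_mderiv coeff_truncation[OF G V])
        then show "(case p of (a, b) \<Rightarrow> coeff (special_fibre (mderiv x (truncation ?K G))) a * coeff T b)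
            = (case p of (a, b) \<Rightarrow> coeff (special_fibre (mderiv x G)) a * coeff T b)"
          by (simp add: p)
      qed simp
      then show ?thesis by simp
    qed
    finally show ?thesis .
  next
    case False
    have "special_fibre ?R = ?R"
    proof -
      have "special_fibre (tangent_deriv n v F) = tangent_deriv n v F" for F
        by (rule mps_eqI) (auto simp: special_fibre_coeff coeff_tangent_deriv)
      moreover have "special_fibre (special_fibre F) = special_fibre F" for F
        by (rule mps_eqI) (auto simp: special_fibre_coeff)
      ultimately show ?thesis by simp
    qed
    then have "coeff ?R m = 0" using False by (metis special_fibre_coeff)
    then show ?thesis using False by (simp add: coeff_tangent_deriv)
  qed
qed

text \<open>At a small radius all substituted series have norm at most \<rho>, a radius at which
  \<open>G\<close> is bounded. The image of a monomial of degree n then has norm at most \<rho>^n,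
  and the bound for \<open>G\<close> carries over.\<close>

lemma msubst_in_germs:
  assumes G: "G \<in> germs V" and V: "finite V"
    and \<sigma>: "\<And>x. x \<in> V \<Longrightarrow> \<sigma> x \<in> germs W" "\<And>x. x \<in> V \<Longrightarrow> coeff (\<sigma> x) 0 = 0"
  shows "msubst \<sigma> G \<in> germs W"
proof -
  obtain \<rho> C where \<rho>: "0 < \<rho>" "norm_bound \<rho> G C" using germsE[OF G] .
  have "\<exists>s>0. norm_bound s (\<sigma> x) \<rho>" if "x \<in> V" for x
    using that \<sigma> \<rho>(1) by (metis germsE norm_bound_small)
  then obtain s where s: "\<And>x. x \<in> V \<Longrightarrow> s x > 0 \<and> norm_bound (s x) (\<sigma> x) \<rho>" by metis
  define r where "r = Min (insert 1 (s ` V))"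
  have r: "0 < r" using V s by (auto simp: r_def)
  have rs: "r \<le> s x" if "x \<in> V" for x using V that by (auto simp: r_def)
  have \<sigma>r: "norm_bound r (\<sigma> x) \<rho>" if "x \<in> V" for x
    using s[OF that] rs[OF that] r by (auto intro: norm_bound_shrink)
  have mono: "norm_bound r (monomial_value \<sigma> a) (\<rho> ^ mdeg a)" if "keys a \<subseteq> V" for a
  proof -
    have "norm_bound r (monomial_value \<sigma> a) (\<Prod>x\<in>keys a. \<rho> ^ lookup a x)"
      unfolding monomial_value_def using r that
      by (intro norm_bound_prod norm_bound_power \<sigma>r) auto
    then show ?thesis by (simp add: mdeg_def power_sum)
  qed
  have "norm_bound r (msubst \<sigma> G) C"
    unfolding norm_bound_def
  proof (intro allI impI)
    fix M :: "('b \<Rightarrow>\<^sub>0 nat) set" assume M: "finite M"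
    define K where "K = Max (insert 0 (mdeg ` M))"
    have K: "mdeg m \<le> K" if "m \<in> M" for m using M that by (auto simp: K_def)
    let ?A = "\<lambda>K. {a. mdeg a \<le> K \<and> coeff G a \<noteq> 0}"
    note finA = finite_low_degree_support[OF G V]
    have "(\<Sum>m\<in>M. norm (coeff (msubst \<sigma> G) m) * r ^ mdeg m)
        \<le> (\<Sum>m\<in>M. \<Sum>a\<in>?A K. norm (coeff G a) * (norm (coeff (monomial_value \<sigma> a) m) * r ^ mdeg m))"
    proof (rule sum_mono)
      fix m assume m: "m \<in> M"
      have "norm (coeff (msubst \<sigma> G) m) \<le> (\<Sum>a\<in>?A (mdeg m). norm (coeff G a * coeff (monomial_value \<sigma> a) m))"
        unfolding coeff_msubst by (rule norm_sum)
      also have "\<dots> \<le> (\<Sum>a\<in>?A K. norm (coeff G a * coeff (monomial_value \<sigma> a) m))"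
        using K[OF m] finA by (intro sum_mono2) auto
      finally have "norm (coeff (msubst \<sigma> G) m) * r ^ mdeg m
          \<le> (\<Sum>a\<in>?A K. norm (coeff G a * coeff (monomial_value \<sigma> a) m)) * r ^ mdeg m"
        using r by (intro mult_right_mono) auto
      then show "norm (coeff (msubst \<sigma> G) m) * r ^ mdeg m
          \<le> (\<Sum>a\<in>?A K. norm (coeff G a) * (norm (coeff (monomial_value \<sigma> a) m) * r ^ mdeg m))"
        by (simp add: sum_distrib_right norm_mult mult.assoc)
    qed
    also have "\<dots> = (\<Sum>a\<in>?A K. norm (coeff G a) * (\<Sum>m\<in>M. norm (coeff (monomial_value \<sigma> a) m) * r ^ mdeg m))"
      by (subst sum.swap) (simp add: sum_distrib_left)
    also have "\<dots> \<le> (\<Sum>a\<in>?A K. norm (coeff G a) * \<rho> ^ mdeg a)"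
      using M germs_support[OF G] by (intro sum_mono mult_left_mono norm_boundD[OF mono]) auto
    also have "\<dots> \<le> C" by (rule norm_boundD[OF \<rho>(2) finA])
    finally show "(\<Sum>m\<in>M. norm (coeff (msubst \<sigma> G) m) * r ^ mdeg m) \<le> C" .
  qed
  then show ?thesis
  proof (rule germsI[rotated 2])
    fix m assume "coeff (msubst \<sigma> G) m \<noteq> 0"
    then obtain a where a: "coeff G a \<noteq> 0" "coeff (monomial_value \<sigma> a) m \<noteq> 0"
      by (auto simp: coeff_msubst elim: sum.not_neutral_contains_not_neutral)
    have "monomial_value \<sigma> a \<in> germs W"
      unfolding monomial_value_def using germs_support[OF G a(1)] \<sigma>(1) by auto
    then show "keys m \<subseteq> W" using a(2) germs_support by blast
  qed (use r in simp)
qed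

section \<open>Kodaira--Spencer classes of a miniversal deformation\<close>

abbreviation tjurina_ideal :: "lvar mps \<Rightarrow> lvar mps set" where
  "tjurina_ideal g \<equiv> ideal_gen plane_ring {g, mderiv LU g, mderiv LV g}"

abbreviation ks_class :: "lvar mps \<Rightarrow> nat \<Rightarrow> lvar mps" where
  "ks_class G i \<equiv> special_fibre (mderiv (Par i) G)"

text \<open>Linearisation of a pullback: the unit contributes a multiple of \<open>g\<close> and the
  coordinate changes multiples of its two derivatives, so modulo the Tjurina ideal only the
  Kodaira-Spencer classes remain.\<close>

lemma tangent_deriv_pullback:
  assumes G: "G \<in> total_ring m" and g: "special_fibre G = g"
    and EAB: "special_fibre E = 1" "special_fibre A = mvar LU" "special_fibre B = mvar LV"
    and \<phi>: "\<And>i. i < m \<Longrightarrow> \<phi> i \<in> param_max_ideal n'"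
  shows "special_fibre (E * msubst (case_lvar A B \<phi>) G) = g"
    and "tangent_deriv n v (E * msubst (case_lvar A B \<phi>) G) =
      tangent_deriv n v E * g + (mderiv LU g * tangent_deriv n v A + mderiv LV g * tangent_deriv n v B +
        (\<Sum>i<m. mscale (dir_deriv n v (\<phi> i)) (ks_class G i)))"
proof -
  let ?\<sigma> = "case_lvar A B \<phi>"
  have \<phi>': "\<phi> i \<in> param_ring n'" "coeff (\<phi> i) 0 = 0" if "i < m" for i
    using \<phi>[OF that] by (auto simp: param_max_ideal_def)
  have \<sigma>: "special_fibre (?\<sigma> x) = special_fibre (mvar x)" if "x \<in> total_vars m" for x
    using that EAB \<phi>' special_fibre_param[OF \<phi>'(1)] by (auto simp: special_fibre_mvar)
  have fin: "finite (total_vars m)" by simp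
  have sf: "special_fibre (msubst ?\<sigma> G) = g" using special_fibre_msubst[OF G fin \<sigma>] g by simp
  show "special_fibre (E * msubst ?\<sigma> G) = g" using EAB by (simp add: sf)
  have "tangent_deriv n v (msubst ?\<sigma> G)
      = (\<Sum>x\<in>total_vars m. special_fibre (mderiv x G) * tangent_deriv n v (?\<sigma> x))"
    by (rule tangent_deriv_msubst[OF G fin \<sigma>])
  also have "total_vars m = insert LU (insert LV (Par ` {..<m}))" by auto
  also have "(\<Sum>x\<in>\<dots>. special_fibre (mderiv x G) * tangent_deriv n v (?\<sigma> x))
     = mderiv LU g * tangent_deriv n v A + mderiv LV g * tangent_deriv n v B +
        (\<Sum>i<m. ks_class G i * tangent_deriv n v (\<phi> i))"
    by (subst sum.insert, simp, simp add: image_iff, subst sum.insert, simp, simp add: image_iff,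
        subst sum.reindex) (auto simp: inj_on_def special_fibre_mderiv g)
  also have "(\<Sum>i<m. ks_class G i * tangent_deriv n v (\<phi> i))
      = (\<Sum>i<m. mscale (dir_deriv n v (\<phi> i)) (ks_class G i))"
    by (rule sum.cong) (auto simp: tangent_deriv_param[OF \<phi>'(1)] mscale_def mult.commute)
  finally show "tangent_deriv n v (E * msubst ?\<sigma> G) =
      tangent_deriv n v E * g + (mderiv LU g * tangent_deriv n v A + mderiv LV g * tangent_deriv n v B +
        (\<Sum>i<m. mscale (dir_deriv n v (\<phi> i)) (ks_class G i)))"
    using EAB(1) by (simp add: tangent_deriv_mult sf)
qed

text \<open>The elements of \<open>S\<close> vanish at the origin and are annihilated by
  \<open>v\<close>, so the whole ideal they generate has derivative 0 along \<open>v\<close>. An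
  isomorphism of families modulo \<open>S\<close> thus gives an exact first-order equation.\<close>

lemma first_order_of_induced:
  assumes ind: "induces n S m G \<phi> F" and G: "is_deformation g m G"
    and S: "S \<subseteq> param_max_ideal n" "\<And>s. s \<in> S \<Longrightarrow> dir_deriv n v s = 0"
  shows "tangent_deriv n v F - (\<Sum>i<m. mscale (dir_deriv n v (\<phi> i)) (ks_class G i)) \<in> tjurina_ideal g"
proof -
  have Gg: "G \<in> total_ring m" "special_fibre G = g" using G by (auto simp: is_deformation_def)
  have \<phi>: "\<And>i. i < m \<Longrightarrow> \<phi> i \<in> param_max_ideal n" using ind by (simp add: induces_def)
  obtain E A B where EAB: "E \<in> total_ring n" "A \<in> total_ring n" "B \<in> total_ring n"
      "special_fibre E = 1" "special_fibre A = mvar LU" "special_fibre B = mvar LV"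
      and F: "F - E * msubst (case_lvar A B \<phi>) G \<in> ideal_gen (total_ring n) S"
    using ind unfolding induces_def by blast
  let ?H = "E * msubst (case_lvar A B \<phi>) G"
  have "tangent_deriv n v (F - ?H) = 0"
    using F
  proof (induction rule: ideal_gen_induct)
    case (add x a s)
    then have s: "s \<in> param_ring n" "coeff s 0 = 0" using S by (auto simp: param_max_ideal_def)
    have "special_fibre s = 0" using special_fibre_param[OF s(1)] s(2) by simp
    moreover have "tangent_deriv n v s = 0" using tangent_deriv_param[OF s(1)] S(2) add by simp
    ultimately show ?case using add by (simp add: tangent_deriv_add tangent_deriv_mult)
  qed simp
  then have "tangent_deriv n v F - (\<Sum>i<m. mscale (dir_deriv n v (\<phi> i)) (ks_class G i))
      = tangent_deriv n v E * g + tangent_deriv n v A * mderiv LU g + tangent_deriv n v B * mderiv LV g"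
    using tangent_deriv_pullback(2)[OF Gg EAB(4-6), where \<phi> = \<phi> and n' = n and n = n and v = v, OF \<phi>]
    by (simp add: tangent_deriv_diff algebra_simps)
  then show ?thesis
    unfolding ideal_gen_three using EAB by blast
qed

text \<open>Pulling \<open>G\<close> back along the constant map gives \<open>g\<close> itself. This
  starts the versality test and supplies the comparison morphism for uniqueness.\<close>

lemma induces_trivial:
  assumes G: "is_deformation g m G" and F: "F - g \<in> ideal_gen (total_ring n) S"
  shows "induces n S m G (\<lambda>_. 0) F"
proof -
  have Gg: "G \<in> total_ring m" "special_fibre G = g" using G by (auto simp: is_deformation_def)
  let ?\<sigma> = "case_lvar (mvar LU) (mvar LV) (\<lambda>_. 0)"
  have sf: "?\<sigma> x = special_fibre (mvar x)" for x
    by (cases x) (auto simp: special_fibre_mvar)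
  have idem: "special_fibre (special_fibre F) = special_fibre F" for F
    by (rule mps_eqI) (simp add: special_fibre_coeff)
  have "special_fibre (msubst ?\<sigma> G) = g"
    using special_fibre_msubst[OF Gg(1), of ?\<sigma>] Gg(2) by (simp add: sf idem)
  moreover have "special_fibre (msubst ?\<sigma> G) = msubst ?\<sigma> G"
  proof (rule mps_eqI)
    fix m
    have "special_fibre (monomial_value ?\<sigma> a) = monomial_value ?\<sigma> a" for a
      unfolding special_fibre_monomial_value by (rule monomial_value_cong) (metis sf idem)
    then have "keys m \<subseteq> {LU, LV} \<or> coeff (monomial_value ?\<sigma> a) m = 0" for a
      by (metis special_fibre_coeff)
    then have "keys m \<subseteq> {LU, LV} \<or> coeff (msubst ?\<sigma> G) m = 0"
      unfolding coeff_msubst by (metis (no_types, lifting) mult_zero_right sum.neutral)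
    then show "coeff (special_fibre (msubst ?\<sigma> G)) m = coeff (msubst ?\<sigma> G) m"
      by (auto simp: special_fibre_coeff)
  qed
  ultimately have H: "F - 1 * msubst ?\<sigma> G \<in> ideal_gen (total_ring n) S" using F by simp
  show ?thesis
    unfolding induces_def
  proof (intro conjI allI impI)
    show "(0 :: lvar mps) \<in> param_max_ideal n" by (simp add: param_max_ideal_def)
    show "\<exists>E\<in>total_ring n. \<exists>A\<in>total_ring n. \<exists>B\<in>total_ring n.
        special_fibre E = 1 \<and> special_fibre A = mvar LU \<and> special_fibre B = mvar LV \<and>
        F - E * msubst (case_lvar A B (\<lambda>_. 0)) G \<in> ideal_gen (total_ring n) S"
      by (rule bexI[of _ 1], rule bexI[of _ "mvar LU"], rule bexI[of _ "mvar LV"])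
        (use H in \<open>auto simp: special_fibre_mvar\<close>)
  qed
qed

lemma dir_deriv_square: "coeff F 0 = 0 \<Longrightarrow> dir_deriv n v (F ^ 2) = 0"
  by (simp add: dir_deriv_def power2_eq_square coeff_mult_linear[simplified])

text \<open>With a single parameter t the two conditions say that the coefficients of 1 and t
  vanish. This converts first-order equalities back into congruences modulo t^2.\<close>

lemma divisible_by_square_of_parameter:
  assumes F: "F \<in> total_ring 1" and "special_fibre F = 0" "tangent_deriv 1 (\<lambda>_. 1) F = 0"
  shows "F \<in> ideal_gen (total_ring 1) {mvar (Par 0) ^ 2}"
proof -
  let ?p = "single (Par 0) (2::nat)"
  define Q where "Q = Mps (\<lambda>m. coeff F (m + ?p))"
  have Q: "Q \<in> total_ring 1" by (rule germs_shift[OF F, of _ ?p]) (simp add: Q_def)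
  have "coeff F m = coeff (mmon ?p * Q) m" for m
  proof (cases "\<exists>c. m = ?p + c")
    case True
    then obtain c where c: "m = ?p + c" by blast
    have "coeff (mmon ?p * Q) (?p + c) = coeff F (?p + c)"
      unfolding coeff_mmon_mult_add by (simp add: Q_def add.commute)
    then show ?thesis by (simp add: c)
  next
    case False
    have "coeff F m = 0"
    proof (rule ccontr)
      assume nz: "coeff F m \<noteq> 0"
      then have keys: "keys m \<subseteq> {LU, LV, Par 0}" using germs_support[OF F] by auto
      show False
      proof (cases "Par 0 \<in> keys m")
        case False
        then have "coeff (special_fibre F) m \<noteq> 0" using nz keys by (auto simp: special_fibre_coeff)
        then show False using assms(2) by simp
      next
        case True
        define n where "n = m - single (Par 0) 1"
        have m: "m = n + single (Par 0) 1" using monomial_split[OF True] by (simp add: n_def)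
        show False
        proof (cases "Par 0 \<in> keys n")
          case True
          have "m = (n - single (Par 0) 1) + (single (Par 0) 1 + single (Par 0) 1)"
            using monomial_split[OF True] m by (metis add.assoc)
          also have "\<dots> = ?p + (n - single (Par 0) 1)"
            by (simp add: single_add[symmetric] add.commute numeral_2_eq_2)
          finally show False using \<open>\<nexists>c. m = ?p + c\<close> by blast
        next
          case False
          then have "keys n \<subseteq> {LU, LV}" using keys m by auto
          then have "coeff (tangent_deriv 1 (\<lambda>_. 1) F) n = coeff F m"
            by (simp add: coeff_tangent_deriv m)
          then show False using assms(3) nz by simp
        qed
      qed
    qed
    then show ?thesis using False by (simp add: coeff_mmon_mult_eq_0)
  qed
  then have "F = Q * mvar (Par 0) ^ 2"
    by (intro mps_eqI) (simp add: mmon_eq_monomial_value mult.commute)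
  then show ?thesis using Q by (auto intro: ideal_gen_baseI)
qed

text \<open>Versality applied to the family g + t h over t^2 = 0: over the reduced point it is
  trivial and induced by 0, and this morphism extends to one over t^2 = 0, whose linear part
  expresses h.\<close>

lemma ks_classes_span:
  assumes G: "miniversal g m G" and h: "h \<in> plane_ring"
  shows "\<exists>c. h - (\<Sum>i<m. mscale (c i) (ks_class G i)) \<in> tjurina_ideal g"
proof -
  have def: "is_deformation g m G" and ver: "versal g m G" using G by (auto simp: miniversal_def)
  have g: "g \<in> plane_ring" using def by (auto simp: is_deformation_def)
  let ?t = "mvar (Par 0)" let ?v = "\<lambda>_::nat. 1::complex"
  define F where "F = g + ?t * h"
  have t: "?t \<in> param_ring 1" by auto
  have t0: "coeff ?t 0 = 0" by (simp add: coeff_mvar)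
  have tmax: "?t \<in> param_max_ideal 1" "?t ^ 2 \<in> param_max_ideal 1"
    using t t0 by (auto simp: param_max_ideal_def)
  have "special_fibre F = g" by (simp add: F_def special_fibre_plane[OF g] special_fibre_mvar)
  moreover have "F \<in> total_ring 1"
    unfolding F_def using g h t plane_subset_total param_subset_total by blast
  ultimately have Fdef: "is_deformation g 1 F" by (simp add: is_deformation_def)
  have "h * ?t \<in> ideal_gen (total_ring 1) {?t ^ 2, ?t}"
    using h plane_subset_total by (intro ideal_gen_baseI) auto
  \<comment> \<open>Adjoining t to t^2 cuts out the reduced point, over which the family is
    \<open>g\<close>.\<close>
  then have "induces 1 {?t ^ 2, ?t} m G (\<lambda>_. 0) F"
    by (intro induces_trivial[OF def]) (simp add: F_def mult.commute)
  then obtain \<phi> where "induces 1 {?t ^ 2} m G \<phi> F"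
    using ver[unfolded versal_def, rule_format, of "{?t ^ 2}" "{?t ^ 2, ?t}" 1 F "\<lambda>_. 0"] Fdef tmax by auto
  then have "tangent_deriv 1 ?v F - (\<Sum>i<m. mscale (dir_deriv 1 ?v (\<phi> i)) (ks_class G i)) \<in> tjurina_ideal g"
    by (rule first_order_of_induced[OF _ def]) (use tmax t0 dir_deriv_square in auto)
  moreover have "tangent_deriv 1 ?v F = h"
    by (simp add: F_def tangent_deriv_add tangent_deriv_mult tangent_deriv_plane[OF g]
        tangent_deriv_plane[OF h] special_fibre_plane[OF h] tangent_deriv_mvar)
  ultimately show ?thesis by (intro exI[of _ "\<lambda>i. dir_deriv 1 ?v (\<phi> i)"]) simp
qed

lemma miniversal_tangent_unique:
  assumes "miniversal g m G" "S \<subseteq> param_max_ideal n" "is_deformation g n F"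
    "induces n S m G \<phi> F" "induces n S m G \<phi>' F" "\<forall>h\<in>S. dir_deriv n v h = 0"
  shows "\<forall>i<m. dir_deriv n v (\<phi> i) = dir_deriv n v (\<phi>' i)"
proof -
  have "\<forall>n S F \<phi> \<phi>' v. S \<subseteq> param_max_ideal n \<longrightarrow> is_deformation g n F \<longrightarrow>
        induces n S m G \<phi> F \<longrightarrow> induces n S m G \<phi>' F \<longrightarrow>
        (\<forall>h\<in>S. dir_deriv n v h = 0) \<longrightarrow>
        (\<forall>i<m. dir_deriv n v (\<phi> i) = dir_deriv n v (\<phi>' i))"
    using assms(1) unfolding miniversal_def by (elim conjE)
  from this[THEN spec, THEN spec, THEN spec, THEN spec, THEN spec, THEN spec,
      THEN mp, THEN mp, THEN mp, THEN mp, THEN mp, OF assms(2-6)]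
  show ?thesis .
qed

text \<open>
  A relation modulo the Tjurina ideal is absorbed by a first-order coordinate change and unit, so
  the trivial deformation is induced modulo \<open>t\<^sup>2\<close> both by \<open>c\<^sub>i t\<close> and by 0.
\<close>

lemma ks_classes_independent:
  assumes G: "miniversal g m G"
    and c: "(\<Sum>i<m. mscale (c i) (ks_class G i)) \<in> tjurina_ideal g"
  shows "\<forall>i<m. c i = 0"
proof -
  have def: "is_deformation g m G" using G by (auto simp: miniversal_def)
  then have Gg: "G \<in> total_ring m" "special_fibre G = g" by (auto simp: is_deformation_def)
  then have g: "g \<in> plane_ring" by auto
  have gdef: "is_deformation g 1 g"
    using g special_fibre_plane plane_subset_total by (auto simp: is_deformation_def)
  let ?t = "mvar (Par 0)" let ?v = "\<lambda>_::nat. 1::complex"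
  have t: "?t \<in> param_ring 1" by auto
  have tt: "?t \<in> total_ring 1" by auto
  have t0: "coeff ?t 0 = 0" by (simp add: coeff_mvar)
  have tmax: "{?t ^ 2} \<subseteq> param_max_ideal 1" using t t0 by (auto simp: param_max_ideal_def)
  obtain \<alpha> \<beta> \<gamma> where abc: "\<alpha> \<in> plane_ring" "\<beta> \<in> plane_ring" "\<gamma> \<in> plane_ring"
      and eq: "(\<Sum>i<m. mscale (c i) (ks_class G i)) = \<alpha> * g + \<beta> * mderiv LU g + \<gamma> * mderiv LV g"
    using c unfolding ideal_gen_three by blast
  \<comment> \<open>The minus signs make the unit and the coordinate changes cancel the
    Kodaira-Spencer term of \<phi> to first order.\<close>
  define E where "E = 1 - ?t * \<alpha>"
  define A where "A = mvar LU - ?t * \<beta>"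
  define B where "B = mvar LV - ?t * \<gamma>"
  define \<phi> where "\<phi> i = mscale (c i) ?t" for i :: nat
  have total: "\<alpha> \<in> total_ring 1" "\<beta> \<in> total_ring 1" "\<gamma> \<in> total_ring 1"
    using abc plane_subset_total by auto
  have EAB: "E \<in> total_ring 1" "A \<in> total_ring 1" "B \<in> total_ring 1"
    using total tt by (auto simp: E_def A_def B_def)
  have sf: "special_fibre E = 1" "special_fibre A = mvar LU" "special_fibre B = mvar LV"
    by (auto simp: E_def A_def B_def special_fibre_mvar)
  have \<phi>: "\<phi> i \<in> param_max_ideal 1" if "i < m" for i using t t0 by (auto simp: \<phi>_def param_max_ideal_def)
  have dd: "dir_deriv 1 ?v (\<phi> i) = c i" for i
    by (simp add: dir_deriv_def \<phi>_def coeff_mvar)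
  let ?H = "E * msubst (case_lvar A B \<phi>) G"
  have "msubst (case_lvar A B \<phi>) G \<in> total_ring 1"
  proof (rule msubst_in_germs[OF Gg(1)])
    fix x assume "x \<in> total_vars m"
    have "\<phi> i \<in> total_ring 1" for i using tt by (auto simp: \<phi>_def)
    then show "case_lvar A B \<phi> x \<in> total_ring 1" using EAB by (cases x) auto
    show "coeff (case_lvar A B \<phi> x) 0 = 0"
      by (cases x) (auto simp: A_def B_def \<phi>_def coeff_mvar)
  qed auto
  then have Htot: "?H \<in> total_ring 1" using EAB by blast
  have pd: "tangent_deriv 1 ?v (mvar x) = 0" if "x \<in> {LU, LV}" for x
    by (rule tangent_deriv_plane) (use that in auto)
  have pdE: "tangent_deriv 1 ?v E = - \<alpha>" "tangent_deriv 1 ?v A = - \<beta>" "tangent_deriv 1 ?v B = - \<gamma>"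
    using abc special_fibre_plane
    by (auto simp: E_def A_def B_def tangent_deriv_diff tangent_deriv_mult tangent_deriv_mvar
        tangent_deriv_plane pd special_fibre_mvar simp del: One_nat_def)
  have "special_fibre (g - ?H) = 0"
    using tangent_deriv_pullback(1)[OF Gg sf, where \<phi> = \<phi> and n' = 1, OF \<phi>] special_fibre_plane[OF g] by simp
  moreover have "tangent_deriv 1 ?v (g - ?H) = 0"
    using tangent_deriv_pullback(2)[OF Gg sf, where \<phi> = \<phi> and n' = 1 and n = 1 and v = ?v, OF \<phi>] eq
    by (simp add: tangent_deriv_diff tangent_deriv_plane[OF g] pdE dd algebra_simps del: One_nat_def)
  moreover have "g - ?H \<in> total_ring 1" using Htot g plane_subset_total by blast
  ultimately have "g - ?H \<in> ideal_gen (total_ring 1) {?t ^ 2}"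
    by (intro divisible_by_square_of_parameter)
  then have "induces 1 {?t ^ 2} m G \<phi> g" unfolding induces_def using EAB sf \<phi> by blast
  moreover have "induces 1 {?t ^ 2} m G (\<lambda>_. 0) g" by (rule induces_trivial[OF def]) simp
  moreover have "\<forall>h\<in>{?t ^ 2}. dir_deriv 1 ?v h = 0" using dir_deriv_square[OF t0] by simp
  ultimately have "\<forall>i<m. dir_deriv 1 ?v (\<phi> i) = dir_deriv 1 ?v 0"
    using miniversal_tangent_unique[OF G tmax gdef, of \<phi> "\<lambda>_. 0" ?v] by blast
  moreover have "dir_deriv 1 ?v 0 = 0" by (simp add: dir_deriv_def)
  ultimately show ?thesis using dd by (simp del: One_nat_def)
qed

text \<open>Spanning and independence make the Kodaira-Spencer classes a basis of a complement of
  the Tjurina ideal.\<close>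

lemma tjurina_eq_miniversal_dim:
  assumes G: "miniversal g m G"
  shows "tjurina g = m"
proof -
  interpret vector_space mscale by (rule vector_space_mscale)
  have Gg: "G \<in> total_ring m" "special_fibre G = g" using G by (auto simp: miniversal_def is_deformation_def)
  then have g: "g \<in> plane_ring" by auto
  let ?D = "ks_class G" let ?B = "?D ` {..<m}"
  have D: "?D i \<in> plane_ring" for i using Gg by auto
  have inj: "inj_on ?D {..<m}"
  proof (rule inj_onI, rule ccontr)
    fix i j assume ij: "i \<in> {..<m}" "j \<in> {..<m}" "?D i = ?D j" "i \<noteq> j"
    \<comment> \<open>Two equal classes would satisfy the relation with coefficients 1 and -1; so
      the set of classes really has \<open>m\<close> elements.\<close>
    define c where "c k = (if k = i then 1 else if k = j then -1 else (0::complex))" for k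
    have "(\<Sum>k<m. mscale (c k) (?D k)) = (\<Sum>k\<in>{i, j}. mscale (c k) (?D k))"
      using ij by (intro sum.mono_neutral_right) (auto simp: c_def)
    also have "\<dots> = 0" using ij by (simp add: c_def)
    finally have "\<forall>k<m. c k = 0" by (intro ks_classes_independent[OF G]) simp
    then show False using ij by (auto simp: c_def)
  qed
  have T: "subspace (tjurina_ideal g)" by (auto simp: subspace_def)
  have Tsub: "tjurina_ideal g \<subseteq> plane_ring" using g by (intro ideal_gen_subset_germs) auto
  have span: "x \<in> span ?B \<longleftrightarrow> (\<exists>c. x = (\<Sum>i<m. mscale (c i) (?D i)))" for x
  proof
    assume "x \<in> span ?B"
    then show "\<exists>c. x = (\<Sum>i<m. mscale (c i) (?D i))"
      by (auto simp: span_finite sum.reindex[OF inj])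
  next
    assume "\<exists>c. x = (\<Sum>i<m. mscale (c i) (?D i))"
    then show "x \<in> span ?B" by (elim exE) (simp only:, intro span_sum span_scale span_base imageI)
  qed
  have "is_complement mscale plane_ring (tjurina_ideal g) ?B"
    unfolding is_complement_def
  proof (intro conjI)
    show "?B \<subseteq> plane_ring" using D by auto
    show "independent ?B"
    proof
      assume "dependent ?B"
      then obtain u where u: "\<exists>v\<in>?B. u v \<noteq> 0" "(\<Sum>v\<in>?B. mscale (u v) v) = 0"
        by (auto simp: dependent_finite)
      then have "(\<Sum>i<m. mscale (u (?D i)) (?D i)) = 0" by (simp add: sum.reindex[OF inj])
      then have "\<forall>i<m. u (?D i) = 0" by (intro ks_classes_independent[OF G]) simp
      with u(1) show False by auto
    qed
    show "span ?B \<inter> tjurina_ideal g = {0}"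
    proof -
      have "x = 0" if xB: "x \<in> span ?B" and xT: "x \<in> tjurina_ideal g" for x
      proof -
        obtain c where c: "x = (\<Sum>i<m. mscale (c i) (?D i))" using span[THEN iffD1, OF xB] by blast
        then have "\<forall>i<m. c i = 0" using xT by (intro ks_classes_independent[OF G]) simp
        then show "x = 0" by (simp add: c)
      qed
      then show ?thesis by (auto intro: span_zero)
    qed
    show "plane_ring = {b + w |b w. b \<in> span ?B \<and> w \<in> tjurina_ideal g}"
    proof (intro equalityI subsetI)
      fix h assume "h \<in> plane_ring"
      then obtain c where "h - (\<Sum>i<m. mscale (c i) (?D i)) \<in> tjurina_ideal g"
        using ks_classes_span[OF G] by blast
      moreover have "(\<Sum>i<m. mscale (c i) (?D i)) \<in> span ?B" using span by blast
      ultimately show "h \<in> {b + w |b w. b \<in> span ?B \<and> w \<in> tjurina_ideal g}"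
        by (intro CollectI exI[of _ "\<Sum>i<m. mscale (c i) (?D i)"] exI[of _ "h - (\<Sum>i<m. mscale (c i) (?D i))"]) auto
    next
      fix h assume "h \<in> {b + w |b w. b \<in> span ?B \<and> w \<in> tjurina_ideal g}"
      then obtain b w where bw: "h = b + w" "b \<in> span ?B" "w \<in> tjurina_ideal g" by blast
      obtain c where "b = (\<Sum>i<m. mscale (c i) (?D i))" using span[THEN iffD1, OF bw(2)] by blast
      then have "b \<in> plane_ring" using D by (auto intro!: germs_sum germs_mscale)
      moreover have "w \<in> plane_ring" using bw(3) Tsub by blast
      ultimately show "h \<in> plane_ring" unfolding bw(1) by (rule germs_add)
    qed
  qed simp
  then show ?thesis
    unfolding tjurina_def using quot_dim_eq_card[OF vector_space_mscale T] inj
    by (simp add: card_image)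
qed

section \<open>Polynomials\<close>

abbreviation pconst :: "complex \<Rightarrow> ('v \<Rightarrow>\<^sub>0 nat) \<Rightarrow>\<^sub>0 complex" where
  "pconst c \<equiv> single 0 c"

abbreviation pvar :: "'v \<Rightarrow> ('v \<Rightarrow>\<^sub>0 nat) \<Rightarrow>\<^sub>0 complex" where
  "pvar x \<equiv> single (single x 1) 1"

lemma poly_mapping_eq_sum_singles:
  "q = (\<Sum>m\<in>keys q. single m (lookup q m))"
  by (rule poly_mapping_eqI) (auto simp: lookup_sum lookup_single when_def in_keys_iff sum.delta')

lemma lookup_single_mult_add:
  fixes q :: "('v \<Rightarrow>\<^sub>0 nat) \<Rightarrow>\<^sub>0 complex"
  shows "lookup (single a c * q) (a + m) = c * lookup q m"
proof -
  have "single a c * q = (\<Sum>k\<in>keys q. single (a + k) (c * lookup q k))"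
    by (subst (1) poly_mapping_eq_sum_singles[of q]) (simp add: sum_distrib_left mult_single)
  then show ?thesis
    by (auto simp: lookup_sum lookup_single when_def in_keys_iff sum.delta')
qed

lemma lookup_pconst_mult [simp]:
  fixes q :: "('v \<Rightarrow>\<^sub>0 nat) \<Rightarrow>\<^sub>0 complex"
  shows "lookup (pconst c * q) m = c * lookup q m"
  using lookup_single_mult_add[of 0 c q m] by simp

lemma single_eq_monomial_value:
  "single m c = pconst c * monomial_value pvar m"
proof -
  have "single m 1 = monomial_value pvar m"
  proof (induction m rule: monomial_induct)
    case (add m x)
    have "single (m + single x 1) (1::complex) = single m 1 * pvar x"
      by (simp add: mult_single)
    then show ?case using add by (simp add: monomial_value_add)
  qed simp
  moreover have "single m c = pconst c * single m 1"
    by (simp add: mult_single)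
  ultimately show ?thesis by simp
qed

lemma polynomial_induct [case_names const var add mult]:
  fixes q :: "('v \<Rightarrow>\<^sub>0 nat) \<Rightarrow>\<^sub>0 complex"
  assumes c: "\<And>c. P (pconst c)" and v: "\<And>x. P (pvar x)"
    and a: "\<And>p q. P p \<Longrightarrow> P q \<Longrightarrow> P (p + q)" and t: "\<And>p q. P p \<Longrightarrow> P q \<Longrightarrow> P (p * q)"
  shows "P q"
proof -
  have "P (monomial_value pvar m)" for m
  proof (induction m rule: monomial_induct)
    case zero
    then show ?case using c[of 1] by simp
  next
    case (add m x)
    then show ?case using t[OF add v[of x]] by (simp add: monomial_value_add)
  qed
  then have s: "P (single m c)" for m c
    by (subst single_eq_monomial_value) (intro t c)
  have z: "P 0" using c[of 0] by simp
  have "P (\<Sum>m\<in>A. single m (lookup q m))" if "finite A" for A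
    using that
  proof (induction A rule: finite_induct)
    case (insert m A)
    show ?case unfolding sum.insert[OF insert(1,2)] by (rule a[OF s insert(3)])
  qed (simp add: z)
  from this[OF finite_keys, of q] show ?thesis
    unfolding poly_mapping_eq_sum_singles[of q, symmetric] .
qed

text \<open>The image of the constants is a parameter: the same evaluation yields values at points,
  local equations as power series, and substitutions of polynomials.\<close>

definition poly_eval :: "(complex \<Rightarrow> 'a::comm_ring_1) \<Rightarrow> ('v \<Rightarrow> 'a) \<Rightarrow> (('v \<Rightarrow>\<^sub>0 nat) \<Rightarrow>\<^sub>0 complex) \<Rightarrow> 'a" where
  "poly_eval \<kappa> \<sigma> q = (\<Sum>m\<in>keys q. \<kappa> (lookup q m) * monomial_value \<sigma> m)"

locale scalar_hom =
  fixes \<kappa> :: "complex \<Rightarrow> 'a::comm_ring_1"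
  assumes hom_add: "\<kappa> (a + b) = \<kappa> a + \<kappa> b" and hom_mult: "\<kappa> (a * b) = \<kappa> a * \<kappa> b"
    and hom_1: "\<kappa> 1 = 1"
begin

lemma hom_0: "\<kappa> 0 = 0"
  using hom_add[of 0 0] by simp

lemma poly_eval_superset:
  assumes "finite A" "keys q \<subseteq> A"
  shows "poly_eval \<kappa> \<sigma> q = (\<Sum>m\<in>A. \<kappa> (lookup q m) * monomial_value \<sigma> m)"
  unfolding poly_eval_def using assms
  by (intro sum.mono_neutral_left) (auto simp: in_keys_iff hom_0)

lemma poly_eval_add: "poly_eval \<kappa> \<sigma> (p + q) = poly_eval \<kappa> \<sigma> p + poly_eval \<kappa> \<sigma> q"
proof -
  let ?K = "keys p \<union> keys q"
  have "keys (p + q) \<subseteq> ?K" by (rule Poly_Mapping.keys_add)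
  then have "poly_eval \<kappa> \<sigma> (p + q) = (\<Sum>m\<in>?K. \<kappa> (lookup (p + q) m) * monomial_value \<sigma> m)"
    by (intro poly_eval_superset) auto
  moreover have "poly_eval \<kappa> \<sigma> p = (\<Sum>m\<in>?K. \<kappa> (lookup p m) * monomial_value \<sigma> m)"
    by (intro poly_eval_superset) auto
  moreover have "poly_eval \<kappa> \<sigma> q = (\<Sum>m\<in>?K. \<kappa> (lookup q m) * monomial_value \<sigma> m)"
    by (intro poly_eval_superset) auto
  ultimately show ?thesis by (simp add: lookup_add hom_add algebra_simps sum.distrib)
qed

lemma poly_eval_0 [simp]: "poly_eval \<kappa> \<sigma> 0 = 0" by (simp add: poly_eval_def)

lemma poly_eval_sum: "poly_eval \<kappa> \<sigma> (sum F A) = (\<Sum>i\<in>A. poly_eval \<kappa> \<sigma> (F i))"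
  by (induction A rule: infinite_finite_induct) (auto simp: poly_eval_add)

lemma poly_eval_single: "poly_eval \<kappa> \<sigma> (single m c) = \<kappa> c * monomial_value \<sigma> m"
  by (simp add: poly_eval_def hom_0)

lemma poly_eval_pconst [simp]: "poly_eval \<kappa> \<sigma> (pconst c) = \<kappa> c"
  by (simp add: poly_eval_single)

lemma poly_eval_1 [simp]: "poly_eval \<kappa> \<sigma> 1 = 1"
  using poly_eval_pconst[of \<sigma> 1] by (simp add: hom_1)

lemma poly_eval_pvar [simp]: "poly_eval \<kappa> \<sigma> (pvar x) = \<sigma> x"
  by (simp add: poly_eval_single hom_1)

lemma poly_eval_mult: "poly_eval \<kappa> \<sigma> (p * q) = poly_eval \<kappa> \<sigma> p * poly_eval \<kappa> \<sigma> q"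
proof -
  have "p * q = (\<Sum>m\<in>keys p. \<Sum>k\<in>keys q.
      single (m + k) (lookup p m * lookup q k))"
    by (subst poly_mapping_eq_sum_singles[of p], subst poly_mapping_eq_sum_singles[of q])
      (simp add: sum_product mult_single)
  then have "poly_eval \<kappa> \<sigma> (p * q) = (\<Sum>m\<in>keys p. \<Sum>k\<in>keys q.
      (\<kappa> (lookup p m) * monomial_value \<sigma> m) * (\<kappa> (lookup q k) * monomial_value \<sigma> k))"
    by (simp add: poly_eval_sum poly_eval_single hom_mult monomial_value_add ac_simps)
  then show ?thesis by (simp add: poly_eval_def sum_product)
qed

lemma poly_eval_uminus: "poly_eval \<kappa> \<sigma> (- q) = - poly_eval \<kappa> \<sigma> q"
  using poly_eval_add[of \<sigma> q "- q"] by (simp add: eq_neg_iff_add_eq_0 add.commute)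

lemma poly_eval_diff: "poly_eval \<kappa> \<sigma> (p - q) = poly_eval \<kappa> \<sigma> p - poly_eval \<kappa> \<sigma> q"
  using poly_eval_add[of \<sigma> p "- q"] by (simp add: poly_eval_uminus)

lemma poly_eval_power: "poly_eval \<kappa> \<sigma> (q ^ n) = poly_eval \<kappa> \<sigma> q ^ n"
  by (induction n) (auto simp: poly_eval_mult)

lemma poly_eval_prod: "poly_eval \<kappa> \<sigma> (prod F A) = (\<Prod>i\<in>A. poly_eval \<kappa> \<sigma> (F i))"
  by (induction A rule: infinite_finite_induct) (auto simp: poly_eval_mult)

lemma poly_eval_monomial_value:
  "poly_eval \<kappa> \<sigma> (monomial_value \<tau> a) = monomial_value (\<lambda>x. poly_eval \<kappa> \<sigma> (\<tau> x)) a"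
  by (simp add: monomial_value_def poly_eval_prod poly_eval_power)

lemmas poly_eval_simps = poly_eval_add poly_eval_mult poly_eval_sum poly_eval_diff
  poly_eval_uminus poly_eval_power

end

interpretation id_hom: scalar_hom "\<lambda>c. c" by unfold_locales auto
interpretation mconst_hom: scalar_hom mconst
  by unfold_locales (auto simp: mconst_add mconst_mult)
interpretation pconst_hom: scalar_hom "pconst :: complex \<Rightarrow> ('v \<Rightarrow>\<^sub>0 nat) \<Rightarrow>\<^sub>0 complex"
  by unfold_locales (auto simp: single_add mult_single)

section \<open>Values at points, local equations and charts of the projective plane\<close>

lemma UNIV_hvar: "UNIV = {X, Y, Z}"
  by (auto intro: hvar.exhaust)

lemma keys_hvar: "keys (m :: hvar \<Rightarrow>\<^sub>0 nat) \<subseteq> {X, Y, Z}"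
  by (simp add: UNIV_hvar[symmetric])

lemma monomial_value_hvar:
  "monomial_value \<sigma> m = (\<Prod>x\<in>{X, Y, Z}. \<sigma> x ^ lookup m x)"
  by (rule monomial_value_superset[OF _ keys_hvar]) simp

lemma peval_eq: "peval p = poly_eval (\<lambda>c. c) p"
  by (rule ext) (simp add: peval_def poly_eval_def monomial_value_hvar)

lemma local_eq_eq: "local_eq p = poly_eval mconst (\<lambda>x. mconst (p x) + local_coord p x)"
  by (rule ext) (simp add: local_eq_def poly_eval_def monomial_value_hvar)

lemmas peval_simps = id_hom.poly_eval_simps[where \<sigma> = p and 'b = hvar for p, folded peval_eq]
lemmas local_eq_simps = mconst_hom.poly_eval_simps[where
  \<sigma> = "\<lambda>x. mconst (p x) + local_coord p x" for p, folded local_eq_eq]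

lemma peval_pconst [simp]: "peval p (pconst c) = c" by (simp add: peval_eq)
lemma peval_pvar [simp]: "peval p (pvar x) = p x" unfolding peval_eq by (rule id_hom.poly_eval_pvar)
lemma peval_0 [simp]: "peval p 0 = 0" by (simp add: peval_eq)
lemma peval_1 [simp]: "peval p 1 = 1" by (simp add: peval_eq)
lemma local_eq_pconst [simp]: "local_eq p (pconst c) = mconst c" by (simp add: local_eq_eq)
lemma local_eq_pvar [simp]: "local_eq p (pvar x) = mconst (p x) + local_coord p x"
  unfolding local_eq_eq by (rule mconst_hom.poly_eval_pvar)
lemma local_eq_0 [simp]: "local_eq p 0 = 0" by (simp add: local_eq_eq)
lemma local_eq_1 [simp]: "local_eq p 1 = 1" by (simp add: local_eq_eq)

lemma local_eq_pscale [simp]: "local_eq p (pscale c q) = mscale c (local_eq p q)"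
  by (simp add: pscale_def mscale_def local_eq_simps)

lemma local_coord_in_plane [simp, intro]: "local_coord p x \<in> plane_ring"
  by (cases x) (auto simp: local_coord_def)

lemma local_eq_in_plane [simp, intro]: "local_eq p q \<in> plane_ring"
  by (induction q rule: polynomial_induct) (auto simp: local_eq_simps simp del: One_nat_def)

lemma coeff_local_eq_0: "coeff (local_eq p q) 0 = peval p q"
proof (induction q rule: polynomial_induct)
  case (var x)
  have "coeff (local_coord p x) 0 = 0" by (cases x) (auto simp: local_coord_def coeff_mvar)
  then show ?case unfolding local_eq_pvar peval_pvar by (simp add: coeff_mconst)
qed (auto simp: coeff_mconst local_eq_simps peval_simps)

lemma vector_space_pscale: "vector_space pscale"
  by unfold_locales (auto simp: pscale_def algebra_simps single_add mult_single mult.assoc[symmetric])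

text \<open>The three normalisations of a point differ only by the names of the coordinates; naming
  them uniformly avoids repeating every local argument three times.\<close>

lemma proj_plane_chart:
  assumes "p \<in> proj_plane"
  obtains w u v where "{w, u, v} = UNIV" "w \<noteq> u" "w \<noteq> v" "u \<noteq> v" "p w = 1"
    "local_coord p w = 0" "local_coord p u = mvar LU" "local_coord p v = mvar LV"
proof -
  consider "p X = 1" | "p X = 0" "p Y = 1" | "p X = 0" "p Y = 0" "p Z = 1"
    using assms by (auto simp: proj_plane_def)
  then show thesis
  proof cases
    case 1
    then show ?thesis by (intro that[of X Y Z]) (auto simp: UNIV_hvar local_coord_def)
  next
    case 2
    then show ?thesis by (intro that[of Y X Z]) (auto simp: UNIV_hvar local_coord_def)
  next
    case 3
    then show ?thesis by (intro that[of Z X Y]) (auto simp: UNIV_hvar local_coord_def)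
  qed
qed

lemma proj_plane_normalize:
  assumes "P x \<noteq> 0"
  obtains p c where "p \<in> proj_plane" "c \<noteq> 0" "\<And>y. P y = c * p y"
proof -
  define w where "w = (if P X \<noteq> 0 then X else if P Y \<noteq> 0 then Y else Z)"
  have w: "P w \<noteq> 0" using assms by (cases x) (auto simp: w_def)
  then have "(\<lambda>y. P y / P w) \<in> proj_plane" by (auto simp: proj_plane_def w_def split: if_splits)
  then show thesis using w by (intro that[of "\<lambda>y. P y / P w" "P w"]) auto
qed

section \<open>Forms\<close>

lemma forms_0 [simp, intro]: "0 \<in> forms n" by (simp add: forms_def)

lemma forms_add [intro]: "p \<in> forms n \<Longrightarrow> q \<in> forms n \<Longrightarrow> p + q \<in> forms n"
  using Poly_Mapping.keys_add[of p q] by (auto simp: forms_def)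

lemma forms_sum [intro]: "(\<And>i. i \<in> A \<Longrightarrow> F i \<in> forms n) \<Longrightarrow> sum F A \<in> forms n"
  by (induction A rule: infinite_finite_induct) auto

lemma forms_single: "mdeg m = n \<Longrightarrow> single m c \<in> forms n"
  by (simp add: forms_def)

lemma forms_pconst [simp, intro]: "pconst c \<in> forms 0" by (rule forms_single) simp
lemma forms_1 [simp, intro]: "1 \<in> forms 0" using forms_pconst[of 1] by simp
lemma forms_pvar [simp, intro]: "pvar x \<in> forms 1" by (rule forms_single) simp

lemma forms_mult [intro]:
  assumes "p \<in> forms n" "q \<in> forms k"
  shows "p * q \<in> forms (n + k)"
  using assms keys_mult[of p q] by (fastforce simp: forms_def)

lemma forms_power: "p \<in> forms n \<Longrightarrow> p ^ k \<in> forms (k * n)"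
  by (induction k) (auto intro: forms_mult)

lemma forms_pscale [intro]: "p \<in> forms n \<Longrightarrow> pscale c p \<in> forms n"
  using forms_mult[OF forms_pconst, of p n c] by (simp add: pscale_def)

lemma forms_uminus [intro]: "p \<in> forms n \<Longrightarrow> - p \<in> forms n"
  by (simp add: forms_def in_keys_iff)

lemma forms_diff [intro]: "p \<in> forms n \<Longrightarrow> q \<in> forms n \<Longrightarrow> p - q \<in> forms n"
  using forms_add[of p n "- q"] by auto

lemma peval_scale:
  assumes "q \<in> forms n" "\<And>y. P y = c * p y"
  shows "peval P q = c ^ n * peval p q"
proof -
  have "monomial_value P m = c ^ mdeg m * monomial_value p m" for m
    by (induction m rule: monomial_induct) (auto simp: monomial_value_add assms(2))
  then show ?thesis using assms(1)
    by (simp add: peval_eq poly_eval_def forms_def sum_distrib_left ac_simps)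
qed

definition hcomp :: "nat \<Rightarrow> hpoly \<Rightarrow> hpoly" where
  "hcomp n q = (\<Sum>m\<in>{m \<in> keys q. mdeg m = n}. single m (lookup q m))"

lemma lookup_hcomp: "lookup (hcomp n q) m = (if mdeg m = n then lookup q m else 0)"
  by (auto simp: hcomp_def lookup_sum lookup_single when_def in_keys_iff sum.delta')

lemma hcomp_add: "hcomp n (p + q) = hcomp n p + hcomp n q"
  by (rule poly_mapping_eqI) (simp add: lookup_hcomp lookup_add)

lemma hcomp_0 [simp]: "hcomp n 0 = 0" by (rule poly_mapping_eqI) (simp add: lookup_hcomp)

lemma hcomp_sum: "hcomp n (sum F A) = (\<Sum>i\<in>A. hcomp n (F i))"
  by (induction A rule: infinite_finite_induct) (auto simp: hcomp_add)

lemma hcomp_in_forms [simp, intro]: "hcomp n q \<in> forms n"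
  by (auto simp: forms_def in_keys_iff lookup_hcomp split: if_splits)

lemma hcomp_forms: "q \<in> forms k \<Longrightarrow> hcomp n q = (if n = k then q else 0)"
  by (rule poly_mapping_eqI) (auto simp: lookup_hcomp forms_def in_keys_iff)

definition pdeg_le :: "nat \<Rightarrow> hpoly \<Rightarrow> bool" where
  "pdeg_le N q \<longleftrightarrow> (\<forall>m\<in>keys q. mdeg m \<le> N)"

lemma pdeg_le_exists: "\<exists>N. pdeg_le N q"
  unfolding pdeg_le_def
  by (rule exI[of _ "Max (mdeg ` keys q)"]) auto

lemma sum_hcomp:
  assumes "pdeg_le N q"
  shows "(\<Sum>n\<le>N. hcomp n q) = q"
proof (rule poly_mapping_eqI)
  fix m
  have "lookup (\<Sum>n\<le>N. hcomp n q) m = (\<Sum>n\<le>N. if n = mdeg m then lookup q m else 0)"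
    unfolding lookup_sum by (rule sum.cong) (auto simp: lookup_hcomp)
  also have "\<dots> = lookup q m"
    using assms by (auto simp: pdeg_le_def in_keys_iff)
  finally show "lookup (\<Sum>n\<le>N. hcomp n q) m = lookup q m" .
qed

lemma hcomp_mult_form:
  assumes g: "g \<in> forms e"
  shows "hcomp n (a * g) = (if e \<le> n then hcomp (n - e) a * g else 0)"
proof -
  obtain N where "pdeg_le N a" using pdeg_le_exists by blast
  then have N: "pdeg_le (max N n) a" by (auto simp: pdeg_le_def)
  have "hcomp n (a * g) = (\<Sum>k\<le>max N n. hcomp n (hcomp k a * g))"
    by (subst sum_hcomp[OF N, symmetric]) (simp only: sum_distrib_right hcomp_sum)
  also have "\<dots> = (\<Sum>k\<le>max N n. if e \<le> n \<and> k = n - e then hcomp (n - e) a * g else 0)"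
    by (rule sum.cong) (use g in \<open>auto simp: hcomp_forms[OF forms_mult[OF hcomp_in_forms]]\<close>)
  also have "\<dots> = (if e \<le> n then hcomp (n - e) a * g else 0)"
    by (cases "e \<le> n") (auto simp: sum.delta)
  finally show ?thesis .
qed

text \<open>Dehomogenisation is injective on forms: in the product the lowest component of
  \<open>a\<close> survives with a sign and the highest one multiplied by \<open>w\<close>, and
  these have different degrees.\<close>

lemma form_not_multiple_of_affine:
  assumes r: "r \<in> forms n" and eq: "r = (pvar w - 1) * a"
  shows "r = 0"
proof (rule ccontr)
  assume "r \<noteq> 0"
  then have "a \<noteq> 0" using eq by auto
  then have "keys a \<noteq> {}" by (auto simp: poly_mapping_eq_iff in_keys_iff fun_eq_iff)
  then have ne: "mdeg ` keys a \<noteq> {}" and fin: "finite (mdeg ` keys a)" by auto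
  obtain m where m: "m \<in> keys a" "mdeg m = Min (mdeg ` keys a)"
    using Min_in[OF fin ne] by auto
  obtain k where k: "k \<in> keys a" "mdeg k = Max (mdeg ` keys a)"
    using Max_in[OF fin ne] by auto
  have min: "mdeg m \<le> mdeg l" and max: "mdeg l \<le> mdeg k" if "l \<in> keys a" for l
    using that fin m k by auto
  let ?e = "single w (1::nat)"
  have r': "r = pvar w * a - a" using eq by (simp add: algebra_simps)
  have "lookup (pvar w * a) m = 0"
  proof (rule ccontr)
    assume "lookup (pvar w * a) m \<noteq> 0"
    then have "m \<in> keys (pvar w * a)" by (simp add: in_keys_iff)
    then obtain l where "m = ?e + l" "l \<in> keys a" using keys_mult[of "pvar w" a] by auto
    then show False using min[of l] by simp
  qed
  then have "m \<in> keys r" using m(1) by (simp add: r' in_keys_iff lookup_minus)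
  then have mn: "mdeg m = n" using r by (auto simp: forms_def)
  have "?e + k \<notin> keys a" using max[of "?e + k"] by auto
  then have "?e + k \<in> keys r"
    using k(1) lookup_single_mult_add[of ?e 1 a k] by (simp add: r' in_keys_iff lookup_minus)
  then have "mdeg (?e + k) = n" using r by (auto simp: forms_def)
  then have "Suc (mdeg k) = n" by simp
  then show False using mn min[OF k(1)] by simp
qed

definition homogenize :: "hvar \<Rightarrow> nat \<Rightarrow> hpoly \<Rightarrow> hpoly" where
  "homogenize w n q = (\<Sum>i\<le>n. pvar w ^ (n - i) * hcomp i q)"

lemma homogenize_in_forms [simp, intro]: "homogenize w n q \<in> forms n"
  unfolding homogenize_def
proof (rule forms_sum)
  fix i assume "i \<in> {..n}"
  then have "(n - i) * 1 + i = n" by simp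
  then show "pvar w ^ (n - i) * hcomp i q \<in> forms n"
    using forms_mult[OF forms_power[OF forms_pvar] hcomp_in_forms, of w "n - i" i q] by simp
qed

text \<open>Each component is padded by a power of \<open>w\<close>, and \<open>w ^ k - 1\<close> is
  divisible by \<open>w - 1\<close>.\<close>

lemma homogenize_congruent:
  assumes "pdeg_le n q"
  shows "\<exists>a. homogenize w n q - q = (pvar w - 1) * a"
proof -
  have "\<exists>b. (pvar w ^ k - 1 :: hpoly) = (pvar w - 1) * b" for k
    by (metis power_diff_1_eq)
  then obtain b where b: "\<And>k. (pvar w ^ k - 1 :: hpoly) = (pvar w - 1) * b k" by metis
  have "homogenize w n q - q = homogenize w n q - (\<Sum>i\<le>n. hcomp i q)" by (simp add: sum_hcomp[OF assms])
  also have "\<dots> = (\<Sum>i\<le>n. (pvar w ^ (n - i) - 1) * hcomp i q)"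
    unfolding homogenize_def by (simp add: sum_subtractf algebra_simps)
  also have "\<dots> = (pvar w - 1) * (\<Sum>i\<le>n. b (n - i) * hcomp i q)"
    by (simp only: b sum_distrib_left mult.assoc)
  finally show ?thesis by blast
qed

section \<open>Partial derivatives and the Jacobian ideal\<close>

lemma pdv_superset:
  assumes "finite A" "keys q \<subseteq> A"
  shows "pdv x q = (\<Sum>m\<in>A. single (m - single x 1)
        (of_nat (lookup m x) * lookup q m))"
  unfolding pdv_def using assms by (intro sum.mono_neutral_left) (auto simp: in_keys_iff)

lemma pdv_add: "pdv x (p + q) = pdv x p + pdv x q"
proof -
  let ?K = "keys p \<union> keys q"
  have "keys (p + q) \<subseteq> ?K" by (rule Poly_Mapping.keys_add)
  then show ?thesis
    using pdv_superset[of ?K "p + q" x] pdv_superset[of ?K p x] pdv_superset[of ?K q x]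
    by (simp add: lookup_add algebra_simps single_add sum.distrib)
qed

lemma pdv_0 [simp]: "pdv x 0 = 0" by (simp add: pdv_def)

lemma pdv_sum: "pdv x (sum F A) = (\<Sum>i\<in>A. pdv x (F i))"
  by (induction A rule: infinite_finite_induct) (auto simp: pdv_add)

lemma pdv_single: "pdv x (single m c) =
    single (m - single x 1) (of_nat (lookup m x) * c)"
  by (simp add: pdv_def)

lemma mdeg_minus_single:
  assumes "x \<in> keys m"
  shows "mdeg (m - single x 1) = mdeg m - 1"
  using arg_cong[OF monomial_split[OF assms], of mdeg] by simp

lemma pdv_in_forms:
  assumes "f \<in> forms d"
  shows "pdv x f \<in> forms (d - 1)"
  unfolding pdv_def
proof (rule forms_sum)
  fix m assume m: "m \<in> keys f"
  show "single (m - single x 1)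
        (of_nat (lookup m x) * lookup f m) \<in> forms (d - 1)"
  proof (cases "x \<in> keys m")
    case True
    then show ?thesis using assms m mdeg_minus_single[OF True] by (intro forms_single) (simp add: forms_def)
  qed (simp add: in_keys_iff)
qed

lemma pvar_mult_pdv_single:
  "pvar x * pdv x (single m c) = single m (of_nat (lookup m x) * c)"
proof (cases "x \<in> keys m")
  case True
  then show ?thesis
    using monomial_split[OF True] by (simp add: pdv_single mult_single add.commute)
qed (simp add: pdv_single in_keys_iff)

lemma euler_identity:
  assumes "f \<in> forms d"
  shows "pvar X * pdv X f + pvar Y * pdv Y f + pvar Z * pdv Z f = pconst (of_nat d) * f"
proof -
  let ?s = "\<lambda>m. single m (lookup f m)"
  have x: "pvar x * pdv x f = (\<Sum>m\<in>keys f. pvar x * pdv x (?s m))" for x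
    by (subst (1) poly_mapping_eq_sum_singles[of f]) (simp only: pdv_sum sum_distrib_left)
  have "pvar X * pdv X f + pvar Y * pdv Y f + pvar Z * pdv Z f = (\<Sum>m\<in>keys f.
      pvar X * pdv X (?s m) + pvar Y * pdv Y (?s m) + pvar Z * pdv Z (?s m))"
    by (simp only: x sum.distrib)
  also have "\<dots> = (\<Sum>m\<in>keys f. pconst (of_nat d) * ?s m)"
  proof (rule sum.cong)
    fix m assume "m \<in> keys f"
    then have "mdeg m = d" using assms by (simp add: forms_def)
    then have d: "lookup m X + lookup m Y + lookup m Z = d"
      using mdeg_eq_sum[OF _ keys_hvar, of m] by simp
    show "pvar X * pdv X (?s m) + pvar Y * pdv Y (?s m) + pvar Z * pdv Z (?s m) = pconst (of_nat d) * ?s m"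
      unfolding pvar_mult_pdv_single single_add[symmetric] mult_single d[symmetric]
      by (simp add: algebra_simps)
  qed simp
  also have "\<dots> = pconst (of_nat d) * f"
    by (simp only: sum_distrib_left[symmetric] poly_mapping_eq_sum_singles[of f, symmetric])
  finally show ?thesis .
qed

lemma mconst_of_nat: "mconst (of_nat n) = of_nat n"
  by (induction n) (auto simp: mconst_add)

text \<open>The local equation is a substitution in which only the variable \<open>u\<close>
  involves the local coordinate \<open>a\<close>; by linearity it is enough to differentiate
  monomials.\<close>

lemma mderiv_local_eq:
  assumes ne: "w \<noteq> u" "w \<noteq> v" "u \<noteq> v" and all: "{w, u, v} = UNIV"
    and y: "local_coord p w = 0" "local_coord p u = mvar a" "local_coord p v = mvar b" "a \<noteq> b"
  shows "mderiv a (local_eq p q) = local_eq p (pdv u q)"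
proof -
  define \<sigma> where "\<sigma> x = mconst (p x) + local_coord p x" for x
  have local: "local_eq p = poly_eval mconst \<sigma>" by (simp add: local_eq_eq \<sigma>_def[abs_def])
  have "x = w \<or> x = u \<or> x = v" for x using all by blast
  then have dx: "mderiv a (\<sigma> x) = (if x = u then 1 else 0)" for x
    using ne y unfolding \<sigma>_def by (cases "x = w"; cases "x = v") (auto simp: mderiv_add mderiv_mvar)
  have mono: "mderiv a (monomial_value \<sigma> m)
      = of_nat (lookup m u) * monomial_value \<sigma> (m - single u 1)" for m
  proof (induction m rule: monomial_induct)
    case (add m x)
    show ?case
    proof (cases "x = u")
      case True
      \<comment> \<open>If \<open>u\<close> does not occur in \<open>m\<close>, the truncated
        difference of exponents is no quotient, but then its coefficient is 0.\<close>
      have "of_nat (lookup m u) * monomial_value \<sigma> (m - single u 1) * \<sigma> u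
          = of_nat (lookup m u) * monomial_value \<sigma> m"
      proof (cases "u \<in> keys m")
        case k: True
        have "monomial_value \<sigma> m = monomial_value \<sigma> (m - single u 1) * \<sigma> u"
          by (subst monomial_split[OF k]) (simp add: monomial_value_add)
        then show ?thesis by (simp add: ac_simps)
      qed (simp add: in_keys_iff)
      then show ?thesis
        using True add by (simp add: monomial_value_add mderiv_mult dx lookup_add algebra_simps)
    next
      case False
      have "of_nat (lookup m u) * (monomial_value \<sigma> (m - single u 1) * \<sigma> x)
          = of_nat (lookup m u) * monomial_value \<sigma> (m + single x 1 - single u 1)"
      proof (cases "u \<in> keys m")
        case k: True
        have "m + single x 1 - single u 1
            = (m - single u 1) + single x 1"
          by (subst monomial_split[OF k]) (metis (no_types, lifting) add.assoc add.commute add_diff_cancel_right')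
        then show ?thesis by (simp add: monomial_value_add)
      qed (simp add: in_keys_iff)
      then show ?thesis
        using False add by (simp add: monomial_value_add mderiv_mult dx lookup_add lookup_single_not_eq ac_simps)
    qed
  qed simp
  have single: "mderiv a (local_eq p (single m c)) = local_eq p (pdv u (single m c))" for m c
    by (simp add: local mconst_hom.poly_eval_single pdv_single mderiv_mult mono[unfolded One_nat_def] mconst_mult
        mconst_of_nat ac_simps)
  have "mderiv a (local_eq p q) = (\<Sum>m\<in>keys q.
      mderiv a (local_eq p (single m (lookup q m))))"
    by (subst (1) poly_mapping_eq_sum_singles[of q]) (simp only: local_eq_simps mderiv_sum)
  also have "\<dots> = local_eq p (pdv u q)"
    by (subst (2) poly_mapping_eq_sum_singles[of q]) (simp only: single local_eq_simps pdv_sum)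
  finally show ?thesis .
qed

lemma jacobian_ideal_0 [simp, intro]: "0 \<in> jacobian_ideal f"
  unfolding jacobian_ideal_def by (auto intro!: exI[of _ 0])

lemma jacobian_ideal_add [intro]:
  assumes "p \<in> jacobian_ideal f" "q \<in> jacobian_ideal f"
  shows "p + q \<in> jacobian_ideal f"
proof -
  obtain a b c a' b' c' where "p = a * pdv X f + b * pdv Y f + c * pdv Z f"
    "q = a' * pdv X f + b' * pdv Y f + c' * pdv Z f"
    using assms by (auto simp: jacobian_ideal_def)
  then have "p + q = (a + a') * pdv X f + (b + b') * pdv Y f + (c + c') * pdv Z f"
    by (simp add: algebra_simps)
  then show ?thesis unfolding jacobian_ideal_def by blast
qed

lemma jacobian_ideal_mult [intro]:
  assumes "q \<in> jacobian_ideal f"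
  shows "a * q \<in> jacobian_ideal f"
proof -
  obtain b c e where "q = b * pdv X f + c * pdv Y f + e * pdv Z f"
    using assms by (auto simp: jacobian_ideal_def)
  then have "a * q = (a * b) * pdv X f + (a * c) * pdv Y f + (a * e) * pdv Z f"
    by (simp add: algebra_simps)
  then show ?thesis unfolding jacobian_ideal_def by blast
qed

lemma jacobian_ideal_sum [intro]:
  "(\<And>i. i \<in> A \<Longrightarrow> F i \<in> jacobian_ideal f) \<Longrightarrow> sum F A \<in> jacobian_ideal f"
  by (induction A rule: infinite_finite_induct) auto

lemma jacobian_ideal_pscale [intro]: "q \<in> jacobian_ideal f \<Longrightarrow> pscale c q \<in> jacobian_ideal f"
  unfolding pscale_def by auto

lemma pdv_in_jacobian_ideal [simp, intro]: "pdv x f \<in> jacobian_ideal f"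
proof -
  have "pdv X f = 1 * pdv X f + 0 * pdv Y f + 0 * pdv Z f"
    "pdv Y f = 0 * pdv X f + 1 * pdv Y f + 0 * pdv Z f"
    "pdv Z f = 0 * pdv X f + 0 * pdv Y f + 1 * pdv Z f" by simp_all
  then show ?thesis unfolding jacobian_ideal_def by (cases x) blast+
qed

text \<open>Euler's identity, divided by the nonzero degree.\<close>

lemma form_in_jacobian_ideal:
  assumes "f \<in> forms d" "d > 0"
  shows "f \<in> jacobian_ideal f"
proof -
  have "pconst (of_nat d) * f \<in> jacobian_ideal f"
    unfolding euler_identity[OF assms(1), symmetric] by auto
  then have "pconst (1 / of_nat d) * (pconst (of_nat d) * f) \<in> jacobian_ideal f" by auto
  moreover have "pconst (1 / of_nat d) * (pconst (of_nat d) * f) = f"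
    using assms(2) by (simp only: mult.assoc[symmetric] mult_single) simp
  ultimately show ?thesis by simp
qed

text \<open>The partial derivatives are forms of degree d - 1, so the coefficients can be replaced
  by their components of complementary degree. That exact degree enters the final count.\<close>

lemma jacobian_ideal_form_coefficients:
  assumes f: "f \<in> forms d" and h: "h \<in> jacobian_ideal f" and n: "d - 1 \<le> n"
  obtains a b c where "a \<in> forms (n - (d - 1))" "b \<in> forms (n - (d - 1))" "c \<in> forms (n - (d - 1))"
    "hcomp n h = a * pdv X f + b * pdv Y f + c * pdv Z f"
proof -
  obtain a b c where "h = a * pdv X f + b * pdv Y f + c * pdv Z f"
    using h by (auto simp: jacobian_ideal_def)
  then show thesis
    using n by (intro that[of "hcomp (n - (d - 1)) a" "hcomp (n - (d - 1)) b" "hcomp (n - (d - 1)) c"])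
      (simp_all add: hcomp_add hcomp_mult_form[OF pdv_in_forms[OF f]])
qed

lemma hcomp_in_jacobian_ideal:
  assumes f: "f \<in> forms d" and h: "h \<in> jacobian_ideal f"
  shows "hcomp n h \<in> jacobian_ideal f"
proof (cases "d - 1 \<le> n")
  case True
  then show ?thesis using jacobian_ideal_form_coefficients[OF f h True] unfolding jacobian_ideal_def by blast
next
  case False
  obtain a b c where "h = a * pdv X f + b * pdv Y f + c * pdv Z f"
    using h by (auto simp: jacobian_ideal_def)
  then show ?thesis using False by (simp add: hcomp_add hcomp_mult_form[OF pdv_in_forms[OF f]])
qed

lemma homogenize_in_jacobian_ideal:
  assumes "f \<in> forms d" "h \<in> jacobian_ideal f"
  shows "homogenize w n h \<in> jacobian_ideal f"
  unfolding homogenize_def using hcomp_in_jacobian_ideal[OF assms] by auto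

text \<open>A multiplier that works after setting w = 1 is homogenised. Its product with
  \<open>h\<close> and the homogenised \<open>j\<close> are forms of the same degree that agree
  modulo \<open>w - 1\<close>, hence are equal.\<close>

lemma homogeneous_multiplier:
  assumes f: "f \<in> forms d" and h: "h \<in> forms k"
    and e: "e * h = j + (pvar w - 1) * a" "j \<in> jacobian_ideal f"
  shows "\<exists>n e' b. e' \<in> forms n \<and> e' - e = (pvar w - 1) * b \<and> e' * h \<in> jacobian_ideal f"
proof -
  obtain N M where "pdeg_le N e" "pdeg_le M j" using pdeg_le_exists by metis
  then have ne: "pdeg_le (max N M) e" and nj: "pdeg_le (max N M + k) j"
    by (auto simp: pdeg_le_def intro: le_trans)
  \<comment> \<open>One degree large enough for \<open>e\<close> and, after adding \<open>k\<close>,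
    for \<open>j\<close>.\<close>
  define n where "n = max N M"
  obtain b where b: "homogenize w n e - e = (pvar w - 1) * b"
    using homogenize_congruent[OF ne] n_def by metis
  obtain c where c: "homogenize w (n + k) j - j = (pvar w - 1) * c"
    using homogenize_congruent[OF nj] n_def by metis
  have "homogenize w n e * h - homogenize w (n + k) j
      = (homogenize w n e - e) * h + (e * h - j) - (homogenize w (n + k) j - j)"
    by (simp add: algebra_simps)
  also have "\<dots> = (pvar w - 1) * (b * h + a - c)"
    by (simp only: b c e(1)) (simp add: algebra_simps)
  finally have "homogenize w n e * h - homogenize w (n + k) j = 0"
    by (rule form_not_multiple_of_affine[of _ "n + k", rotated])
      (intro forms_diff forms_mult homogenize_in_forms h)
  then have "homogenize w n e * h \<in> jacobian_ideal f"
    using homogenize_in_jacobian_ideal[OF f e(2)] by simp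
  then show ?thesis using b homogenize_in_forms by blast
qed

section \<open>Ideals of commutative rings\<close>

definition is_ideal :: "'a::comm_ring_1 set \<Rightarrow> bool" where
  "is_ideal I \<longleftrightarrow> 0 \<in> I \<and> (\<forall>x\<in>I. \<forall>y\<in>I. x + y \<in> I) \<and> (\<forall>a. \<forall>x\<in>I. a * x \<in> I)"

lemma is_idealD:
  assumes "is_ideal I"
  shows "0 \<in> I" "x \<in> I \<Longrightarrow> y \<in> I \<Longrightarrow> x + y \<in> I" "x \<in> I \<Longrightarrow> a * x \<in> I"
    "x \<in> I \<Longrightarrow> - x \<in> I" "x \<in> I \<Longrightarrow> y \<in> I \<Longrightarrow> x - y \<in> I"
proof -
  show 0: "0 \<in> I" and a: "x \<in> I \<Longrightarrow> y \<in> I \<Longrightarrow> x + y \<in> I" and m: "x \<in> I \<Longrightarrow> a * x \<in> I" for x y a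
    using assms by (auto simp: is_ideal_def)
  show u: "x \<in> I \<Longrightarrow> - x \<in> I" for x using m[of x "- 1"] by simp
  show "x \<in> I \<Longrightarrow> y \<in> I \<Longrightarrow> x - y \<in> I" using a[of x "- y"] u by simp
qed

lemma is_ideal_sum: "is_ideal I \<Longrightarrow> (\<And>i. i \<in> A \<Longrightarrow> F i \<in> I) \<Longrightarrow> sum F A \<in> I"
  by (induction A rule: infinite_finite_induct) (auto intro: is_idealD)

text \<open>Zorn's lemma. Maximality is recorded as invertibility modulo \<open>M\<close>, the form
  in which the residue field is studied below.\<close>

lemma maximal_ideal_exists:
  assumes I: "is_ideal I" and "1 \<notin> I"
  obtains M where "is_ideal M" "I \<subseteq> M" "1 \<notin> M" "\<And>z. z \<notin> M \<Longrightarrow> \<exists>b. z * b - 1 \<in> M"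
proof -
  let ?A = "{K. is_ideal K \<and> I \<subseteq> K \<and> 1 \<notin> K}"
  have "\<exists>M\<in>?A. \<forall>K\<in>?A. M \<subseteq> K \<longrightarrow> K = M"
  proof (rule subset_Zorn_nonempty)
    show "?A \<noteq> {}" using assms by blast
    fix C assume ne: "C \<noteq> {}" and C: "subset.chain ?A C"
    then have sub: "C \<subseteq> ?A" and chain: "\<And>K L. K \<in> C \<Longrightarrow> L \<in> C \<Longrightarrow> K \<subseteq> L \<or> L \<subseteq> K"
      by (auto simp: subset_chain_def)
    have "is_ideal (\<Union>C)"
      unfolding is_ideal_def
    proof (intro conjI ballI allI)
      show "0 \<in> \<Union>C" using ne sub is_idealD(1) by blast
    next
      fix x y assume "x \<in> \<Union>C" "y \<in> \<Union>C"
      then obtain K L where "K \<in> C" "x \<in> K" "L \<in> C" "y \<in> L" by blast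
      moreover from this chain[of K L] obtain N where "N \<in> C" "x \<in> N" "y \<in> N" by blast
      ultimately show "x + y \<in> \<Union>C" using sub is_idealD(2)[of N x y] by blast
    next
      fix a x assume "x \<in> \<Union>C"
      then show "a * x \<in> \<Union>C" using sub is_idealD(3) by blast
    qed
    moreover have "I \<subseteq> \<Union>C" using ne sub by blast
    moreover have "1 \<notin> \<Union>C" using sub by blast
    ultimately show "\<Union>C \<in> ?A" by blast
  qed
  then obtain M where "M \<in> ?A" and max': "\<forall>K\<in>?A. M \<subseteq> K \<longrightarrow> K = M" by (elim bexE)
  then have M: "is_ideal M" "I \<subseteq> M" "1 \<notin> M" by simp_all
  have max: "K = M" if "is_ideal K" "I \<subseteq> K" "1 \<notin> K" "M \<subseteq> K" for K
    using max' that by simp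
  have "\<exists>b. z * b - 1 \<in> M" if z: "z \<notin> M" for z
  proof -
    \<comment> \<open>The ideal generated by \<open>M\<close> and \<open>z\<close>; by maximality it
      contains 1.\<close>
    let ?K = "{x + z * b |x b. x \<in> M}"
    have "is_ideal ?K"
      unfolding is_ideal_def
    proof (intro conjI ballI allI)
      show "0 \<in> ?K" using is_idealD(1)[OF M(1)] by (intro CollectI exI[of _ 0]) simp
    next
      fix x y assume "x \<in> ?K" "y \<in> ?K"
      then obtain x' b y' c where "x = x' + z * b" "y = y' + z * c" "x' \<in> M" "y' \<in> M" by blast
      then show "x + y \<in> ?K" using is_idealD(2)[OF M(1)]
        by (intro CollectI exI[of _ "x' + y'"] exI[of _ "b + c"]) (simp add: algebra_simps)
    next
      fix a x assume "x \<in> ?K"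
      then obtain x' b where x: "x = x' + z * b" "x' \<in> M" by blast
      have "a * x = a * x' + z * (a * b)" by (simp add: x algebra_simps)
      then show "a * x \<in> ?K" using is_idealD(3)[OF M(1) x(2)] by blast
    qed
    moreover have "M \<subseteq> ?K"
    proof
      fix x assume "x \<in> M"
      then show "x \<in> ?K" by (intro CollectI exI[of _ x] exI[of _ 0]) simp
    qed
    moreover have "z \<in> ?K" using is_idealD(1)[OF M(1)] by (intro CollectI exI[of _ 0] exI[of _ 1]) simp
    ultimately have "1 \<in> ?K" using max[of ?K] M(2) z by blast
    then obtain x b where "1 = x + z * b" "x \<in> M" by blast
    then have "z * b - 1 = - x" by (simp add: algebra_simps)
    then show ?thesis using is_idealD(4)[OF M(1) \<open>x \<in> M\<close>] by metis
  qed
  with M show thesis by (rule that)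
qed

text \<open>Elements \<open>e\<close> with \<open>1 - e\<close> in the ideal act as denominators, so
  no localisation is formed. In place of the determinant trick, the generators are eliminated one by
  one.\<close>

lemma nakayama:
  fixes y :: "'i \<Rightarrow> 'a::comm_ring_1"
  assumes J: "is_ideal J" and m: "is_ideal \<mm>" and fin: "finite I"
    and "\<And>i. i \<in> I \<Longrightarrow> \<exists>e c. 1 - e \<in> \<mm> \<and> (\<forall>k\<in>I. c k \<in> \<mm>) \<and> e * y i - (\<Sum>k\<in>I. c k * y k) \<in> J"
  shows "\<exists>e. 1 - e \<in> \<mm> \<and> (\<forall>i\<in>I. e * y i \<in> J)"
  using fin assms(4)
proof (induction I rule: finite_induct)
  case empty
  then show ?case using is_idealD(1)[OF m] by (intro exI[of _ 1]) simp
next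
  case (insert i0 I)
  have mult1: "1 - e * e' \<in> \<mm>" if "1 - e \<in> \<mm>" "1 - e' \<in> \<mm>" for e e'
  proof -
    have "1 - e * e' = (1 - e') + e' * (1 - e)" by (simp add: algebra_simps)
    then show ?thesis using that is_idealD[OF m] by metis
  qed
  obtain e0 c0 where e0: "1 - e0 \<in> \<mm>" "\<forall>k\<in>insert i0 I. c0 k \<in> \<mm>"
    "e0 * y i0 - (\<Sum>k\<in>insert i0 I. c0 k * y k) \<in> J"
    using insert.prems[of i0] by auto
  \<comment> \<open>The diagonal coefficient is moved to the left; \<open>e1\<close> is still
    congruent to 1.\<close>
  define e1 where "e1 = e0 - c0 i0"
  have "1 - e1 = (1 - e0) + c0 i0" by (simp add: e1_def)
  then have e1: "1 - e1 \<in> \<mm>" using e0 is_idealD(2)[OF m] by (metis insertI1)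
  have y0: "e1 * y i0 - (\<Sum>k\<in>I. c0 k * y k) \<in> J"
    using e0(3) insert.hyps by (simp add: e1_def algebra_simps)
  have "\<exists>e c. 1 - e \<in> \<mm> \<and> (\<forall>k\<in>I. c k \<in> \<mm>) \<and> e * y i - (\<Sum>k\<in>I. c k * y k) \<in> J" if i: "i \<in> I" for i
  proof -
    obtain e c where e: "1 - e \<in> \<mm>" "\<forall>k\<in>insert i0 I. c k \<in> \<mm>"
      "e * y i - (\<Sum>k\<in>insert i0 I. c k * y k) \<in> J"
      using insert.prems[of i] i by auto
    \<comment> \<open>Multiplying the relation by \<open>e1\<close> and substituting for
      \<open>e1 * y i0\<close> removes the generator \<open>i0\<close>.\<close>
    define c' where "c' k = e1 * c k + c i0 * c0 k" for k
    have "(\<Sum>k\<in>I. c' k * y k) = e1 * (\<Sum>k\<in>I. c k * y k) + c i0 * (\<Sum>k\<in>I. c0 k * y k)"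
      by (simp add: c'_def algebra_simps sum.distrib sum_distrib_left)
    then have "(e1 * e) * y i - (\<Sum>k\<in>I. c' k * y k)
        = e1 * (e * y i - (\<Sum>k\<in>insert i0 I. c k * y k)) + c i0 * (e1 * y i0 - (\<Sum>k\<in>I. c0 k * y k))"
      using insert.hyps by (simp add: algebra_simps)
    also have "\<dots> \<in> J" using e(3) y0 by (intro is_idealD(2,3)[OF J])
    finally have "(e1 * e) * y i - (\<Sum>k\<in>I. c' k * y k) \<in> J" .
    moreover have "\<forall>k\<in>I. c' k \<in> \<mm>"
      using e(2) e0(2) unfolding c'_def by (auto intro!: is_idealD[OF m])
    ultimately show ?thesis using mult1[OF e1 e(1)] by blast
  qed
  then obtain e where e: "1 - e \<in> \<mm>" "\<forall>i\<in>I. e * y i \<in> J" using insert.IH by blast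
  have "(e * e1) * y i0 = e * (e1 * y i0 - (\<Sum>k\<in>I. c0 k * y k)) + (\<Sum>k\<in>I. c0 k * (e * y k))"
    by (simp add: algebra_simps sum_distrib_left)
  also have "\<dots> \<in> J"
  proof (rule is_idealD(2)[OF J is_idealD(3)[OF J y0] is_ideal_sum[OF J]])
    fix k assume "k \<in> I"
    then show "c0 k * (e * y k) \<in> J" using e(2) by (simp add: is_idealD(3)[OF J])
  qed
  finally have "(e * e1) * y i0 \<in> J" .
  moreover have "(e * e1) * y i \<in> J" if "i \<in> I" for i
    using is_idealD(3)[OF J, of "e * y i" e1] e(2) that by (simp add: ac_simps)
  ultimately show ?case using mult1[OF e(1) e1] by blast
qed

section \<open>The weak Nullstellensatz\<close>

context
  fixes a :: hpoly
begin

definition at_element :: "complex poly \<Rightarrow> hpoly" where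
  "at_element p = poly (map_poly pconst p) a"

lemma at_element_pCons: "at_element (pCons c p) = pconst c + a * at_element p"
  unfolding at_element_def by (subst map_poly_pCons) auto

lemma at_element_0 [simp]: "at_element 0 = 0" by (simp add: at_element_def)

lemma at_element_add: "at_element (p + q) = at_element p + at_element q"
proof (induction p arbitrary: q rule: pCons_induct)
  case (pCons c p)
  obtain e r where q: "q = pCons e r" by (cases q)
  show ?case by (simp add: q at_element_pCons single_add pCons.IH distrib_left)
qed simp

lemma at_element_smult: "at_element (smult c p) = pconst c * at_element p"
  by (induction p rule: pCons_induct)
    (simp_all add: at_element_pCons algebra_simps mult_single)

lemma at_element_mult: "at_element (p * q) = at_element p * at_element q"
  by (induction p rule: pCons_induct)
    (simp_all add: at_element_pCons at_element_add at_element_smult algebra_simps)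

lemma at_element_sum: "at_element (sum F A) = (\<Sum>i\<in>A. at_element (F i))"
  by (induction A rule: infinite_finite_induct) (auto simp: at_element_add)

lemma at_element_linear: "at_element [:- r, 1:] = a - pconst r"
  by (simp add: at_element_pCons single_uminus)

end

text \<open>The polynomial is split into linear factors over the complex numbers; a factor whose
  value lies outside \<open>M\<close> is invertible modulo \<open>M\<close> and can be cancelled,
  until one lies in \<open>M\<close>.\<close>

lemma root_modulo_maximal_ideal:
  assumes M: "is_ideal M" "1 \<notin> M" "\<And>z. z \<notin> M \<Longrightarrow> \<exists>b. z * b - 1 \<in> M"
  shows "p \<noteq> 0 \<Longrightarrow> at_element a p \<in> M \<Longrightarrow> \<exists>r. a - pconst r \<in> M"
proof (induction "degree p" arbitrary: p)
  case 0
  then obtain c where c: "p = [:c:]" "c \<noteq> 0" by (metis degree_eq_zeroE pCons_0_0)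
  then have "pconst (1 / c) * pconst c \<in> M"
    using 0 by (intro is_idealD(3)[OF M(1)]) (simp add: at_element_pCons)
  then have "1 \<in> M" using c by (simp add: mult_single)
  then show ?case using M(2) by simp
next
  case (Suc n)
  then have "\<not> constant (poly p)" by (simp add: constant_degree)
  then obtain r where "poly p r = 0" using fundamental_theorem_of_algebra by blast
  then obtain q where q: "p = [:- r, 1:] * q" by (auto simp: poly_eq_0_iff_dvd)
  show ?case
  proof (cases "a - pconst r \<in> M")
    case False
    then obtain b where b: "(a - pconst r) * b - 1 \<in> M" using M(3) by blast
    have "at_element a q = b * at_element a p - at_element a q * ((a - pconst r) * b - 1)"
      by (simp add: q at_element_mult at_element_linear del: mult_pCons_left)
        (simp add: algebra_simps)
    also have "\<dots> \<in> M"
      by (rule is_idealD(5)[OF M(1) is_idealD(3)[OF M(1) Suc.prems(2)] is_idealD(3)[OF M(1) b]])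
    finally have "at_element a q \<in> M" .
    moreover have "q \<noteq> 0" using q Suc.prems(1) by auto
    moreover have "n = degree q"
      using Suc(2) \<open>q \<noteq> 0\<close> by (simp add: q degree_mult_eq del: mult_pCons_left)
    ultimately show ?thesis using Suc(1) by blast
  qed blast
qed

text \<open>
  If no \<open>a - c\<close> lies in \<open>M\<close>, all of them are invertible modulo \<open>M\<close>. Uncountably many inverses
  cannot be linearly independent in a space of countable dimension, and a linear relation between
  them makes \<open>a\<close> algebraic over \<open>\<complex>\<close> modulo \<open>M\<close>.
\<close>

lemma maximal_ideal_residue_field:
  fixes a :: hpoly
  assumes M: "is_ideal M" "1 \<notin> M" "\<And>z. z \<notin> M \<Longrightarrow> \<exists>b. z * b - 1 \<in> M"
  shows "\<exists>c. a - pconst c \<in> M"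
proof (rule ccontr)
  assume no: "\<nexists>c. a - pconst c \<in> M"
  then have "\<forall>x::real. \<exists>b. (a - pconst (of_real x)) * b - 1 \<in> M" using M(3) by blast
  then obtain b where b: "\<And>x::real. (a - pconst (of_real x)) * b x - 1 \<in> M" by metis
  \<comment> \<open>Uncountably many inverses are distributed over countably many degree bounds, so
    some bound serves infinitely many of them.\<close>
  have "(\<Union>n. {x. pdeg_le n (b x)}) = UNIV" using pdeg_le_exists by auto
  then have "uncountable (\<Union>n. {x. pdeg_le n (b x)})"
    using uncountable_UNIV_real by simp
  then obtain n where n: "infinite {x. pdeg_le n (b x)}"
    by (metis countable_UN uncountable_infinite UNIV_I countableI_type)
  let ?R = "{m :: hvar \<Rightarrow>\<^sub>0 nat. keys m \<subseteq> {X, Y, Z} \<and> mdeg m \<le> n}"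
  have finR: "finite ?R" by (rule finite_monomials_le) simp
  \<comment> \<open>One inverse more than there are monomials of degree at most \<open>n\<close>
    forces a linear relation.\<close>
  obtain F where F: "finite F" "card F = Suc (card ?R)" "F \<subseteq> {x. pdeg_le n (b x)}"
    using infinite_arbitrarily_large[OF n] by blast
  obtain l where l: "\<exists>x\<in>F. l x \<noteq> 0" "\<forall>m\<in>?R. (\<Sum>x\<in>F. lookup (b x) m * l x) = 0"
    using homogeneous_system_nontrivial_solution[OF finR F(1), of "\<lambda>m x. lookup (b x) m"] F(2)
    by auto
  have rel: "(\<Sum>x\<in>F. pconst (l x) * b x) = 0"
  proof (rule poly_mapping_eqI)
    fix m
    show "lookup (\<Sum>x\<in>F. pconst (l x) * b x) m = lookup 0 m"
    proof (cases "mdeg m \<le> n")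
      case True
      then have "(\<Sum>x\<in>F. lookup (b x) m * l x) = 0" using l(2) keys_hvar by blast
      then have "(\<Sum>x\<in>F. l x * lookup (b x) m) = 0" by (simp only: mult.commute)
      then show ?thesis by (simp add: lookup_sum)
    next
      case False
      have "lookup (b x) m = 0" if "x \<in> F" for x
      proof -
        have "pdeg_le n (b x)" using F(3) that by blast
        then show ?thesis using False unfolding pdeg_le_def by (meson in_keys_iff)
      qed
      then show ?thesis by (simp add: lookup_sum)
    qed
  qed
  define L where "L A = (\<Prod>y\<in>A. [:- of_real y, 1:] :: complex poly)" for A :: "real set"
  have atL: "at_element a (L F) = at_element a (L (F - {x})) * (a - pconst (of_real x))" if "x \<in> F" for x
    unfolding L_def prod.remove[OF F(1) that] at_element_mult at_element_linear by (rule mult.commute)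
  \<comment> \<open>The numerator of the sum of \<open>l x / (a - x)\<close> over the common
    denominator \<open>L F\<close>.\<close>
  define p where "p = (\<Sum>x\<in>F. smult (l x) (L (F - {x})))"
  have "at_element a p = (\<Sum>x\<in>F. pconst (l x) * at_element a (L (F - {x})))"
    by (simp add: p_def at_element_sum at_element_smult)
  also have "\<dots> = at_element a (L F) * (\<Sum>x\<in>F. pconst (l x) * b x)
      - (\<Sum>x\<in>F. pconst (l x) * at_element a (L (F - {x})) * ((a - pconst (of_real x)) * b x - 1))"
    unfolding sum_distrib_left sum_subtractf[symmetric]
    by (rule sum.cong) (simp_all add: atL algebra_simps)
  also have "\<dots> \<in> M"
    unfolding rel
    by (rule is_idealD(5)[OF M(1) is_idealD(3)[OF M(1) is_idealD(1)[OF M(1)]]])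
      (intro is_ideal_sum[OF M(1)] is_idealD(3)[OF M(1)] b)
  finally have "at_element a p \<in> M" .
  moreover have "p \<noteq> 0"
  proof -
    obtain x0 where x0: "x0 \<in> F" "l x0 \<noteq> 0" using l(1) by blast
    \<comment> \<open>At \<open>x0\<close> every summand but the one belonging to \<open>x0\<close>
      contains a vanishing factor.\<close>
    have "poly p (of_real x0) = (\<Sum>x\<in>F. l x * poly (L (F - {x})) (of_real x0))"
      by (simp add: p_def poly_sum)
    also have "\<dots> = (\<Sum>x\<in>F. if x = x0 then l x0 * poly (L (F - {x0})) (of_real x0) else 0)"
    proof (rule sum.cong)
      fix x assume "x \<in> F"
      then show "l x * poly (L (F - {x})) (of_real x0)
          = (if x = x0 then l x0 * poly (L (F - {x0})) (of_real x0) else 0)"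
        using x0 F(1) by (auto simp: L_def poly_prod)
    qed simp
    also have "\<dots> = l x0 * poly (L (F - {x0})) (of_real x0)" using x0 F(1) by simp
    also have "\<dots> \<noteq> 0" using x0 F(1) by (auto simp: L_def poly_prod)
    finally show ?thesis by auto
  qed
  ultimately show False using root_modulo_maximal_ideal[OF M] no by blast
qed

text \<open>Modulo a maximal ideal each variable is congruent to a constant; these constants are the
  coordinates of a common zero.\<close>

theorem weak_nullstellensatz:
  fixes I :: "hpoly set"
  assumes "is_ideal I" "1 \<notin> I"
  shows "\<exists>P. \<forall>q\<in>I. peval P q = 0"
proof -
  obtain M where M: "is_ideal M" "I \<subseteq> M" "1 \<notin> M" "\<And>z. z \<notin> M \<Longrightarrow> \<exists>b. z * b - 1 \<in> M"
    using maximal_ideal_exists[OF assms] by blast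
  have "\<forall>x. \<exists>c. pvar x - pconst c \<in> M"
    using maximal_ideal_residue_field[OF M(1,3,4)] by blast
  then obtain P where P: "\<And>x. pvar x - pconst (P x) \<in> M" by metis
  have ev: "q - pconst (peval P q) \<in> M" for q
  proof (induction q rule: polynomial_induct)
    case (const c)
    then show ?case using is_idealD(1)[OF M(1)] by simp
  next
    case (var x)
    then show ?case using P unfolding peval_pvar .
  next
    case (add p q)
    then show ?case
      using is_idealD(2)[OF M(1) add] by (simp add: peval_simps single_add algebra_simps)
  next
    case (mult p q)
    have "p * q - pconst (peval P (p * q))
        = q * (p - pconst (peval P p)) + pconst (peval P p) * (q - pconst (peval P q))"
      by (simp add: peval_simps algebra_simps mult_single)
    also have "\<dots> \<in> M" using mult by (intro is_idealD(2,3)[OF M(1)])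
    finally show ?case .
  qed
  have "peval P q = 0" if "q \<in> I" for q
  proof (rule ccontr)
    assume nz: "peval P q \<noteq> 0"
    have "q - (q - pconst (peval P q)) \<in> M" 
      by (rule is_idealD(5)[OF M(1) subsetD[OF M(2) that] ev])
    then have "pconst (1 / peval P q) * pconst (peval P q) \<in> M" by (intro is_idealD[OF M(1)]) simp
    then have "1 \<in> M" using nz by (simp add: mult_single)
    with M(3) show False by simp
  qed
  then show ?thesis by blast
qed

section \<open>Local membership in the Jacobian ideal\<close>

lemma ideal_gen_least:
  assumes "S \<subseteq> ideal_gen (germs A) S'"
  shows "ideal_gen (germs A) S \<subseteq> ideal_gen (germs A) S'"
proof
  fix x assume "x \<in> ideal_gen (germs A) S"
  then show "x \<in> ideal_gen (germs A) S'"
    by (induction rule: ideal_gen_induct) (use assms in auto)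
qed

lemma ord_ge_mvar_power: "ord_ge n (mvar x ^ n)"
  by (rule ord_ge_power) (simp add: coeff_mvar)

text \<open>Otherwise every degree contains a monomial that is not the leading form of an element of
  the ideal. Among m + 1 of these, of different degrees, some combination lies in the ideal, because
  m elements span the quotient; its term of lowest degree is then a leading form. The result is the
  input for Nakayama's lemma.\<close>

lemma finite_colength_monomials:
  fixes m :: nat
  assumes fd: "\<And>h. h \<in> plane_ring \<Longrightarrow> \<exists>c. h - (\<Sum>i<m. mscale (c i) (D i)) \<in> ideal_gen plane_ring S"
  shows "\<exists>s. \<forall>i\<le>s. \<exists>x\<in>ideal_gen plane_ring S. ord_ge (Suc s) (mvar LU ^ i * mvar LV ^ (s - i) - x)"
proof (rule ccontr)
  let ?T = "ideal_gen plane_ring S"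
  assume "\<not> ?thesis"
  then obtain i where i: "\<And>s. i s \<le> s"
    "\<And>s x. x \<in> ?T \<Longrightarrow> \<not> ord_ge (Suc s) (mvar LU ^ i s * mvar LV ^ (s - i s) - x)" by metis
  define \<mu> where "\<mu> s = mvar LU ^ i s * mvar LV ^ (s - i s)" for s
  have \<mu>: "\<mu> s \<in> plane_ring" for s unfolding \<mu>_def by auto
  have ord: "ord_ge s (\<mu> s)" for s
    using ord_ge_mult[of "i s" "mvar LU ^ i s" "s - i s" "mvar LV ^ (s - i s)"] i(1)[of s]
    by (simp add: \<mu>_def ord_ge_mvar_power)
  obtain c where c: "\<And>s. \<mu> s - (\<Sum>j<m. mscale (c s j) (D j)) \<in> ?T" using fd[OF \<mu>] by metis
  obtain l where l: "\<exists>s\<in>{..m}. l s \<noteq> 0" "\<forall>j\<in>{..<m}. (\<Sum>s\<in>{..m}. c s j * l s) = 0"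
    using homogeneous_system_nontrivial_solution[of "{..<m}" "{..m}" "\<lambda>j s. c s j"] by auto
  have "(\<Sum>s\<le>m. mscale (l s) (\<mu> s - (\<Sum>j<m. mscale (c s j) (D j)))) \<in> ?T"
    using c by auto
  also have "(\<Sum>s\<le>m. mscale (l s) (\<mu> s - (\<Sum>j<m. mscale (c s j) (D j)))) = (\<Sum>s\<le>m. mscale (l s) (\<mu> s))"
  proof (rule mps_eqI)
    fix a
    have "(\<Sum>s\<le>m. \<Sum>j<m. l s * (c s j * coeff (D j) a)) = (\<Sum>j<m. (\<Sum>s\<le>m. c s j * l s) * coeff (D j) a)"
      by (subst sum.swap) (simp add: sum_distrib_left sum_distrib_right ac_simps)
    then show "coeff (\<Sum>s\<le>m. mscale (l s) (\<mu> s - (\<Sum>j<m. mscale (c s j) (D j)))) a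
        = coeff (\<Sum>s\<le>m. mscale (l s) (\<mu> s)) a"
      using l(2) by (simp add: right_diff_distrib sum_subtractf sum_distrib_left)
  qed
  finally have T: "(\<Sum>s\<le>m. mscale (l s) (\<mu> s)) \<in> ?T" .
  define s0 where "s0 = (LEAST s. l s \<noteq> 0)"
  have "\<exists>s. l s \<noteq> 0" using l(1) by blast
  then have s0: "l s0 \<noteq> 0" unfolding s0_def by (rule LeastI_ex)
  have less: "l s = 0" if "s < s0" for s using that not_less_Least unfolding s0_def by blast
  have "s0 \<le> m" using l(1) less by (metis atMost_iff le_trans linorder_not_less)
  define x where "x = mscale (1 / l s0) (\<Sum>s\<le>m. mscale (l s) (\<mu> s))"
  have "x \<in> ?T" using T by (auto simp: x_def)
  moreover have "ord_ge (Suc s0) (\<mu> s0 - x)"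
    unfolding ord_ge_def
  proof (intro allI impI)
    fix a :: "lvar \<Rightarrow>\<^sub>0 nat" assume a: "mdeg a < Suc s0"
    have "(\<Sum>s\<le>m. l s * coeff (\<mu> s) a) = (\<Sum>s\<le>m. if s = s0 then l s0 * coeff (\<mu> s0) a else 0)"
    proof (rule sum.cong)
      fix s
      show "l s * coeff (\<mu> s) a = (if s = s0 then l s0 * coeff (\<mu> s0) a else 0)"
        using less[of s] ord[of s] a by (cases s s0 rule: linorder_cases) (auto simp: ord_ge_def)
    qed simp
    also have "\<dots> = l s0 * coeff (\<mu> s0) a" using \<open>s0 \<le> m\<close> by simp
    finally show "coeff (\<mu> s0 - x) a = 0" using s0 by (simp add: x_def)
  qed
  ultimately show False using i(2) unfolding \<mu>_def by blast
qed

section \<open>An affine chart around a point: passage between series and polynomials\<close>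

locale plane_chart =
  fixes p :: "hvar \<Rightarrow> complex" and w u v :: hvar
  assumes coords: "{w, u, v} = UNIV" "w \<noteq> u" "w \<noteq> v" "u \<noteq> v" and pw: "p w = 1"
    and local: "local_coord p w = 0" "local_coord p u = mvar LU" "local_coord p v = mvar LV"
begin

abbreviation "M1 \<equiv> pvar u - pconst (p u)"
abbreviation "M2 \<equiv> pvar v - pconst (p v)"

text \<open>The kernel of setting w = 1. Working modulo it replaces the coordinate ring of the
  affine chart, so that forms and their dehomogenisations stay in one ring.\<close>

definition affine_ideal :: "hpoly set" where
  "affine_ideal = {(pvar w - 1) * b |b. True}"

lemma affine_ideal: "is_ideal affine_ideal"
  unfolding is_ideal_def
proof (intro conjI ballI allI)
  show "0 \<in> affine_ideal" unfolding affine_ideal_def by (intro CollectI exI[of _ 0]) simp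
next
  fix x y assume "x \<in> affine_ideal" "y \<in> affine_ideal"
  then show "x + y \<in> affine_ideal" unfolding affine_ideal_def by (auto simp: distrib_left[symmetric])
next
  fix a x assume "x \<in> affine_ideal"
  then obtain b where "x = (pvar w - 1) * b" unfolding affine_ideal_def by blast
  then show "a * x \<in> affine_ideal" unfolding affine_ideal_def
    by (intro CollectI exI[of _ "a * b"]) (simp only: mult.left_commute simp_thms)
qed

lemma hvar_cases: "y = w \<or> y = u \<or> y = v" using coords(1) by blast

lemma local_eq_M: "local_eq p M1 = mvar LU" "local_eq p M2 = mvar LV" "local_eq p (pvar w - 1) = 0"
  unfolding local_eq_simps local_eq_pvar local_eq_pconst local_eq_1 local pw by simp_all

lemma peval_M: "peval p M1 = 0" "peval p M2 = 0" "peval p (pvar w - 1) = 0"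
  unfolding peval_simps peval_pvar peval_pconst peval_1 pw by simp_all

abbreviation "shift \<equiv> case_lvar M1 M2 (\<lambda>_. 0)"

lemma local_eq_shift:
  assumes "keys a \<subseteq> {LU, LV}"
  shows "local_eq p (monomial_value shift a) = mmon a"
proof -
  have "local_eq p (monomial_value shift a) = monomial_value (\<lambda>x. local_eq p (shift x)) a"
    unfolding local_eq_eq by (rule mconst_hom.poly_eval_monomial_value)
  also have "\<dots> = monomial_value mvar a"
    using assms by (intro monomial_value_cong) (auto simp: local_eq_M simp del: One_nat_def)
  finally show ?thesis by (simp add: mmon_eq_monomial_value)
qed

text \<open>A Taylor polynomial of \<open>A\<close>, with the local coordinates replaced by
  \<open>M1\<close> and \<open>M2\<close>, whose germs they are.\<close>

lemma plane_approximation: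
  assumes A: "A \<in> plane_ring"
  shows "\<exists>q. ord_ge s (local_eq p q - A)"
proof -
  define q where "q = (\<Sum>a | mdeg a \<le> s \<and> coeff A a \<noteq> 0. pconst (coeff A a) * monomial_value shift a)"
  have "local_eq p q = truncation s A"
    unfolding q_def truncation_def local_eq_simps
    by (rule sum.cong) (use germs_support[OF A] in \<open>auto simp: local_eq_shift mscale_def simp del: One_nat_def\<close>)
  then have "ord_ge s (local_eq p q - A)"
    by (simp add: ord_ge_def coeff_truncation[OF A])
  then show ?thesis by blast
qed

definition dehom :: "hvar \<Rightarrow> (lvar \<Rightarrow>\<^sub>0 nat) \<Rightarrow>\<^sub>0 complex" where
  "dehom y = (if y = w then 1 else if y = u then pvar LU + pconst (p u) else pvar LV + pconst (p v))"

text \<open>Taylor expansion at p: passing to the local coordinates by \<open>dehom\<close> and back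
  by \<open>shift\<close> changes a polynomial only by a multiple of \<open>w - 1\<close>, and the
  coefficients in between are those of the local equation.\<close>

lemma normal_form:
  "\<exists>S. finite S \<and> (\<forall>a\<in>S. coeff (local_eq p q) a \<noteq> 0) \<and>
     q - (\<Sum>a\<in>S. pconst (coeff (local_eq p q) a) * monomial_value shift a) \<in> affine_ideal"
proof -
  let ?r = "poly_eval pconst dehom :: hpoly \<Rightarrow> _"
  let ?e = "poly_eval pconst shift"
  have 1: "local_eq p q = poly_eval mconst mvar (?r q)"
  proof (induction q rule: polynomial_induct)
    case (var y)
    have "local_eq p (pvar y) = poly_eval mconst mvar (dehom y)"
      using hvar_cases[of y] coords(2-4) local pw unfolding local_eq_pvar dehom_def
      by (auto simp: mconst_hom.poly_eval_add mconst_hom.poly_eval_pvar simp del: One_nat_def)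
    then show ?case by (simp only: pconst_hom.poly_eval_pvar)
  qed (simp_all add: local_eq_simps pconst_hom.poly_eval_simps mconst_hom.poly_eval_simps)
  have 2: "q - ?e (?r q) \<in> affine_ideal"
  proof (induction q rule: polynomial_induct)
    case (const c)
    then show ?case using is_idealD(1)[OF affine_ideal] by simp
  next
    case (var y)
    have "pvar w - 1 \<in> affine_ideal" unfolding affine_ideal_def by (intro CollectI exI[of _ 1]) simp
    then have "pvar y - ?e (dehom y) \<in> affine_ideal"
      using hvar_cases[of y] coords(2-4) is_idealD(1)[OF affine_ideal] unfolding dehom_def
      by (auto simp: pconst_hom.poly_eval_add pconst_hom.poly_eval_pvar simp del: One_nat_def)
    then show ?case by (simp only: pconst_hom.poly_eval_pvar)
  next
    case (add a b)
    then show ?case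
      using is_idealD(2)[OF affine_ideal add] by (simp add: pconst_hom.poly_eval_simps algebra_simps)
  next
    case (mult a b)
    have "a * b - ?e (?r (a * b)) = b * (a - ?e (?r a)) + ?e (?r a) * (b - ?e (?r b))"
      by (simp add: pconst_hom.poly_eval_simps algebra_simps)
    also have "\<dots> \<in> affine_ideal" using mult by (intro is_idealD(2,3)[OF affine_ideal])
    finally show ?case .
  qed
  have 3: "coeff (poly_eval mconst mvar r) a = lookup r a" for r a
    unfolding poly_eval_def mmon_eq_monomial_value[symmetric]
    by (auto simp: coeff_mmon in_keys_iff if_distrib sum.delta' cong: if_cong)
  have "?e (?r q) = (\<Sum>a\<in>keys (?r q). pconst (coeff (local_eq p q) a) * monomial_value shift a)"
    by (simp only: poly_eval_def[of pconst shift] 1 3)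
  with 2 show ?thesis
    by (intro exI[of _ "keys (?r q)"]) (auto simp: 1 3 in_keys_iff)
qed

text \<open>The s-th power of the ideal of p on the affine chart, with the coefficients of its
  generators kept explicit.\<close>

definition power_ideal :: "nat \<Rightarrow> hpoly set" where
  "power_ideal s = {x. \<exists>c. x - (\<Sum>i\<le>s. c i * (M1 ^ i * M2 ^ (s - i))) \<in> affine_ideal}"

lemma power_ideal: "is_ideal (power_ideal s)"
  unfolding is_ideal_def
proof (intro conjI ballI allI)
  show "0 \<in> power_ideal s" unfolding power_ideal_def
    using is_idealD(1)[OF affine_ideal] by (intro CollectI exI[of _ "\<lambda>_. 0"]) simp
next
  let ?y = "\<lambda>i. M1 ^ i * M2 ^ (s - i)"
  fix x y assume "x \<in> power_ideal s" "y \<in> power_ideal s"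
  then obtain c c' where "x - (\<Sum>i\<le>s. c i * ?y i) \<in> affine_ideal" "y - (\<Sum>i\<le>s. c' i * ?y i) \<in> affine_ideal"
    unfolding power_ideal_def by blast
  then have "(x - (\<Sum>i\<le>s. c i * ?y i)) + (y - (\<Sum>i\<le>s. c' i * ?y i)) \<in> affine_ideal"
    by (rule is_idealD(2)[OF affine_ideal])
  also have "(x - (\<Sum>i\<le>s. c i * ?y i)) + (y - (\<Sum>i\<le>s. c' i * ?y i)) = x + y - (\<Sum>i\<le>s. (c i + c' i) * ?y i)"
    by (simp only: distrib_right sum.distrib) simp
  finally show "x + y \<in> power_ideal s"
    unfolding power_ideal_def by (intro CollectI exI[of _ "\<lambda>i. c i + c' i"])
next
  let ?y = "\<lambda>i. M1 ^ i * M2 ^ (s - i)"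
  fix a x assume "x \<in> power_ideal s"
  then obtain c where "x - (\<Sum>i\<le>s. c i * ?y i) \<in> affine_ideal"
    unfolding power_ideal_def by blast
  then have "a * (x - (\<Sum>i\<le>s. c i * ?y i)) \<in> affine_ideal" by (rule is_idealD(3)[OF affine_ideal])
  also have "a * (x - (\<Sum>i\<le>s. c i * ?y i)) = a * x - (\<Sum>i\<le>s. (a * c i) * ?y i)"
    by (simp only: right_diff_distrib sum_distrib_left mult.assoc)
  finally show "a * x \<in> power_ideal s"
    unfolding power_ideal_def by (intro CollectI exI[of _ "\<lambda>i. a * c i"])
qed

lemma power_ideal_base:
  assumes "i \<le> s"
  shows "M1 ^ i * M2 ^ (s - i) \<in> power_ideal s"
proof -
  have "(\<Sum>k\<le>s. (if k = i then 1 else 0) * (M1 ^ k * M2 ^ (s - k)))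
      = (\<Sum>k\<le>s. if k = i then M1 ^ i * M2 ^ (s - i) else 0)"
    by (rule sum.cong) auto
  also have "\<dots> = M1 ^ i * M2 ^ (s - i)" using assms by simp
  finally show ?thesis unfolding power_ideal_def using is_idealD(1)[OF affine_ideal]
    by (intro CollectI exI[of _ "\<lambda>k. if k = i then 1 else 0"]) simp
qed

lemma affine_subset_power_ideal: "affine_ideal \<subseteq> power_ideal s"
  unfolding power_ideal_def by (auto intro!: exI[of _ "\<lambda>_. 0"])

text \<open>In the Taylor expansion only monomials of degree at least s occur, and each is divisible
  by one of degree s.\<close>

lemma power_ideal_of_order:
  assumes "ord_ge s (local_eq p q)"
  shows "q \<in> power_ideal s"
proof -
  obtain S where S: "finite S" "\<And>a. a \<in> S \<Longrightarrow> coeff (local_eq p q) a \<noteq> 0"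
    "q - (\<Sum>a\<in>S. pconst (coeff (local_eq p q) a) * monomial_value shift a) \<in> affine_ideal"
    using normal_form[of q] by blast
  have "monomial_value shift a \<in> power_ideal s" if a: "a \<in> S" for a
  proof -
    let ?i = "lookup a LU" and ?j = "lookup a LV"
    have keys: "keys a \<subseteq> {LU, LV}" using germs_support[OF local_eq_in_plane S(2)[OF a]] .
    have "s \<le> mdeg a" using S(2)[OF a] assms by (auto simp: ord_ge_def not_less[symmetric])
    then have s: "s \<le> ?i + ?j" using mdeg_eq_sum[OF _ keys] by simp
    \<comment> \<open>Splits off a factor of degree exactly s, taking as much of \<open>M1\<close>
      as possible.\<close>
    define k where "k = min s ?i"
    have "?i = k + (?i - k)" "?j = (s - k) + (?j - (s - k))" using s by (auto simp: k_def)
    then have "M1 ^ ?i * M2 ^ ?j = M1 ^ (k + (?i - k)) * M2 ^ ((s - k) + (?j - (s - k)))" by metis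
    also have "\<dots> = (M1 ^ (?i - k) * M2 ^ (?j - (s - k))) * (M1 ^ k * M2 ^ (s - k))"
      by (simp only: power_add ac_simps)
    also have "\<dots> \<in> power_ideal s"
      by (intro is_idealD(3)[OF power_ideal] power_ideal_base) (simp add: k_def)
    also have "M1 ^ ?i * M2 ^ ?j = monomial_value shift a"
      using monomial_value_superset[OF _ keys, of shift] by simp
    finally show ?thesis .
  qed
  then have "(\<Sum>a\<in>S. pconst (coeff (local_eq p q) a) * monomial_value shift a) \<in> power_ideal s"
    by (intro is_ideal_sum[OF power_ideal] is_idealD(3)[OF power_ideal])
  then have "(q - (\<Sum>a\<in>S. pconst (coeff (local_eq p q) a) * monomial_value shift a))
      + (\<Sum>a\<in>S. pconst (coeff (local_eq p q) a) * monomial_value shift a) \<in> power_ideal s"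
    using S(3) affine_subset_power_ideal by (intro is_idealD(2)[OF power_ideal]) auto
  then show ?thesis by simp
qed

text \<open>Each generator of degree s + 1 is one of degree s times \<open>M1\<close> or
  \<open>M2\<close>, both of which vanish at p. This is the shape of coefficients that Nakayama's
  lemma asks for.\<close>

lemma power_ideal_Suc:
  assumes "x \<in> power_ideal (Suc s)"
  shows "\<exists>c. (\<forall>i\<le>s. peval p (c i) = 0) \<and> x - (\<Sum>i\<le>s. c i * (M1 ^ i * M2 ^ (s - i))) \<in> affine_ideal"
proof -
  obtain c where c: "x - (\<Sum>i\<le>Suc s. c i * (M1 ^ i * M2 ^ (Suc s - i))) \<in> affine_ideal"
    using assms unfolding power_ideal_def by blast
  \<comment> \<open>Only \<open>M2 ^ Suc s\<close> contains no \<open>M1\<close>; it is charged to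
    \<open>i = 0\<close>, while all others give up one factor \<open>M1\<close>.\<close>
  define c' where "c' i = (if i = 0 then c 0 * M2 else 0) + c (Suc i) * M1" for i
  have "(\<Sum>i\<le>Suc s. c i * (M1 ^ i * M2 ^ (Suc s - i)))
      = c 0 * M2 ^ Suc s + (\<Sum>i\<le>s. c (Suc i) * (M1 ^ Suc i * M2 ^ (s - i)))"
    by (simp only: sum.atMost_Suc_shift) simp
  also have "\<dots> = (\<Sum>i\<le>s. (if i = 0 then c 0 * M2 * (M1 ^ i * M2 ^ (s - i)) else 0))
      + (\<Sum>i\<le>s. c (Suc i) * M1 * (M1 ^ i * M2 ^ (s - i)))"
    by (simp add: sum.delta ac_simps)
  also have "\<dots> = (\<Sum>i\<le>s. c' i * (M1 ^ i * M2 ^ (s - i)))"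
    unfolding sum.distrib[symmetric] by (rule sum.cong) (auto simp: c'_def distrib_right)
  finally have "x - (\<Sum>i\<le>s. c' i * (M1 ^ i * M2 ^ (s - i))) \<in> affine_ideal" using c by simp
  moreover have "peval p (c' i) = 0" for i
    unfolding c'_def peval_simps peval_M by (simp add: peval_simps peval_M del: One_nat_def)
  ultimately show ?thesis by blast
qed

text \<open>By Euler's identity the local equation of \<open>f\<close> is a combination of those of
  its partial derivatives, and the derivatives in local coordinates are two of these. So only three
  series coefficients have to be approximated by polynomials.\<close>

lemma tjurina_ideal_approximation:
  assumes f: "f \<in> forms d" "d > 0" and x: "x \<in> tjurina_ideal (local_eq p f)"
  shows "\<exists>j\<in>jacobian_ideal f. ord_ge s (local_eq p j - x)"
proof -
  let ?G = "{local_eq p (pdv X f), local_eq p (pdv Y f), local_eq p (pdv Z f)}"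
  let ?T = "ideal_gen plane_ring ?G"
  have pd: "local_eq p (pdv y f) \<in> ?T" for y
    by (cases y) (auto intro: ideal_gen_superset)
  have "local_eq p f \<in> ?T"
  proof -
    obtain a b c where "f = a * pdv X f + b * pdv Y f + c * pdv Z f"
      using form_in_jacobian_ideal[OF f] unfolding jacobian_ideal_def by blast
    then have "local_eq p f = local_eq p (a * pdv X f + b * pdv Y f + c * pdv Z f)" by (rule arg_cong)
    also have "\<dots> \<in> ?T" unfolding local_eq_simps by (intro ideal_gen_add ideal_gen_mult pd local_eq_in_plane)
    finally show ?thesis .
  qed
  moreover have "mderiv LU (local_eq p f) = local_eq p (pdv u f)"
    by (rule mderiv_local_eq[OF coords(2-4,1) local]) simp
  moreover have "mderiv LV (local_eq p f) = local_eq p (pdv v f)"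
    by (rule mderiv_local_eq[of w v u]) (use coords local in auto)
  ultimately have "tjurina_ideal (local_eq p f) \<subseteq> ?T" using pd by (intro ideal_gen_least) auto
  then have "x \<in> ?T" using x by (rule subsetD)
  from iffD1[OF ideal_gen_three this]
  obtain A B C where ABC: "A \<in> plane_ring" "B \<in> plane_ring" "C \<in> plane_ring"
    "x = A * local_eq p (pdv X f) + B * local_eq p (pdv Y f) + C * local_eq p (pdv Z f)"
    by (elim bexE)
  obtain a where a: "ord_ge s (local_eq p a - A)" using plane_approximation[OF ABC(1), of s] by (elim exE)
  obtain b where b: "ord_ge s (local_eq p b - B)" using plane_approximation[OF ABC(2), of s] by (elim exE)
  obtain c where c: "ord_ge s (local_eq p c - C)" using plane_approximation[OF ABC(3), of s] by (elim exE)
  let ?j = "a * pdv X f + b * pdv Y f + c * pdv Z f"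
  have "local_eq p ?j - x = (local_eq p a - A) * local_eq p (pdv X f)
      + (local_eq p b - B) * local_eq p (pdv Y f) + (local_eq p c - C) * local_eq p (pdv Z f)"
    by (simp add: ABC(4) local_eq_simps algebra_simps)
  moreover have "ord_ge s \<dots>"
    using ord_ge_mult[OF a ord_ge_0] ord_ge_mult[OF b ord_ge_0] ord_ge_mult[OF c ord_ge_0]
    by (intro ord_ge_add) simp_all
  moreover have "?j \<in> jacobian_ideal f" unfolding jacobian_ideal_def by blast
  ultimately show ?thesis by (intro bexI[of _ ?j]) simp_all
qed

text \<open>Nakayama's lemma for the monomials of degree s at p, modulo the Jacobian ideal and
  \<open>w - 1\<close>: some e with value 1 at p multiplies the s-th power of the ideal of p into
  that ideal. As \<open>h\<close> agrees with an element of the Jacobian ideal up to order s, e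
  multiplies \<open>h\<close> into it as well; it remains to homogenise e.\<close>

lemma local_multiplier:
  fixes m :: nat
  assumes f: "f \<in> forms d" "d > 0" and h: "h \<in> forms k"
    and hT: "local_eq p h \<in> tjurina_ideal (local_eq p f)"
    and fd: "\<And>h. h \<in> plane_ring \<Longrightarrow>
      \<exists>c. h - (\<Sum>i<m. mscale (c i) (D i)) \<in> tjurina_ideal (local_eq p f)"
  shows "\<exists>n e. e \<in> forms n \<and> peval p e \<noteq> 0 \<and> e * h \<in> jacobian_ideal f"
proof -
  let ?T = "tjurina_ideal (local_eq p f)" and ?\<mm> = "{q. peval p q = 0}"
  let ?J = "{j + b |j b. j \<in> jacobian_ideal f \<and> b \<in> affine_ideal}"
  have m: "is_ideal ?\<mm>" by (auto simp: is_ideal_def peval_simps)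
  have J: "is_ideal ?J"
    unfolding is_ideal_def
  proof (intro conjI ballI allI)
    show "0 \<in> ?J" using is_idealD(1)[OF affine_ideal] by (intro CollectI exI[of _ 0]) simp
  next
    fix x y assume "x \<in> ?J" "y \<in> ?J"
    then obtain j b j' b' where "x = j + b" "y = j' + b'" "j \<in> jacobian_ideal f" "j' \<in> jacobian_ideal f"
      "b \<in> affine_ideal" "b' \<in> affine_ideal" by blast
    then show "x + y \<in> ?J" using is_idealD(2)[OF affine_ideal]
      by (intro CollectI exI[of _ "j + j'"] exI[of _ "b + b'"]) (auto simp: algebra_simps)
  next
    fix a x assume "x \<in> ?J"
    then obtain j b where "x = j + b" "j \<in> jacobian_ideal f" "b \<in> affine_ideal" by blast
    then show "a * x \<in> ?J"
      by (intro CollectI exI[of _ "a * j"] exI[of _ "a * b"] conjI jacobian_ideal_mult is_idealD(3)[OF affine_ideal])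
        (simp_all only: distrib_left)
  qed
  have JJ: "j \<in> ?J" if "j \<in> jacobian_ideal f" for j
    using that is_idealD(1)[OF affine_ideal] by (intro CollectI exI[of _ j] exI[of _ 0]) simp
  have affJ: "b \<in> ?J" if "b \<in> affine_ideal" for b
    using that by (intro CollectI exI[of _ 0] exI[of _ b]) simp
  obtain s where s: "\<And>i. i \<le> s \<Longrightarrow> \<exists>x\<in>?T. ord_ge (Suc s) (mvar LU ^ i * mvar LV ^ (s - i) - x)"
    using finite_colength_monomials[where m = m and D = D, OF fd] by blast
  let ?y = "\<lambda>i. M1 ^ i * M2 ^ (s - i)"
  have "\<exists>e c. 1 - e \<in> ?\<mm> \<and> (\<forall>k\<in>{..s}. c k \<in> ?\<mm>) \<and> e * ?y i - (\<Sum>k\<in>{..s}. c k * ?y k) \<in> ?J"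
    if i: "i \<in> {..s}" for i
  proof -
    obtain x where x: "x \<in> ?T" "ord_ge (Suc s) (mvar LU ^ i * mvar LV ^ (s - i) - x)" using s i by auto
    obtain j where j: "j \<in> jacobian_ideal f" "ord_ge (Suc s) (local_eq p j - x)"
      using tjurina_ideal_approximation[OF f x(1)] by blast
    \<comment> \<open>The monomial and \<open>j\<close> both agree with \<open>x\<close> up to order
      s + 1, so their difference has order at least s + 1.\<close>
    have "local_eq p (?y i - j) = (mvar LU ^ i * mvar LV ^ (s - i) - x) - (local_eq p j - x)"
    proof -
      have "local_eq p (?y i) = mvar LU ^ i * mvar LV ^ (s - i)"
        by (simp only: local_eq_simps(2,6) local_eq_M)
      then show ?thesis by (simp only: local_eq_simps(4)) simp
    qed
    also have "ord_ge (Suc s) \<dots>" using x(2) j(2) by (simp add: ord_ge_def)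
    finally obtain c where c: "\<forall>k\<le>s. peval p (c k) = 0"
      "?y i - j - (\<Sum>k\<le>s. c k * ?y k) \<in> affine_ideal"
      using power_ideal_Suc[OF power_ideal_of_order] by blast
    have "1 * ?y i - (\<Sum>k\<le>s. c k * ?y k) = j + (?y i - j - (\<Sum>k\<le>s. c k * ?y k))" by simp
    also have "\<dots> \<in> ?J" using JJ[OF j(1)] affJ[OF c(2)] by (rule is_idealD(2)[OF J])
    finally have "1 * ?y i - (\<Sum>k\<le>s. c k * ?y k) \<in> ?J" .
    moreover have "\<forall>k\<in>{..s}. c k \<in> ?\<mm>" using c(1) by simp
    moreover have "1 - (1::hpoly) \<in> ?\<mm>" by simp
    ultimately show ?thesis by blast
  qed
  from nakayama[OF J m _ this] obtain e where e: "1 - e \<in> ?\<mm>" "\<And>i. i \<le> s \<Longrightarrow> e * ?y i \<in> ?J" by auto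
  have "peval p e = 1" using e(1) by (simp add: peval_simps)
  \<comment> \<open>Agreement up to order s is enough here, since \<open>e\<close> takes care of the
    s-th power.\<close>
  obtain j where j: "j \<in> jacobian_ideal f" "ord_ge s (local_eq p j - local_eq p h)"
    using tjurina_ideal_approximation[OF f hT] by blast
  have "ord_ge s (local_eq p (h - j))" using j(2) by (simp add: ord_ge_def local_eq_simps)
  then have "h - j \<in> power_ideal s" by (rule power_ideal_of_order)
  then obtain c where c: "h - j - (\<Sum>i\<le>s. c i * ?y i) \<in> affine_ideal" unfolding power_ideal_def by blast
  have "e * h = e * j + e * (h - j - (\<Sum>i\<le>s. c i * ?y i)) + (\<Sum>i\<le>s. c i * (e * ?y i))"
    by (simp only: right_diff_distrib sum_distrib_left mult.left_commute[of e]) simp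
  also have "\<dots> \<in> ?J"
    by (intro is_idealD(2)[OF J] is_idealD(3)[OF J] is_ideal_sum[OF J] JJ[OF j(1)] affJ[OF c] e(2)) simp
  finally obtain j' b where "e * h = j' + (pvar w - 1) * b" "j' \<in> jacobian_ideal f"
    unfolding affine_ideal_def by blast
  from homogeneous_multiplier[OF f(1) h this] obtain n e' b where
    e': "e' \<in> forms n" "e' - e = (pvar w - 1) * b" "e' * h \<in> jacobian_ideal f" by blast
  \<comment> \<open>Homogenising changes \<open>e\<close> by a multiple of \<open>w - 1\<close>,
    which vanishes at p.\<close>
  have "peval p e' - peval p e = peval p (pvar w - 1) * peval p b"
    using arg_cong[OF e'(2), of "peval p"] by (simp only: peval_simps)
  then have "peval p e' \<noteq> 0" using \<open>peval p e = 1\<close> by (simp only: peval_M) simp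
  then show ?thesis using e' by blast
qed

end

text \<open>The multipliers of \<open>h\<close> into the Jacobian ideal modulo \<open>w - 1\<close>
  form an ideal without common zero: \<open>w - 1\<close> confines the zeros to the affine chart, a
  local multiplier excludes each singular point, and at any other point \<open>f\<close> or a
  partial derivative is a nonvanishing multiplier. By the Nullstellensatz 1 is a multiplier.\<close>

lemma power_of_variable_multiplier:
  assumes f: "f \<in> forms d" "d > 0" and h: "h \<in> forms k"
    and loc: "\<And>p. p \<in> singular_points f \<Longrightarrow> local_eq p h \<in> tjurina_ideal (local_eq p f)"
    and fd: "\<And>p. p \<in> singular_points f \<Longrightarrow> \<exists>(m::nat) D. \<forall>g\<in>plane_ring.
      \<exists>c. g - (\<Sum>i<m. mscale (c i) (D i)) \<in> tjurina_ideal (local_eq p f)"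
  shows "\<exists>n. pvar w ^ n * h \<in> jacobian_ideal f"
proof -
  let ?Q = "{q. \<exists>j b. j \<in> jacobian_ideal f \<and> q * h = j + (pvar w - 1) * b}"
  have Q: "is_ideal ?Q"
    unfolding is_ideal_def
  proof (intro conjI ballI allI)
    show "0 \<in> ?Q" by (intro CollectI exI[of _ 0]) simp
  next
    fix x y assume "x \<in> ?Q" "y \<in> ?Q"
    then obtain j b j' b' where "x * h = j + (pvar w - 1) * b" "y * h = j' + (pvar w - 1) * b'"
      "j \<in> jacobian_ideal f" "j' \<in> jacobian_ideal f" by blast
    then show "x + y \<in> ?Q"
      by (intro CollectI exI[of _ "j + j'"] exI[of _ "b + b'"]) (auto simp: distrib_right distrib_left)
  next
    fix a x assume "x \<in> ?Q"
    then obtain j b where "x * h = j + (pvar w - 1) * b" "j \<in> jacobian_ideal f" by blast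
    moreover from this(1) have "(a * x) * h = a * j + (pvar w - 1) * (a * b)"
      by (simp only: mult.assoc distrib_left mult.left_commute)
    ultimately show "a * x \<in> ?Q" by blast
  qed
  have "1 \<in> ?Q"
  proof (rule ccontr)
    assume "1 \<notin> ?Q"
    from weak_nullstellensatz[OF Q this] obtain P where P': "\<forall>q\<in>?Q. peval P q = 0" by (elim exE)
    note P = bspec[OF P']
    have "pvar w - 1 \<in> ?Q" by (intro CollectI exI[of _ 0] exI[of _ h]) simp
    from P[OF this] have "P w = 1" unfolding peval_simps peval_pvar by simp
    then have "P w \<noteq> 0" by simp
    then obtain p c where p: "p \<in> proj_plane" "c \<noteq> 0" "\<And>y. P y = c * p y" using proj_plane_normalize by blast
    have "\<exists>n e. e \<in> forms n \<and> peval p e \<noteq> 0 \<and> e * h \<in> jacobian_ideal f"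
    proof (cases "p \<in> singular_points f")
      case True
      obtain a u v where chart: "plane_chart p a u v"
        by (rule proj_plane_chart[OF p(1)]) (rule that, rule plane_chart.intro)
      obtain m :: nat and D where mD: "\<forall>g\<in>plane_ring.
          \<exists>c. g - (\<Sum>i<m. mscale (c i) (D i)) \<in> tjurina_ideal (local_eq p f)"
        using fd[OF True] by (elim exE)
      show ?thesis
        by (rule plane_chart.local_multiplier[OF chart f h loc[OF True] bspec[OF mD]])
    next
      case False
      then have "peval p f \<noteq> 0 \<or> (\<exists>x. peval p (pdv x f) \<noteq> 0)"
        using p(1) by (simp add: singular_points_def)
      then obtain n e where "e \<in> forms n" "peval p e \<noteq> 0" "e \<in> jacobian_ideal f"
        using f(1) pdv_in_forms[OF f(1)] form_in_jacobian_ideal[OF f] pdv_in_jacobian_ideal by metis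
      moreover from this(3) have "e * h \<in> jacobian_ideal f"
        using jacobian_ideal_mult[of e f h] by (simp only: mult.commute)
      ultimately show ?thesis by blast
    qed
    then obtain n e where e: "e \<in> forms n" "peval p e \<noteq> 0" "e * h \<in> jacobian_ideal f" by blast
    then have "e \<in> ?Q" by (intro CollectI exI[of _ "e * h"] exI[of _ 0]) simp
    then have "peval P e = 0" by (rule P)
    then show False using peval_scale[OF e(1) p(3)] e(2) p(2) by simp
  qed
  then obtain j b where "1 * h = j + (pvar w - 1) * b" "j \<in> jacobian_ideal f" by blast
  \<comment> \<open>The homogenised multiplier is congruent to 1, hence to \<open>w ^ n\<close>,
    modulo \<open>w - 1\<close>; two congruent forms of degree n are equal.\<close>
  from homogeneous_multiplier[OF f(1) h this] obtain n e b where
    e: "e \<in> forms n" "e - 1 = (pvar w - 1) * b" "e * h \<in> jacobian_ideal f" by (elim exE conjE)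
  have "pvar w ^ n - (1 :: hpoly) = (pvar w - 1) * (\<Sum>i<n. pvar w ^ i)" by (rule power_diff_1_eq)
  then have "e - pvar w ^ n = (pvar w - 1) * (b - (\<Sum>i<n. pvar w ^ i))"
    using e(2) by (simp only: right_diff_distrib) (simp add: algebra_simps)
  moreover have "e - pvar w ^ n \<in> forms n"
    using forms_power[OF forms_pvar, of w n] e(1) by (intro forms_diff) simp_all
  ultimately have "e - pvar w ^ n = 0" by (rule form_not_multiple_of_affine[rotated])
  then show ?thesis using e(3) by auto
qed

theorem locally_in_tjurina_ideals_imp_saturated:
  assumes f: "f \<in> forms d" "d > 0" and h: "h \<in> forms k"
    and loc: "\<And>p. p \<in> singular_points f \<Longrightarrow> local_eq p h \<in> tjurina_ideal (local_eq p f)"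
    and fd: "\<And>p. p \<in> singular_points f \<Longrightarrow> \<exists>(m::nat) D. \<forall>g\<in>plane_ring.
      \<exists>c. g - (\<Sum>i<m. mscale (c i) (D i)) \<in> tjurina_ideal (local_eq p f)"
  shows "h \<in> saturated_jacobian_ideal f"
proof -
  obtain N where N: "\<And>w. pvar w ^ N w * h \<in> jacobian_ideal f"
    using power_of_variable_multiplier[OF assms] by metis
  \<comment> \<open>Pigeonhole: every monomial of this degree has exponent at least
    \<open>N y\<close> in some variable \<open>y\<close>.\<close>
  define k where "k = N X + N Y + N Z"
  have mono: "single m c * h \<in> jacobian_ideal f" if "mdeg m = k" for m c
  proof -
    have "\<exists>y. N y \<le> lookup m y"
    proof (rule ccontr)
      assume "\<not> ?thesis"
      then have "lookup m y < N y" for y by (simp add: not_le)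
      from this[of X] this[of Y] this[of Z] show False
        using that mdeg_eq_sum[OF _ keys_hvar, of m] by (simp add: k_def)
    qed
    then obtain y where y: "N y \<le> lookup m y" by blast
    have "m = (m - single y (N y)) + single y (N y)"
      using y by (intro poly_mapping_eqI) (auto simp: lookup_add lookup_minus lookup_single when_def)
    moreover have "pvar y ^ N y = single (single y (N y)) 1"
      using single_eq_monomial_value[of "single y (N y)" 1] by simp
    ultimately have "single m c = single (m - single y (N y)) c * pvar y ^ N y"
      by (metis mult_single mult.right_neutral)
    then have "single m c * h = single (m - single y (N y)) c * (pvar y ^ N y * h)"
      by (simp only: mult.assoc)
    then show ?thesis using N by (simp only: jacobian_ideal_mult)
  qed
  have "q * h \<in> jacobian_ideal f" if q: "q \<in> forms k" for q
  proof -
    have "q * h = (\<Sum>m\<in>keys q. single m (lookup q m) * h)"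
      by (subst (1) poly_mapping_eq_sum_singles[of q]) (simp only: sum_distrib_right)
    also have "\<dots> \<in> jacobian_ideal f" using q by (intro jacobian_ideal_sum mono) (simp add: forms_def)
    finally show ?thesis .
  qed
  then show ?thesis unfolding saturated_jacobian_ideal_def by blast
qed

section \<open>Tangent spaces of smooth germs\<close>

lemma dir_deriv_add: "dir_deriv n v (F + G) = dir_deriv n v F + dir_deriv n v G"
  by (simp add: dir_deriv_def algebra_simps sum.distrib)

lemma dir_deriv_diff: "dir_deriv n v (F - G) = dir_deriv n v F - dir_deriv n v G"
  by (simp add: dir_deriv_def algebra_simps sum_subtractf)

lemma dir_deriv_sum: "dir_deriv n v (sum F A) = (\<Sum>i\<in>A. dir_deriv n v (F i))"
  by (induction A rule: infinite_finite_induct) (simp_all add: dir_deriv_add, simp_all add: dir_deriv_def)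

lemma dir_deriv_mult: "dir_deriv n v (F * G) = coeff F 0 * dir_deriv n v G + dir_deriv n v F * coeff G 0"
  by (simp add: dir_deriv_def coeff_mult_linear[simplified] algebra_simps sum.distrib sum_distrib_left)

lemma dir_deriv_mvar:
  assumes "i < n"
  shows "dir_deriv n v (mvar (Par i)) = v i"
proof -
  have "single (Par k) 1 = single (Par i) (1::nat) \<longleftrightarrow> k = i" for k
    by (metis keys_single lvar.inject singleton_inject zero_neq_one)
  then have "dir_deriv n v (mvar (Par i)) = (\<Sum>k<n. if k = i then v i else 0)"
    unfolding dir_deriv_def coeff_mvar by (intro sum.cong) auto
  then show ?thesis using assms by simp
qed

text \<open>The map \<alpha> of \<open>smooth_germ\<close>. Its laws are known only on the
  convergent series in the parameters, hence the membership conditions throughout.\<close>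

locale germ_hom =
  fixes n k :: nat and \<alpha> :: "lvar mps \<Rightarrow> lvar mps"
  assumes surj: "\<alpha> ` param_ring n = param_ring k"
    and hom: "F \<in> param_ring n \<Longrightarrow> G \<in> param_ring n \<Longrightarrow> \<alpha> (F + G) = \<alpha> F + \<alpha> G"
      "F \<in> param_ring n \<Longrightarrow> G \<in> param_ring n \<Longrightarrow> \<alpha> (F * G) = \<alpha> F * \<alpha> G"
    and const: "\<alpha> (mconst c) = mconst c"
begin

lemma image: "F \<in> param_ring n \<Longrightarrow> \<alpha> F \<in> param_ring k"
  using surj by blast

lemma hom_0: "\<alpha> 0 = 0" and hom_1: "\<alpha> 1 = 1"
  using const[of 0] const[of 1] by simp_all

lemma hom_sum: "(\<And>i. i \<in> A \<Longrightarrow> F i \<in> param_ring n) \<Longrightarrow> \<alpha> (sum F A) = (\<Sum>i\<in>A. \<alpha> (F i))"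
proof (induction A rule: infinite_finite_induct)
  case (insert i A)
  then have "\<alpha> (F i + sum F A) = \<alpha> (F i) + \<alpha> (sum F A)" by (intro hom germs_sum) auto
  then show ?case using insert by simp
qed (simp_all add: hom_0)

lemma hom_diff:
  assumes "F \<in> param_ring n" "G \<in> param_ring n"
  shows "\<alpha> (F - G) = \<alpha> F - \<alpha> G"
proof -
  have "\<alpha> (F + mconst (- 1) * G) = \<alpha> F + mconst (- 1) * \<alpha> G"
    using assms by (simp only: hom germs_mult mconst_in_germs const)
  then show ?thesis by (simp add: mconst_uminus)
qed

text \<open>Locality is automatic: otherwise subtracting the constant term of
  \<open>\<alpha> F\<close> from \<open>F\<close> would leave a unit whose image is not a
  unit.\<close>

lemma constant_term:
  assumes F: "F \<in> param_ring n"
  shows "coeff (\<alpha> F) 0 = coeff F 0"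
proof (rule ccontr)
  let ?c = "coeff (\<alpha> F) 0"
  let ?G = "F - mconst ?c"
  assume "?c \<noteq> coeff F 0"
  then have "coeff ?G 0 \<noteq> 0" by (simp add: coeff_mconst)
  moreover have G: "?G \<in> param_ring n" using F by auto
  ultimately obtain H where H: "H \<in> param_ring n" "?G * H = 1" using germs_inverse by blast
  have "\<alpha> ?G * \<alpha> H = 1" using hom(2)[OF G H(1)] H(2) by (simp add: hom_1)
  then have "coeff (\<alpha> ?G) 0 * coeff (\<alpha> H) 0 = 1" by (metis coeff_mult_0 coeff_one)
  moreover have "\<alpha> ?G = \<alpha> F - mconst ?c" using hom_diff[OF F] const by simp
  ultimately show False by (simp add: coeff_mconst)
qed

lemma parameter_lifts:
  obtains A where "\<And>j. j < k \<Longrightarrow> A j \<in> param_ring n" "\<And>j. j < k \<Longrightarrow> \<alpha> (A j) = mvar (Par j)"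
    "\<And>j. j < k \<Longrightarrow> coeff (A j) 0 = 0"
proof -
  have "\<exists>F. F \<in> param_ring n \<and> \<alpha> F = mvar (Par j)" if "j < k" for j
  proof -
    have "mvar (Par j) \<in> param_ring k" using that by auto
    then show ?thesis using surj by (metis imageE)
  qed
  then obtain A where A: "\<And>j. j < k \<Longrightarrow> A j \<in> param_ring n \<and> \<alpha> (A j) = mvar (Par j)" by metis
  moreover have "coeff (A j) 0 = 0" if "j < k" for j
    using constant_term[of "A j"] A[OF that] by (simp add: coeff_mvar)
  ultimately show thesis using that by blast
qed

lemma param_decomposition:
  assumes F: "F \<in> param_ring n'" and F0: "coeff F 0 = 0"
  obtains B where "\<And>i. B i \<in> param_ring n'" "F = (\<Sum>i<n'. mvar (Par i) * B i)"
proof -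
  obtain B where B: "\<forall>x. B x \<in> param_ring n'" "F = (\<Sum>x\<in>Par ` {..<n'}. mvar x * B x)"
    using germs_divide_by_variables[OF F F0] by auto
  have "F = (\<Sum>i<n'. mvar (Par i) * B (Par i))"
    unfolding B(2) by (subst sum.reindex) (auto simp: inj_on_def)
  then show thesis using B(1) by (intro that[of "\<lambda>i. B (Par i)"]) auto
qed

text \<open>The lifts of the k coordinates generate the maximal ideal modulo the kernel. A vector
  that annihilates the kernel and these lifts therefore annihilates every parameter; so the tangent
  space has dimension at most k.\<close>

lemma tangent_space_coordinates:
  "\<exists>A. \<forall>v. (\<forall>F\<in>param_ring n. \<alpha> F = 0 \<longrightarrow> dir_deriv n v F = 0) \<longrightarrow>
    (\<forall>j<k. dir_deriv n v (A j) = 0) \<longrightarrow> (\<forall>i<n. v i = 0)"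
proof -
  obtain A where A: "\<And>j. j < k \<Longrightarrow> A j \<in> param_ring n" "\<And>j. j < k \<Longrightarrow> \<alpha> (A j) = mvar (Par j)"
    "\<And>j. j < k \<Longrightarrow> coeff (A j) 0 = 0" using parameter_lifts by metis
  have "v i = 0" if v: "\<forall>F\<in>param_ring n. \<alpha> F = 0 \<longrightarrow> dir_deriv n v F = 0"
    "\<forall>j<k. dir_deriv n v (A j) = 0" and i: "i < n" for v i
  proof -
    have ti: "mvar (Par i) \<in> param_ring n" using i by auto
    have "coeff (\<alpha> (mvar (Par i))) 0 = 0" using constant_term[OF ti] by (simp add: coeff_mvar)
    then obtain B where B: "\<And>j. B j \<in> param_ring k" "\<alpha> (mvar (Par i)) = (\<Sum>j<k. mvar (Par j) * B j)"
      using param_decomposition[OF image[OF ti]] by metis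
    have "\<forall>j. \<exists>F. F \<in> param_ring n \<and> \<alpha> F = B j" using B(1) surj by (metis imageE)
    then obtain C where C: "\<And>j. C j \<in> param_ring n" "\<And>j. \<alpha> (C j) = B j" by metis
    have AC: "(\<Sum>j<k. A j * C j) \<in> param_ring n" using A(1) C(1) by auto
    have "\<alpha> (\<Sum>j<k. A j * C j) = (\<Sum>j<k. \<alpha> (A j * C j))"
      using A(1) C(1) by (intro hom_sum) auto
    also have "\<dots> = \<alpha> (mvar (Par i))"
      unfolding B(2) by (rule sum.cong) (use A C in \<open>auto simp: hom\<close>)
    finally have "\<alpha> (mvar (Par i) - (\<Sum>j<k. A j * C j)) = 0"
      using hom_diff[OF ti AC] by simp
    moreover have "mvar (Par i) - (\<Sum>j<k. A j * C j) \<in> param_ring n" using ti AC by (rule germs_diff)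
    ultimately have "dir_deriv n v (mvar (Par i) - (\<Sum>j<k. A j * C j)) = 0" using v(1) by simp
    moreover have "dir_deriv n v (\<Sum>j<k. A j * C j) = 0"
      unfolding dir_deriv_sum dir_deriv_mult using A(3) v(2) by simp
    ultimately show "v i = 0" by (simp add: dir_deriv_diff dir_deriv_mvar[OF i])
  qed
  then show ?thesis by blast
qed

text \<open>In equal dimensions the induced surjection of cotangent spaces is bijective. In
  coordinates: the linear parts of \<open>F\<close> and of the k lifts are k + 1 vectors of length
  k, hence dependent; \<alpha> turns the relation into one between the coordinates, so the lifts
  have coefficient 0 and only \<open>F\<close> remains.\<close>

lemma kernel_linear_part_zero:
  assumes nk: "n = k" and F: "F \<in> param_ring n" "\<alpha> F = 0"
  shows "dir_deriv n v F = 0"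
proof -
  let ?e = "\<lambda>i. single (Par i) (1::nat)"
  obtain A where A: "\<And>j. j < k \<Longrightarrow> A j \<in> param_ring n" "\<And>j. j < k \<Longrightarrow> \<alpha> (A j) = mvar (Par j)"
    "\<And>j. j < k \<Longrightarrow> coeff (A j) 0 = 0" using parameter_lifts by metis
  \<comment> \<open>The matrix of \<alpha> on linear parts.\<close>
  define l where "l j i = coeff (\<alpha> (mvar (Par i))) (?e j)" for j i
  have lin: "coeff (\<alpha> H) (?e j) = (\<Sum>i<n. l j i * coeff H (?e i))"
    if H: "H \<in> param_ring n" "coeff H 0 = 0" for H j
  proof -
    obtain B where B: "\<And>i. B i \<in> param_ring n" "H = (\<Sum>i<n. mvar (Par i) * B i)"
      using param_decomposition[OF H] by metis
    have t: "mvar (Par i) \<in> param_ring n" if "i < n" for i using that by auto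
    have "\<alpha> H = (\<Sum>i<n. \<alpha> (mvar (Par i)) * \<alpha> (B i))"
      unfolding B(2) using t B(1) by (subst hom_sum) (auto simp: hom)
    then have "coeff (\<alpha> H) (?e j) = (\<Sum>i<n. l j i * coeff (B i) 0)"
      using t B(1) by (simp add: coeff_mult_linear[simplified] l_def constant_term coeff_mvar)
    moreover have "coeff H (?e i) = coeff (B i) 0" if i: "i < n" for i
    proof -
      have e: "?e i = ?e i' \<longleftrightarrow> i = i'" for i'
        by (metis keys_single lvar.inject singleton_inject zero_neq_one)
      have "coeff H (?e i) = (\<Sum>i'<n. if i' = i then coeff (B i) 0 else 0)"
        unfolding B(2) coeff_sum coeff_mult_linear coeff_mvar e by (rule sum.cong) auto
      then show ?thesis using i by simp
    qed
    ultimately show ?thesis by simp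
  qed
  have F0: "coeff F 0 = 0" using constant_term[OF F(1)] F(2) by simp
  define M where "M i r = (case r of None \<Rightarrow> coeff F (?e i) | Some j \<Rightarrow> coeff (A j) (?e i))" for i r
  let ?K = "insert None (Some ` {..<k})"
  have "card ?K = Suc k" by (subst card_insert_disjoint) (auto simp: card_image)
  then obtain c where c: "\<exists>r\<in>?K. c r \<noteq> 0" "\<forall>i\<in>{..<n}. (\<Sum>r\<in>?K. M i r * c r) = 0"
    using homogeneous_system_nontrivial_solution[of "{..<n}" ?K M] nk by auto
  have rel: "coeff F (?e i) * c None + (\<Sum>j<k. coeff (A j) (?e i) * c (Some j)) = 0" if "i < n" for i
  proof -
    have "(\<Sum>r\<in>?K. M i r * c r) = 0" using c(2) that by blast
    moreover have "(\<Sum>r\<in>?K. M i r * c r) = M i None * c None + (\<Sum>j<k. M i (Some j) * c (Some j))"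
      by (subst sum.insert) (auto simp: sum.reindex)
    ultimately show ?thesis by (simp add: M_def)
  qed
  have "c (Some j) = 0" if j: "j < k" for j
  proof -
    have "0 = (\<Sum>i<n. l j i * (coeff F (?e i) * c None + (\<Sum>j<k. coeff (A j) (?e i) * c (Some j))))"
      using rel by simp
    also have "\<dots> = (\<Sum>i<n. l j i * coeff F (?e i)) * c None
        + (\<Sum>i<n. \<Sum>j'<k. l j i * coeff (A j') (?e i) * c (Some j'))"
      by (simp add: distrib_left sum.distrib sum_distrib_right sum_distrib_left mult.assoc)
    also have "(\<Sum>i<n. \<Sum>j'<k. l j i * coeff (A j') (?e i) * c (Some j'))
        = (\<Sum>j'<k. (\<Sum>i<n. l j i * coeff (A j') (?e i)) * c (Some j'))"
      by (subst sum.swap) (simp add: sum_distrib_right)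
    also have "(\<Sum>i<n. l j i * coeff F (?e i)) = 0" using lin[OF F(1) F0, of j] F(2) by simp
    also have "(\<Sum>j'<k. (\<Sum>i<n. l j i * coeff (A j') (?e i)) * c (Some j'))
        = (\<Sum>j'<k. if j' = j then c (Some j) else 0)"
    proof (rule sum.cong)
      fix j' assume "j' \<in> {..<k}"
      then have j': "j' < k" by simp
      have "?e j = ?e j' \<longleftrightarrow> j' = j"
        by (metis keys_single lvar.inject singleton_inject zero_neq_one)
      then have "(\<Sum>i<n. l j i * coeff (A j') (?e i)) = (if j' = j then 1 else 0)"
        unfolding lin[OF A(1)[OF j'] A(3)[OF j'], symmetric] A(2)[OF j'] coeff_mvar by simp
      then show "(\<Sum>i<n. l j i * coeff (A j') (?e i)) * c (Some j') = (if j' = j then c (Some j) else 0)"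
        by simp
    qed simp
    finally show ?thesis using j by simp
  qed
  then have "coeff F (?e i) * c None = 0" if "i < n" for i using rel[OF that] by simp
  moreover have "c None \<noteq> 0" using c(1) \<open>\<And>j. j < k \<Longrightarrow> c (Some j) = 0\<close> by auto
  ultimately have "coeff F (?e i) = 0" if "i < n" for i using that by auto
  then show ?thesis by (simp add: dir_deriv_def)
qed

end

section \<open>The count of forms of degree d + 1\<close>

definition binary_index :: "nat \<Rightarrow> nat \<Rightarrow> (hvar \<Rightarrow>\<^sub>0 nat)" where
  "binary_index n i = single X i + single Y (n - i)"

lemma lookup_binary_index:
  "lookup (binary_index n i) x = (case x of X \<Rightarrow> i | Y \<Rightarrow> n - i | Z \<Rightarrow> 0)"
  by (cases x) (auto simp: binary_index_def lookup_add lookup_single)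

lemma binary_monomial: "pvar X ^ i * pvar Y ^ (n - i) = single (binary_index n i) 1"
  using single_eq_monomial_value[of "binary_index n i" 1]
  by (simp add: binary_index_def monomial_value_add)

lemma mdeg_hvar: "mdeg m = lookup m X + lookup m Y + lookup m Z"
  using mdeg_eq_sum[OF _ keys_hvar, of m] by simp

text \<open>Model for the forms on a line that is parametrised by \<open>X\<close> and
  \<open>Y\<close>.\<close>

definition binary_forms :: "nat \<Rightarrow> hpoly set" where
  "binary_forms n = {q \<in> forms n. \<forall>m\<in>keys q. lookup m Z = 0}"

lemma binary_forms_mult: "p \<in> binary_forms n \<Longrightarrow> q \<in> binary_forms k \<Longrightarrow> p * q \<in> binary_forms (n + k)"
  using keys_mult[of p q] by (fastforce simp: binary_forms_def lookup_add intro: forms_mult)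

lemma binary_forms_add: "p \<in> binary_forms n \<Longrightarrow> q \<in> binary_forms n \<Longrightarrow> p + q \<in> binary_forms n"
  using Poly_Mapping.keys_add[of p q] by (fastforce simp: binary_forms_def)

lemma binary_forms_0: "0 \<in> binary_forms n"
  by (simp add: binary_forms_def)

lemma binary_forms_pconst: "pconst c \<in> binary_forms 0"
  by (auto simp: binary_forms_def)

lemma binary_forms_pvar: "x \<noteq> Z \<Longrightarrow> pvar x \<in> binary_forms 1"
  using forms_pvar[of x] by (auto simp: binary_forms_def lookup_single when_def simp del: One_nat_def)

lemma binary_form_expansion:
  assumes q: "q \<in> binary_forms n"
  shows "q = (\<Sum>i\<le>n. pconst (lookup q (binary_index n i)) * (pvar X ^ i * pvar Y ^ (n - i)))"
proof (rule poly_mapping_eqI)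
  fix m
  have "lookup (\<Sum>i\<le>n. pconst (lookup q (binary_index n i)) * (pvar X ^ i * pvar Y ^ (n - i))) m
      = (\<Sum>i\<le>n. if binary_index n i = m then lookup q m else 0)"
    unfolding binary_monomial by (simp add: lookup_sum lookup_single when_def if_distrib cong: if_cong)
  also have "\<dots> = lookup q m"
  proof (cases "m \<in> keys q")
    case True
    then have "mdeg m = n" "lookup m Z = 0" using q by (auto simp: binary_forms_def forms_def)
    then have m: "binary_index n i = m \<longleftrightarrow> i = lookup m X" for i
      using lookup_binary_index[of n i]
      by (auto simp: mdeg_hvar poly_mapping_eq_iff fun_eq_iff split: hvar.splits)
    have "lookup m X \<le> n" using \<open>mdeg m = n\<close> lookup_le_mdeg[of m X] by simp
    then show ?thesis unfolding m by simp
  next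
    case False
    then have "lookup q m = 0" by (simp add: in_keys_iff)
    then show ?thesis by (simp cong: if_cong)
  qed
  finally show "lookup q m = lookup
      (\<Sum>i\<le>n. pconst (lookup q (binary_index n i)) * (pvar X ^ i * pvar Y ^ (n - i))) m" ..
qed

text \<open>A one-parameter family of lines suffices: for general \<open>a\<close> the line avoids a given finite set.\<close>

definition line :: "complex \<Rightarrow> hpoly" where
  "line a = pvar Z + pconst a * pvar X + pconst (a\<^sup>2) * pvar Y"

text \<open>The equation of the line solved for \<open>Z\<close>; restriction to the line is then a
  substitution that fixes binary forms.\<close>

definition line_param :: "complex \<Rightarrow> hvar \<Rightarrow> hpoly" where
  "line_param a = case_hvar (pvar X) (pvar Y) (pconst (- a) * pvar X + pconst (- (a\<^sup>2)) * pvar Y)"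

definition restrict_line :: "complex \<Rightarrow> hpoly \<Rightarrow> hpoly" where
  "restrict_line a = poly_eval pconst (line_param a)"

lemmas restrict_line_simps = pconst_hom.poly_eval_simps[where \<sigma> = "line_param a" and 'b = hvar for a,
    folded restrict_line_def]

lemma restrict_line_pvar: "restrict_line a (pvar x) = line_param a x"
  unfolding restrict_line_def by (rule pconst_hom.poly_eval_pvar)

lemma restrict_line_pconst: "restrict_line a (pconst c) = pconst c"
  unfolding restrict_line_def by (rule pconst_hom.poly_eval_pconst)

lemma restrict_line_line: "restrict_line a (line a) = 0"
  unfolding line_def restrict_line_simps restrict_line_pvar restrict_line_pconst line_param_def
  by (simp add: single_uminus)

lemma restrict_line_binary:
  "restrict_line a (pvar X ^ i * pvar Y ^ j) = pvar X ^ i * pvar Y ^ j"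
  unfolding restrict_line_simps restrict_line_pvar line_param_def by simp

lemma line_in_forms: "line a \<in> forms 1"
  unfolding line_def
  using forms_mult[OF forms_pconst forms_pvar, of a X] forms_mult[OF forms_pconst forms_pvar, of "a\<^sup>2" Y]
  by (intro forms_add forms_pvar) (simp_all del: One_nat_def)

lemma restrict_line_in_binary_forms:
  assumes "q \<in> forms n"
  shows "restrict_line a q \<in> binary_forms n"
proof -
  have var: "line_param a x \<in> binary_forms 1" for x
    using binary_forms_mult[OF binary_forms_pconst binary_forms_pvar, of X "- a"]
      binary_forms_mult[OF binary_forms_pconst binary_forms_pvar, of Y "- (a\<^sup>2)"] binary_forms_pvar
    by (cases x) (auto simp: line_param_def intro!: binary_forms_add)
  have mono: "monomial_value (line_param a) m \<in> binary_forms (mdeg m)" for m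
  proof (induction m rule: monomial_induct)
    case zero
    then show ?case using binary_forms_pconst[of 1] by simp
  next
    case (add m x)
    then show ?case using binary_forms_mult[OF add var[of x]] by (simp add: monomial_value_add)
  qed
  have summand: "pconst c * monomial_value (line_param a) m \<in> binary_forms n" if "mdeg m = n" for m c
    using binary_forms_mult[OF binary_forms_pconst mono, of c m] that by simp
  have "(\<Sum>m\<in>A. pconst (lookup q m) * monomial_value (line_param a) m) \<in> binary_forms n"
    if "A \<subseteq> keys q" for A
    using that
  proof (induction A rule: infinite_finite_induct)
    case (insert m A)
    then show ?case using summand[of m] assms by (auto simp: forms_def intro!: binary_forms_add)
  qed (simp_all add: binary_forms_0)
  then show ?thesis unfolding restrict_line_def poly_eval_def by blast
qed

text \<open>The value at a point is a polynomial in \<open>a\<close> whose coefficients are the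
  coordinates of the point, so each point excludes only finitely many \<open>a\<close>.\<close>

lemma general_line_exists:
  assumes "finite S" "S \<subseteq> proj_plane"
  shows "\<exists>a. \<forall>p\<in>S. peval p (line a) \<noteq> 0"
proof -
  have ev: "peval p (line a) = poly [:p Z, p X, p Y:] a" for p a
    unfolding line_def peval_simps peval_pvar peval_pconst by (simp add: power2_eq_square algebra_simps)
  have "finite {a. poly [:p Z, p X, p Y:] a = 0}" if "p \<in> S" for p
    using that assms(2) by (intro poly_roots_finite) (auto simp: proj_plane_def)
  then have "finite (\<Union>p\<in>S. {a. peval p (line a) = 0})" using assms(1) by (auto simp: ev)
  then obtain a where "a \<notin> (\<Union>p\<in>S. {a. peval p (line a) = 0})"
    using ex_new_if_finite[OF infinite_UNIV_char_0] by blast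
  then show ?thesis by blast
qed

section \<open>The saturation and complements of the Jacobian ideal in a fixed degree\<close>

text \<open>Different elements of the saturation come with different exponents; raising these to a
  common one makes sums possible.\<close>

lemma saturated_jacobian_ideal_mono:
  assumes "\<forall>q\<in>forms k. q * h \<in> jacobian_ideal f" "k \<le> n"
  shows "\<forall>q\<in>forms n. q * h \<in> jacobian_ideal f"
  using assms(2)
proof (induction n rule: dec_induct)
  case base
  then show ?case using assms(1) .
next
  case (step n)
  have mono: "single m c * h \<in> jacobian_ideal f" if m: "mdeg m = Suc n" for m c
  proof -
    have "keys m \<noteq> {}" using m by (auto simp: mdeg_def)
    then obtain x where x: "x \<in> keys m" by blast
    have "mdeg (m - single x 1) = n" using mdeg_minus_single[OF x] m by simp
    then have "single (m - single x 1) c * h \<in> jacobian_ideal f"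
      using step(3) by (simp add: forms_single)
    then have "pvar x * (single (m - single x 1) c * h) \<in> jacobian_ideal f"
      by (rule jacobian_ideal_mult)
    moreover have "pvar x * single (m - single x 1) c = single m c"
      using monomial_split[OF x] by (simp add: mult_single add.commute)
    ultimately show ?thesis by (simp add: mult.assoc[symmetric])
  qed
  show ?case
  proof
    fix q assume q: "q \<in> forms (Suc n)"
    have "q * h = (\<Sum>m\<in>keys q. single m (lookup q m) * h)"
      by (subst (1) poly_mapping_eq_sum_singles[of q]) (simp only: sum_distrib_right)
    also have "\<dots> \<in> jacobian_ideal f" using q by (intro jacobian_ideal_sum mono) (simp add: forms_def)
    finally show "q * h \<in> jacobian_ideal f" .
  qed
qed

lemma jacobian_subset_saturated: "jacobian_ideal f \<subseteq> saturated_jacobian_ideal f"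
  unfolding saturated_jacobian_ideal_def by auto

lemma saturated_jacobian_ideal_add:
  assumes "g \<in> saturated_jacobian_ideal f" "h \<in> saturated_jacobian_ideal f"
  shows "g + h \<in> saturated_jacobian_ideal f"
proof -
  obtain k l where "\<forall>q\<in>forms k. q * g \<in> jacobian_ideal f" "\<forall>q\<in>forms l. q * h \<in> jacobian_ideal f"
    using assms by (auto simp: saturated_jacobian_ideal_def)
  then have "\<forall>q\<in>forms (max k l). q * g \<in> jacobian_ideal f" "\<forall>q\<in>forms (max k l). q * h \<in> jacobian_ideal f"
    using saturated_jacobian_ideal_mono by (metis max.cobounded1, metis max.cobounded2)
  then have "\<forall>q\<in>forms (max k l). q * (g + h) \<in> jacobian_ideal f"
    by (auto simp: distrib_left)
  then show ?thesis unfolding saturated_jacobian_ideal_def by blast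
qed

lemma saturated_jacobian_ideal_pscale:
  assumes "h \<in> saturated_jacobian_ideal f"
  shows "pscale c h \<in> saturated_jacobian_ideal f"
proof -
  obtain k where k: "\<forall>q\<in>forms k. q * h \<in> jacobian_ideal f"
    using assms by (auto simp: saturated_jacobian_ideal_def)
  have "q * pscale c h \<in> jacobian_ideal f" if "q \<in> forms k" for q
    using jacobian_ideal_mult[of "q * h" f "pconst c"] k that by (simp add: pscale_def mult.left_commute)
  then show ?thesis unfolding saturated_jacobian_ideal_def by blast
qed

text \<open>Finitely many monomials span the forms of degree \<open>j\<close>, so the dimension is
  realised by an actual basis of a complement.\<close>

lemma jacobian_module_complement:
  obtains B where "is_complement pscale (saturated_jacobian_ideal f \<inter> forms j) (jacobian_ideal f \<inter> forms j) B"
    "card B = jacobian_module_dim f j"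
proof -
  interpret vector_space pscale by (rule vector_space_pscale)
  let ?S = "(\<lambda>m. single m 1) ` {m :: hvar \<Rightarrow>\<^sub>0 nat. keys m \<subseteq> {X, Y, Z} \<and> mdeg m \<le> j}"
  have V: "subspace (saturated_jacobian_ideal f \<inter> forms j)"
    using jacobian_subset_saturated
    by (auto simp: subspace_def intro: saturated_jacobian_ideal_add saturated_jacobian_ideal_pscale)
  have W: "subspace (jacobian_ideal f \<inter> forms j)" by (auto simp: subspace_def)
  have S: "finite ?S" using finite_monomials_le[of "{X, Y, Z}"] by auto
  have "forms j \<subseteq> span ?S"
  proof
    fix q assume q: "q \<in> forms j"
    have "q = (\<Sum>m\<in>keys q. pscale (lookup q m) (single m 1))"
      by (subst (1) poly_mapping_eq_sum_singles[of q]) (simp add: pscale_def mult_single)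
    also have "\<dots> \<in> span ?S"
      using q keys_hvar by (intro span_sum span_scale span_base) (auto simp: forms_def)
    finally show "q \<in> span ?S" .
  qed
  then have sub: "saturated_jacobian_ideal f \<inter> forms j \<subseteq> span ?S" by blast
  have "jacobian_ideal f \<inter> forms j \<subseteq> saturated_jacobian_ideal f \<inter> forms j"
    using jacobian_subset_saturated by blast
  then obtain B where "is_complement pscale (saturated_jacobian_ideal f \<inter> forms j) (jacobian_ideal f \<inter> forms j) B"
    "card B = quot_dim pscale (saturated_jacobian_ideal f \<inter> forms j) (jacobian_ideal f \<inter> forms j)"
    by (rule quot_dim_complement[OF vector_space_pscale V W _ S sub])
  then show thesis by (intro that) (simp_all add: jacobian_module_dim_def)
qed

text \<open>The 9 dimensions come from the products of the three binary quadratic monomials with the three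
  partial derivatives.\<close>

lemma degree_bound_of_generation:
  assumes f: "f \<in> forms d" "d > 0"
    and gen: "\<And>q. q \<in> forms (Suc d) \<Longrightarrow> \<exists>g. q - line a * g \<in> saturated_jacobian_ideal f \<inter> forms (Suc d)"
  shows "d \<le> 7 + jacobian_module_dim f (Suc d)"
proof (rule ccontr)
  interpret vector_space pscale by (rule vector_space_pscale)
  let ?V = "saturated_jacobian_ideal f \<inter> forms (Suc d)" and ?W = "jacobian_ideal f \<inter> forms (Suc d)"
  assume lt: "\<not> d \<le> 7 + jacobian_module_dim f (Suc d)"
  obtain B where B: "is_complement pscale ?V ?W B" "card B = jacobian_module_dim f (Suc d)"
    by (rule jacobian_module_complement)
  have finB: "finite B" using B(1) by (simp add: is_complement_def)
  \<comment> \<open>Indices of the generators: the nine products with partial derivatives, and the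
    complement \<open>B\<close>.\<close>
  let ?R = "({..2::nat} \<times> {X, Y, Z}) <+> B"
  define G where "G r = (case r of Inl (i, y) \<Rightarrow> pvar X ^ i * pvar Y ^ (2 - i) * pdv y f | Inr b \<Rightarrow> b)"
    for r :: "(nat \<times> hvar) + hpoly"
  let ?e = "binary_index (Suc d)"
  have "card ?R = 9 + card B" using finB by (simp add: card_Plus card_cartesian_product)
  then have "card ?R < card {..Suc d}" using lt B(2) by simp
  moreover have "finite ?R" using finB by simp
  \<comment> \<open>There are d + 2 binary monomials, more than generators; so some nonzero
    functional on the binary forms of degree d + 1 kills all generators.\<close>
  ultimately obtain c where c: "\<exists>j\<in>{..Suc d}. c j \<noteq> 0"
    "\<forall>r\<in>?R. (\<Sum>j\<in>{..Suc d}. lookup (restrict_line a (G r)) (?e j) * c j) = 0"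
    using homogeneous_system_nontrivial_solution[of ?R "{..Suc d}"
        "\<lambda>r j. lookup (restrict_line a (G r)) (?e j)"] by auto
  define L where "L q = (\<Sum>j\<le>Suc d. lookup (restrict_line a q) (?e j) * c j)" for q
  have L_add: "L (p + q) = L p + L q" for p q
    by (simp add: L_def restrict_line_simps lookup_add distrib_right sum.distrib)
  have L_scale: "L (pconst s * q) = s * L q" for s q
    by (simp add: L_def restrict_line_simps restrict_line_pconst sum_distrib_left mult.assoc del: sum.atMost_Suc)
  have L_sum: "L (sum F A) = (\<Sum>i\<in>A. L (F i))" for F :: "'i \<Rightarrow> hpoly" and A
    by (induction A rule: infinite_finite_induct)
      (simp_all add: L_add, simp_all add: L_def restrict_line_def)
  have LG: "L (G r) = 0" if "r \<in> ?R" for r using c(2) that by (simp add: L_def)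
  \<comment> \<open>\<open>L\<close> sees only the restriction to the line, so the quadratic
    coefficient may be replaced by its restriction and expanded into binary monomials.\<close>
  have LJ: "L (b * pdv y f) = 0" if b: "b \<in> forms 2" for b y
  proof -
    let ?b = "restrict_line a b"
    have "restrict_line a (b * pdv y f) = restrict_line a (?b * pdv y f)"
    proof -
      have "restrict_line a ?b = ?b"
        by (subst (1 2) binary_form_expansion[OF restrict_line_in_binary_forms[OF b]])
          (simp only: restrict_line_simps(3) restrict_line_simps(2)[of a "pconst _"] restrict_line_pconst restrict_line_binary)
      then show ?thesis by (simp only: restrict_line_simps(2))
    qed
    then have "L (b * pdv y f) = L (?b * pdv y f)" by (simp add: L_def)
    also have "?b * pdv y f = (\<Sum>i\<le>2. pconst (lookup ?b (binary_index 2 i)) *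
        (pvar X ^ i * pvar Y ^ (2 - i) * pdv y f))"
      by (subst (1) binary_form_expansion[OF restrict_line_in_binary_forms[OF b]])
        (simp only: sum_distrib_right mult.assoc)
    also have "L \<dots> = (\<Sum>i\<le>2. lookup ?b (binary_index 2 i) * L (G (Inl (i, y))))"
      unfolding L_sum L_scale by (simp add: G_def)
    also have "\<dots> = 0"
      by (intro sum.neutral ballI) (use UNIV_hvar in \<open>auto intro!: LG\<close>)
    finally show ?thesis .
  qed
  have LV: "L q = 0" if q: "q \<in> ?V" for q
  proof -
    obtain b w where bw: "q = b + w" "b \<in> span B" "w \<in> ?W"
      using B(1) q unfolding is_complement_def by blast
    obtain u where "b = (\<Sum>x\<in>B. pscale (u x) x)" using bw(2) span_finite[OF finB] by auto
    then have "L b = (\<Sum>x\<in>B. u x * L (G (Inr x)))" by (simp add: L_sum pscale_def L_scale G_def)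
    also have "\<dots> = 0" by (intro sum.neutral ballI) (auto intro!: LG)
    finally have "L b = 0" .
    have w: "w \<in> jacobian_ideal f" "hcomp (Suc d) w = w" using bw(3) by (auto simp: hcomp_forms)
    \<comment> \<open>Coefficients of the partial derivatives in degree d + 1 are quadratic;
      \<open>d > 0\<close> makes the truncated subtraction exact.\<close>
    have "Suc d - (d - 1) = 2" "d - 1 \<le> Suc d" using f(2) by auto
    with jacobian_ideal_form_coefficients[OF f(1) w(1), of "Suc d"] w(2) obtain x y z where
      "x \<in> forms 2" "y \<in> forms 2" "z \<in> forms 2" "w = x * pdv X f + y * pdv Y f + z * pdv Z f" by metis
    then have "L w = 0" by (simp add: L_add LJ)
    with \<open>L b = 0\<close> show ?thesis by (simp add: bw(1) L_add)
  qed
  \<comment> \<open>Modulo the line every binary monomial lies in \<open>?V\<close>, so the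
    functional kills all of them and is 0.\<close>
  have "c j = 0" if j: "j \<le> Suc d" for j
  proof -
    let ?q = "pvar X ^ j * pvar Y ^ (Suc d - j) :: hpoly"
    have "?q \<in> forms (Suc d)"
      unfolding binary_monomial using j by (intro forms_single) (simp add: binary_index_def)
    then obtain g where "?q - line a * g \<in> ?V" using gen by blast
    then have "L (?q - line a * g) = 0" by (rule LV)
    moreover have "L (line a * g) = 0" by (simp add: L_def restrict_line_simps restrict_line_line)
    ultimately have "L ?q = 0" using L_add[of "?q - line a * g" "line a * g"] by simp
    moreover have "lookup (restrict_line a ?q) (?e i) * c i = (if i = j then c j else 0)" for i
    proof -
      have "?e j = ?e i \<longleftrightarrow> j = i"
        using lookup_binary_index[of "Suc d" i X] lookup_binary_index[of "Suc d" j X] by auto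
      then show ?thesis
        unfolding restrict_line_binary unfolding binary_monomial by (auto simp: lookup_single when_def)
    qed
    then have "L ?q = c j" using j by (simp add: L_def del: sum.atMost_Suc)
    ultimately show ?thesis by simp
  qed
  with c(1) show False by auto
qed

section \<open>The equianalytic stratum\<close>

text \<open>The universal family is affine linear in the parameters.\<close>

lemma tangent_deriv_universal_family:
  "tangent_deriv (curve_space_dim d) v (universal_family d f h p) =
     local_eq p (\<Sum>i<curve_space_dim d. pscale (v i) (h i))"
proof -
  let ?N = "curve_space_dim d"
  have "tangent_deriv ?N v (universal_family d f h p)
      = (\<Sum>i<?N. tangent_deriv ?N v (mvar (Par i) * local_eq p (h i)))"
    by (simp add: universal_family_def tangent_deriv_add tangent_deriv_sum tangent_deriv_plane)
  also have "\<dots> = (\<Sum>i<?N. mscale (v i) (local_eq p (h i)))"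
    by (rule sum.cong) (simp_all add: tangent_deriv_mult tangent_deriv_plane special_fibre_plane
        tangent_deriv_mvar mscale_def)
  finally show ?thesis by (simp add: local_eq_simps)
qed

text \<open>All three generators vanish at a singular point.\<close>

lemma tjurina_ideal_constant_term:
  assumes p: "p \<in> singular_points f" and x: "x \<in> tjurina_ideal (local_eq p f)"
  shows "coeff x 0 = 0"
proof -
  have pp: "p \<in> proj_plane" and sing: "peval p f = 0" "\<And>x. peval p (pdv x f) = 0"
    using p by (auto simp: singular_points_def)
  obtain w u v where c: "{w, u, v} = UNIV" "w \<noteq> u" "w \<noteq> v" "u \<noteq> v"
    "local_coord p w = 0" "local_coord p u = mvar LU" "local_coord p v = mvar LV"
    using proj_plane_chart[OF pp] by metis
  have "mderiv LU (local_eq p f) = local_eq p (pdv u f)"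
    by (rule mderiv_local_eq[OF c(2-4,1,5-7)]) simp
  moreover have "mderiv LV (local_eq p f) = local_eq p (pdv v f)"
    by (rule mderiv_local_eq[of w v u]) (use c in auto)
  ultimately have "coeff s 0 = 0" if "s \<in> {local_eq p f, mderiv LU (local_eq p f), mderiv LV (local_eq p f)}" for s
    using that sing by (auto simp: coeff_local_eq_0)
  with x show ?thesis by (induction rule: ideal_gen_induct) auto
qed

theorem stratum_degree_bound:
  assumes f: "f \<in> forms d" "d > 0"
    and smooth: "ea_stratum_smooth_of_dim d f (int (d * (d + 3) div 2) - int (total_tjurina f))"
  shows "d \<le> 7 + jacobian_module_dim f (Suc d)"
proof -
  interpret vector_space pscale by (rule vector_space_pscale)
  let ?N = "curve_space_dim d" and ?S = "singular_points f"
  obtain I k where I: "ea_stratum_ideal d f I" and sm: "smooth_germ ?N I k"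
    and k: "int k = int (d * (d + 3) div 2) - int (total_tjurina f)"
    using smooth unfolding ea_stratum_smooth_of_dim_def by blast
  \<comment> \<open>The dimension of the chart splits into \<tau> conditions and k free
    coordinates.\<close>
  have N: "?N = total_tjurina f + k" using k unfolding curve_space_dim_def by linarith
  obtain h m G \<phi> where chart: "chart_at d f h"
    and mini: "\<And>p. p \<in> ?S \<Longrightarrow> miniversal (local_eq p f) (m p) (G p)"
    and ind: "\<And>p. p \<in> ?S \<Longrightarrow> induces ?N {} (m p) (G p) (\<phi> p) (universal_family d f h p)"
    and Ieq: "I = ideal_gen (param_ring ?N) {\<phi> p i | p i. p \<in> ?S \<and> i < m p}"
    using I unfolding ea_stratum_ideal_def by blast
  obtain \<alpha> where \<alpha>: "\<alpha> ` param_ring ?N = param_ring k"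
    "\<forall>F\<in>param_ring ?N. \<forall>G\<in>param_ring ?N. \<alpha> (F + G) = \<alpha> F + \<alpha> G \<and> \<alpha> (F * G) = \<alpha> F * \<alpha> G"
    "\<forall>c. \<alpha> (mconst c) = mconst c" and ker: "{F \<in> param_ring ?N. \<alpha> F = 0} = I"
    using sm unfolding smooth_germ_def by blast
  interpret germ_hom ?N k \<alpha> by unfold_locales (use \<alpha> in auto)
  let ?D = "\<lambda>p. ks_class (G p)" and ?T = "\<lambda>p. tjurina_ideal (local_eq p f)"
  have hf: "h i \<in> forms d" if "i < ?N" for i
    using chart that span_superset[of "insert f (h ` {..<?N})"] unfolding chart_at_def by blast
  define H where "H v = (\<Sum>i<?N. pscale (v i) (h i))" for v
  have Hf: "H v \<in> forms d" for v unfolding H_def using hf by auto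
  have def: "is_deformation (local_eq p f) (m p) (G p)" if "p \<in> ?S" for p
    using mini[OF that] by (simp add: miniversal_def)
  \<comment> \<open>The universal family is induced over the full chart, with no equations imposed,
    so every vector \<open>v\<close> is admissible.\<close>
  have first_order: "local_eq p (H v) - (\<Sum>i<m p. mscale (dir_deriv ?N v (\<phi> p i)) (?D p i)) \<in> ?T p"
    if p: "p \<in> ?S" for p v
    using first_order_of_induced[OF ind[OF p] def[OF p], of v]
    by (simp add: tangent_deriv_universal_family H_def)
  have \<phi>: "\<phi> p i \<in> param_ring ?N" "coeff (\<phi> p i) 0 = 0" if "p \<in> ?S" "i < m p" for p i
    using ind[OF that(1)] that(2) by (auto simp: induces_def param_max_ideal_def)
  have tj: "tjurina (local_eq p f) = m p" if "p \<in> ?S" for p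
    by (rule tjurina_eq_miniversal_dim[OF mini[OF that]])
  \<comment> \<open>For an infinite singular set the total Tjurina number would be an infinite sum, hence 0.\<close>
  have finS: "finite ?S"
  proof (rule ccontr)
    assume inf: "infinite ?S"
    then have "?N = k" using N by (simp add: total_tjurina_def)
    obtain p where p: "p \<in> ?S" using inf by (metis finite.emptyI ex_in_conv)
    have "dir_deriv ?N v (\<phi> p i) = 0" if "i < m p" for v i
    proof -
      have "\<phi> p i \<in> I" unfolding Ieq using p that by (intro ideal_gen_superset) blast
      then have "\<alpha> (\<phi> p i) = 0" using ker by blast
      then show ?thesis by (rule kernel_linear_part_zero[OF \<open>?N = k\<close> \<phi>(1)[OF p that]])
    qed
    then have HT: "local_eq p (H v) \<in> ?T p" for v
      using first_order[OF p, of v] by (simp add: mscale_def)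
    have fT: "local_eq p f \<in> ?T p" by (rule ideal_gen_superset) simp
    \<comment> \<open>Every form of degree d would vanish at \<open>p\<close>, but
      \<open>w ^ d\<close> does not.\<close>
    let ?U = "{q. coeff (local_eq p q) 0 = 0}"
    have "subspace ?U" by (auto simp: subspace_def local_eq_simps)
    moreover have "h i \<in> ?U" if i: "i < ?N" for i
    proof -
      have "H (\<lambda>j. if j = i then 1 else 0) = (\<Sum>j<?N. if j = i then h i else 0)"
        unfolding H_def by (rule sum.cong) (auto simp: pscale_def)
      then have "H (\<lambda>j. if j = i then 1 else 0) = h i" using i by simp
      then show ?thesis using tjurina_ideal_constant_term[OF p HT] by (metis mem_Collect_eq)
    qed
    moreover have "f \<in> ?U" using tjurina_ideal_constant_term[OF p fT] by simp
    ultimately have "span (insert f (h ` {..<?N})) \<subseteq> ?U" by (intro span_minimal) auto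
    then have U: "forms d \<subseteq> ?U" using chart by (simp add: chart_at_def)
    obtain w where w: "p w = 1"
      using p by (auto simp: singular_points_def proj_plane_def)
    have "pvar w ^ d \<in> forms d" using forms_power[OF forms_pvar, of w d] by simp
    then have "coeff (local_eq p (pvar w ^ d)) 0 = 0" using U by blast
    then have "peval p (pvar w ^ d) = 0" by (simp only: coeff_local_eq_0)
    then show False unfolding peval_simps peval_pvar w by simp
  qed
  have \<tau>: "total_tjurina f = (\<Sum>p\<in>?S. m p)" by (simp add: total_tjurina_def tj)
  obtain A where A: "\<forall>v. (\<forall>F\<in>param_ring ?N. \<alpha> F = 0 \<longrightarrow> dir_deriv ?N v F = 0) \<longrightarrow>
      (\<forall>j<k. dir_deriv ?N v (A j) = 0) \<longrightarrow> (\<forall>i<?N. v i = 0)"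
    using tangent_space_coordinates by (elim exE)
  \<comment> \<open>Prescribing the linear parts of all \<open>\<phi> p i\<close>, and 0 for the k
    coordinates, is a square system. A solution of the homogeneous system is a tangent vector with
    zero coordinates, hence 0.\<close>
  have solve: "\<exists>v. \<forall>p\<in>?S. \<forall>i<m p. dir_deriv ?N v (\<phi> p i) = b p i" for b
  proof -
    let ?R = "(SIGMA p:?S. {..<m p}) <+> {..<k}"
    define F where "F r = (case r of Inl (p, i) \<Rightarrow> \<phi> p i | Inr j \<Rightarrow> A j)" for r
    define M where "M r i = coeff (F r) (single (Par i) 1)" for r i
    have M: "(\<Sum>i\<in>{..<?N}. M r i * v i) = dir_deriv ?N v (F r)" for r v
      by (simp add: M_def dir_deriv_def mult.commute)
    have "card ?R = card {..<?N}" using finS by (simp add: card_Plus N \<tau>)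
    moreover have "finite ?R" using finS by simp
    moreover have "\<forall>i\<in>{..<?N}. v i = 0" if v: "\<forall>r\<in>?R. (\<Sum>i\<in>{..<?N}. M r i * v i) = 0" for v
    proof -
      have v\<phi>: "dir_deriv ?N v (\<phi> p i) = 0" if "p \<in> ?S" "i < m p" for p i
      proof -
        have "Inl (p, i) \<in> ?R" using that by auto
        then show ?thesis using v M[of "Inl (p, i)" v] by (simp add: F_def)
      qed
      \<comment> \<open>The generators of \<open>I\<close> have constant term 0, so by the product
        rule \<open>v\<close> annihilates all of \<open>I\<close>.\<close>
      have "dir_deriv ?N v x = 0" if "x \<in> I" for x
        using that unfolding Ieq
      proof (induction rule: ideal_gen_induct)
        case (add x a s)
        then show ?case using v\<phi> \<phi>(2) by (auto simp: dir_deriv_add dir_deriv_mult)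
      qed (simp add: dir_deriv_def)
      then have "\<forall>F\<in>param_ring ?N. \<alpha> F = 0 \<longrightarrow> dir_deriv ?N v F = 0" using ker by blast
      moreover have "\<forall>j<k. dir_deriv ?N v (A j) = 0"
      proof (intro allI impI)
        fix j assume "j < k"
        then have "Inr j \<in> ?R" by auto
        then show "dir_deriv ?N v (A j) = 0" using v M[of "Inr j" v] by (simp add: F_def)
      qed
      ultimately show ?thesis using A by blast
    qed
    ultimately obtain v where v: "\<forall>r\<in>?R. (\<Sum>i\<in>{..<?N}. M r i * v i) = (case r of Inl (p, i) \<Rightarrow> b p i | Inr j \<Rightarrow> 0)"
      using square_system_solvable[of ?R "{..<?N}" M "\<lambda>r. case r of Inl (p, i) \<Rightarrow> b p i | Inr j \<Rightarrow> 0"] by blast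
    have "dir_deriv ?N v (\<phi> p i) = b p i" if "p \<in> ?S" "i < m p" for p i
    proof -
      have "Inl (p, i) \<in> ?R" using that by auto
      then show ?thesis using v M[of "Inl (p, i)" v] by (simp add: F_def)
    qed
    then show ?thesis by blast
  qed
  obtain a where a: "\<And>p. p \<in> ?S \<Longrightarrow> peval p (line a) \<noteq> 0"
    using general_line_exists[OF finS] by (auto simp: singular_points_def)
  show ?thesis
  proof (rule degree_bound_of_generation[OF f])
    fix q assume q: "q \<in> forms (Suc d)"
    \<comment> \<open>The line avoids the singular points, so its local equation is a unit there.
      The vector \<open>v\<close> below is chosen such that \<open>H v\<close> represents
      \<open>q\<close> divided by the line in every Tjurina algebra.\<close>
    have "\<exists>U. U \<in> plane_ring \<and> local_eq p (line a) * U = 1" if "p \<in> ?S" for p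
    proof -
      have "coeff (local_eq p (line a)) 0 \<noteq> 0" using a[OF that] by (simp add: coeff_local_eq_0)
      then show ?thesis using germs_inverse[OF local_eq_in_plane] by blast
    qed
    then obtain U where U: "\<And>p. p \<in> ?S \<Longrightarrow> U p \<in> plane_ring \<and> local_eq p (line a) * U p = 1" by metis
    have "\<forall>p\<in>?S. \<exists>c. U p * local_eq p q - (\<Sum>i<m p. mscale (c i) (?D p i)) \<in> ?T p"
    proof
      fix p assume p: "p \<in> ?S"
      have "U p * local_eq p q \<in> plane_ring" using U[OF p] by (intro germs_mult local_eq_in_plane) simp
      then show "\<exists>c. U p * local_eq p q - (\<Sum>i<m p. mscale (c i) (?D p i)) \<in> ?T p"
        by (rule ks_classes_span[OF mini[OF p]])
    qed
    from bchoice[OF this] obtain c where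
      c': "\<forall>p\<in>?S. U p * local_eq p q - (\<Sum>i<m p. mscale (c p i) (?D p i)) \<in> ?T p" by (elim exE)
    note c = bspec[OF c']
    obtain v where v: "\<forall>p\<in>?S. \<forall>i<m p. dir_deriv ?N v (\<phi> p i) = c p i"
      using solve[of c] by (elim exE)
    let ?Q = "q - line a * H v"
    have Qf: "?Q \<in> forms (Suc d)"
      using forms_mult[OF line_in_forms Hf, of a v] q by (intro forms_diff) simp_all
    have QT: "local_eq p ?Q \<in> ?T p" if p: "p \<in> ?S" for p
    proof -
      have "local_eq p (H v) - (\<Sum>i<m p. mscale (c p i) (?D p i)) \<in> ?T p"
        using first_order[OF p, of v] bspec[OF v p] by simp
      then have "(U p * local_eq p q - (\<Sum>i<m p. mscale (c p i) (?D p i)))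
          - (local_eq p (H v) - (\<Sum>i<m p. mscale (c p i) (?D p i))) \<in> ?T p"
        by (rule ideal_gen_diff[OF c[OF p]])
      then have "U p * local_eq p q - local_eq p (H v) \<in> ?T p" by simp
      then have "local_eq p (line a) * (U p * local_eq p q - local_eq p (H v)) \<in> ?T p"
        by (rule ideal_gen_mult[OF local_eq_in_plane])
      moreover have "local_eq p (line a) * (U p * local_eq p q - local_eq p (H v)) = local_eq p ?Q"
        using U[OF p] by (simp add: right_diff_distrib mult.assoc[symmetric] local_eq_simps)
      ultimately show ?thesis by simp
    qed
    have "?Q \<in> saturated_jacobian_ideal f"
    proof (rule locally_in_tjurina_ideals_imp_saturated[OF f Qf QT])
      fix p assume p: "p \<in> ?S"
      show "\<exists>(m::nat) D. \<forall>g\<in>plane_ring. \<exists>c. g - (\<Sum>i<m. mscale (c i) (D i)) \<in> ?T p"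
        by (rule exI[of _ "m p"], rule exI[of _ "?D p"]) (intro ballI ks_classes_span[OF mini[OF p]])
    qed
    then show "\<exists>g. q - line a * g \<in> saturated_jacobian_ideal f \<inter> forms (Suc d)" using Qf by blast
  qed
qed

theorem corollary3p10:
  fixes d :: nat and f :: hpoly
  assumes "reduced_form d f"
    and "mdr f > 0"
    and "ea_stratum_smooth_of_dim d f (int (d * (d + 3) div 2) - int (total_tjurina f))"
  shows "(free_curve f \<longrightarrow> d \<le> 7) \<and> (nearly_free_curve f \<longrightarrow> d \<le> 8)"
proof (cases "d = 0")
  case False
  have bound: "d \<le> 7 + jacobian_module_dim f (Suc d)"
    using assms(1,3) False by (intro stratum_degree_bound) (auto simp: reduced_form_def)
  \<comment> \<open>The single degree d + 1 of the Jacobian module is enough, as its dimension is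
    bounded by the supremum.\<close>
  have nu: "enat (jacobian_module_dim f (Suc d)) \<le> nu f"
    unfolding nu_def by (rule SUP_upper) simp
  show ?thesis
  proof (intro conjI impI)
    assume "free_curve f"
    then have "enat (jacobian_module_dim f (Suc d)) \<le> enat 0" using nu by (simp add: free_curve_def zero_enat_def)
    then show "d \<le> 7" using bound by simp
  next
    assume "nearly_free_curve f"
    then have "enat (jacobian_module_dim f (Suc d)) \<le> enat 1" using nu by (simp add: nearly_free_curve_def one_enat_def)
    then show "d \<le> 8" using bound by simp
  qed
qed simp

end
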